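(* In the singular control setting of the context (Assumptions 1–4 in force), a control $\theta^*\in\mathcal{A}$ is optimal for the problem $\inf_{\theta\in\mathcal{A}}J(\theta)$ if and only if $$DJ(\theta^* )_t\ge 0\qquad\forall\,t\ge0\quad P_x\text{-a.s.}$$ and $$E_x\left[\int_0^\infty DJ(\theta^* )_{t}\,e^{-rt}\,d\theta^*_t\right]=0.$$
   Context: Setting. $(\Omega,\mathcal{F},\mathbb{F}=(\mathcal{F}_t)_{t\ge0},(P_x)_{x\in\mathbb{R}})$ are filtered probability spaces, $X=(X_t)_{t\ge 0}$ is a real-valued $\mathbb{F}$-adapted Lévy process with $X_0=x$ under $P_x$, $E_x$ is expectation under $P_x$, $r>0$ is a constant, and $x\in\mathbb{R}$ is fixed. Controls. A singular control $\theta$ is an increasing (i.e. nondecreasing) adapted càdlàg process with $\theta_{0-}=0$ and $\left\|\int_0^\infty e^{-rt}\,d\theta_t\right\|_{L^2(P_x)}<\infty$; $\mathcal{A}$ is the set of all singular controls. Integrals $\int_0^\infty\cdot\,d\theta_t$ are over $[0,\infty)$ and include the jump of $\theta$ at time $0$. Costs. $k=(k_t)_{t\ge0}$ is the intervention cost process and $c:(t,x,\theta)\mapsto c(t,x,\theta)\in\mathbb{R}$ is a deterministic running cost function ($t\ge0$, $x\in\mathbb{R}$, $\theta\ge0$); neither $k$ nor $X$ depends on the control. Assumption 1: $k$ is a positive adapted càdlàg process with $E_x[\sup_{t\ge0}|k_t|^2]<\infty$. Assumption 2: for each $(t,x)$ the map $\theta\mapsto c(t,x,\theta)$ has a continuous,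 strictly increasing first derivative $c_\theta(t,x,\theta)$, and this derivative is bounded, uniformly in $t$ and $x$. Assumption 3: there is $y\in\mathbb{R}_+$ such that for all $x\in\mathbb{R}$, $E_x[\int_0^\infty c(t,X_t,y)e^{-rt}\,dt]<+\infty$. Assumption 4: with $C(t,x,k)=\inf_{z\ge0}(c(t,x,z)+rkz)$, one has $E_x[\int_0^\infty C(t,X_t,k_t)e^{-rt}\,dt]>-\infty$. Objective. For $\theta\in\mathcal{A}$, $$J(\theta)=E_x\left[\int_0^\infty c(t,X_t,\theta_t)e^{-rt}\,dt+\int_0^\infty k_te^{-rt}\,d\theta_t\right]\in\mathbb{R}\cup\{+\infty\}.$$ A control is optimal if it attains $\inf_{\theta\in\mathcal{A}}J(\theta)$. Subgradient process. For $\theta\in\mathcal{A}$, $p^\theta_s=E_x\left[\int_s^\infty c_\theta(u,X_u,\theta_u)e^{-r(u-s)}\,du\,\big|\,\mathcal{F}_s\right]$ (càdlàg version) and $DJ(\theta)_t=k_t+p^\theta_t$ for $t\ge0$. *)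

theory Defs
  imports "HOL-Probability.Probability"
begin

text \<open>
  Integral with values in the extended reals: positive part minus negative part. In \<^typ>\<open>ereal\<close>,
  \<open>\<infinity> - \<infinity> = \<infinity>\<close>, so the value is \<open>\<infinity>\<close> also where the integral is undefined; for a measurable
  function, a value below \<open>\<infinity>\<close> thus means that the positive part has a finite integral.
\<close>

definition ext_integral :: "'a measure \<Rightarrow> ('a \<Rightarrow> ereal) \<Rightarrow> ereal" where
  "ext_integral M f =
     enn2ereal (\<integral>\<^sup>+ x. e2ennreal (f x) \<partial>M) - enn2ereal (\<integral>\<^sup>+ x. e2ennreal (- f x) \<partial>M)"

text \<open>
  Time is \<open>[0, \<infinity>)\<close>: processes, filtrations and paths are indexed by \<^typ>\<open>real\<close>, and their values at
  negative times are never used.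
\<close>

definition cadlag :: "(real \<Rightarrow> real) \<Rightarrow> bool" where
  "cadlag f \<longleftrightarrow>
     (\<forall>t\<ge>0. continuous (at_right t) f) \<and> (\<forall>t>0. \<exists>l. (f \<longlongrightarrow> l) (at_left t))"

definition filtered_prob_space :: "'a measure \<Rightarrow> (real \<Rightarrow> 'a measure) \<Rightarrow> bool" where
  "filtered_prob_space M F \<longleftrightarrow>
     prob_space M \<and> (\<forall>t\<ge>0. subalgebra M (F t)) \<and>
     (\<forall>s t. 0 \<le> s \<and> s \<le> t \<longrightarrow> subalgebra (F t) (F s))"

definition adapted :: "(real \<Rightarrow> 'a measure) \<Rightarrow> (real \<Rightarrow> 'a \<Rightarrow> real) \<Rightarrow> bool" where
  "adapted F Y \<longleftrightarrow> (\<forall>t\<ge>0. Y t \<in> borel_measurable (F t))"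

text \<open>
  Stochastic continuity is not listed: it follows from right-continuity of the paths and
  stationarity of the increments.
\<close>

definition levy_process :: "'a measure \<Rightarrow> (real \<Rightarrow> 'a \<Rightarrow> real) \<Rightarrow> real \<Rightarrow> bool" where
  "levy_process M X x \<longleftrightarrow>
     (\<forall>t\<ge>0. X t \<in> borel_measurable M) \<and>
     (\<forall>\<omega>\<in>space M. cadlag (\<lambda>t. X t \<omega>)) \<and>
     (AE \<omega> in M. X 0 \<omega> = x) \<and>
     (\<forall>n (\<tau> :: nat \<Rightarrow> real). 0 \<le> \<tau> 0 \<and> mono \<tau> \<longrightarrow>
        prob_space.indep_vars M (\<lambda>_. borel) (\<lambda>i \<omega>. X (\<tau> (Suc i)) \<omega> - X (\<tau> i) \<omega>) {..<n}) \<and>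
     (\<forall>t\<ge>0. \<forall>h\<ge>0. distr M borel (\<lambda>\<omega>. X (t + h) \<omega> - X t \<omega>) =
                     distr M borel (\<lambda>\<omega>. X h \<omega> - X 0 \<omega>))"

text \<open>
  The Lebesgue--Stieltjes measure \<open>d\<theta>\<close> on \<open>[0, \<infinity>)\<close> of a right-continuous nondecreasing path.
  Extending the path by \<open>0\<close> to negative times encodes \<open>\<theta>\<^bsub>0-\<^esub> = 0\<close>, so \<open>{0}\<close> has mass \<open>\<theta> 0\<close>.
\<close>

definition stieltjes :: "(real \<Rightarrow> real) \<Rightarrow> real measure" where
  "stieltjes \<theta> = restrict_space (interval_measure (\<lambda>t. if t < 0 then 0 else \<theta> t)) {0..}"

text \<open>Given \<open>\<theta>\<^bsub>0-\<^esub> = 0\<close>, monotonicity at time \<open>0\<close> is \<open>0 \<le> \<theta> 0\<close>.\<close>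

definition singular_controls ::
    "'a measure \<Rightarrow> (real \<Rightarrow> 'a measure) \<Rightarrow> real \<Rightarrow> (real \<Rightarrow> 'a \<Rightarrow> real) set" where
  "singular_controls M F r =
     {\<theta>. adapted F \<theta> \<and>
         (\<forall>\<omega>\<in>space M. cadlag (\<lambda>t. \<theta> t \<omega>) \<and> mono_on {0..} (\<lambda>t. \<theta> t \<omega>) \<and> 0 \<le> \<theta> 0 \<omega>) \<and>
         (\<integral>\<^sup>+ \<omega>. (\<integral>\<^sup>+ t. ennreal (exp (- r * t)) \<partial>stieltjes (\<lambda>t. \<theta> t \<omega>))\<^sup>2 \<partial>M) < \<infinity>}"

definition cost ::
    "'a measure \<Rightarrow> (real \<Rightarrow> 'a \<Rightarrow> real) \<Rightarrow> real \<Rightarrow> (real \<Rightarrow> real \<Rightarrow> real \<Rightarrow> real) \<Rightarrow>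
     (real \<Rightarrow> 'a \<Rightarrow> real) \<Rightarrow> (real \<Rightarrow> 'a \<Rightarrow> real) \<Rightarrow> ereal" where
  "cost M X r c k \<theta> =
     ext_integral M (\<lambda>\<omega>.
       ext_integral (restrict_space lborel {0..})
         (\<lambda>t. ereal (c t (X t \<omega>) (\<theta> t \<omega>) * exp (- r * t))) +
       ext_integral (stieltjes (\<lambda>t. \<theta> t \<omega>)) (\<lambda>t. ereal (k t \<omega> * exp (- r * t))))"

definition optimal_control ::
    "'a measure \<Rightarrow> (real \<Rightarrow> 'a measure) \<Rightarrow> (real \<Rightarrow> 'a \<Rightarrow> real) \<Rightarrow> real \<Rightarrow>
     (real \<Rightarrow> real \<Rightarrow> real \<Rightarrow> real) \<Rightarrow> (real \<Rightarrow> 'a \<Rightarrow> real) \<Rightarrow> (real \<Rightarrow> 'a \<Rightarrow> real) \<Rightarrow> bool" where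
  "optimal_control M F X r c k \<theta> \<longleftrightarrow>
     \<theta> \<in> singular_controls M F r \<and>
     cost M X r c k \<theta> = (INF \<eta>\<in>singular_controls M F r. cost M X r c k \<eta>)"

definition min_cost :: "real \<Rightarrow> (real \<Rightarrow> real \<Rightarrow> real \<Rightarrow> real) \<Rightarrow> real \<Rightarrow> real \<Rightarrow> real \<Rightarrow> ereal" where
  "min_cost r c t x \<kappa> = (INF z\<in>{0..}. ereal (c t x z + r * \<kappa> * z))"

text \<open>
  \<open>p\<close> is a cadlag version of the process \<open>p\<^sup>\<theta>\<close>, where \<open>c'\<close> is the derivative of \<open>c\<close> in its last
  argument. No usual conditions are imposed on the filtration; measurability of \<open>p s\<close> is therefore
  only required with respect to \<open>M\<close> (it is \<open>F s\<close>-measurable up to a null set).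
\<close>

definition subgradient_version ::
    "'a measure \<Rightarrow> (real \<Rightarrow> 'a measure) \<Rightarrow> (real \<Rightarrow> 'a \<Rightarrow> real) \<Rightarrow> real \<Rightarrow>
     (real \<Rightarrow> real \<Rightarrow> real \<Rightarrow> real) \<Rightarrow> (real \<Rightarrow> 'a \<Rightarrow> real) \<Rightarrow> (real \<Rightarrow> 'a \<Rightarrow> real) \<Rightarrow> bool" where
  "subgradient_version M F X r c' \<theta> p \<longleftrightarrow>
     (\<forall>\<omega>\<in>space M. cadlag (\<lambda>s. p s \<omega>)) \<and>
     (\<forall>s\<ge>0. p s \<in> borel_measurable M \<and>
        (AE \<omega> in M. p s \<omega> =
           real_cond_exp M (F s)
             (\<lambda>\<omega>. LINT u:{s..}|lborel. c' u (X u \<omega>) (\<theta> u \<omega>) * exp (- r * (u - s))) \<omega>))"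

end

theory Submission
  imports Defs
begin

text \<open>
  The cost is convex in the control, and the controls form a convex cone. A control \<open>\<theta>\<close> is therefore
  optimal if and only if the derivative of the cost at \<open>\<theta>\<close>, a linear functional \<open>L\<close> on the cone, is
  minimal at \<open>\<theta>\<close>; and a linear functional on a cone is minimal at \<open>\<theta>\<close> if and only if
  \<open>L \<ge> 0\<close> on the cone and \<open>L \<theta> = 0\<close> (\<open>optimal_iff_marginal_cost\<close>, \<open>marginal_cost_minimal_iff\<close>).

  The derivative is \<open>L \<eta> = E (\<integral> c'(t, X\<^sub>t, \<theta>\<^sub>t) \<eta>\<^sub>t e\<^bsup>-rt\<^esup> dt + \<integral> k\<^sub>t e\<^bsup>-rt\<^esup> d\<eta>\<^sub>t)\<close>. The heart of the proof is that it
  equals \<open>E (\<integral> (k\<^sub>t + p\<^sub>t) e\<^bsup>-rt\<^esup> d\<eta>\<^sub>t)\<close>. Integration by parts turns the time integral into the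
  integral of the discounted tail of \<open>c'\<close> against \<open>d\<eta>\<close>, and the tail may be replaced by
  its conditional expectation \<open>p\<close> since \<open>\<eta>\<close> is adapted. For the last step the control is
  decomposed into unit jumps: with the passage time \<open>\<tau>\<^sub>u = inf {s. u \<le> \<eta>\<^sub>s}\<close>, the measure \<open>d\<eta>\<close> is the image
  of Lebesgue measure on the attained levels \<open>u\<close> (\<open>stieltjes_eq_distr\<close>). Each \<open>\<tau>\<^sub>u\<close> is a stopping
  time, where replacing the tail by \<open>p\<close> preserves expectations (\<open>projection_at_random_time\<close>), and
  integrating over \<open>u\<close> gives the claim (\<open>projection_duality\<close>).

  With this formula, \<open>L \<theta> = 0\<close> is the complementarity condition. That \<open>L \<ge> 0\<close> means
  \<open>k + p \<ge> 0\<close> follows by testing \<open>L\<close> with a unit jump at time \<open>s\<close> on an event of \<open>F s\<close> where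
  \<open>k\<^sub>s + p\<^sub>s\<close> is negative (\<open>marginal_cost_nonneg_iff\<close>).

  The cost takes values in the extended reals, so it also has to be shown to be finite. The assumptions on
  the constant control \<open>y\<close> and on the minimal cost make the running cost of \<open>y\<close> integrable
  (\<open>reference_integrable\<close>); every other cost differs from it by an integrable amount, because \<open>c\<close>
  is Lipschitz in the control and because \<open>sup k\<close> and the discounted mass of a control are
  square-integrable (\<open>cost_eq\<close>).
\<close>

section \<open>Integrals with values in the extended reals\<close>

lemma ext_integral_eq_integral:
  assumes "integrable N g"
  shows "ext_integral N (\<lambda>x. ereal (g x)) = ereal (LINT x|N. g x)"
proof -
  have fin: "(\<integral>\<^sup>+ x. ennreal (g x) \<partial>N) < \<infinity>" "(\<integral>\<^sup>+ x. ennreal (- g x) \<partial>N) < \<infinity>"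
    using integrableD(2,3)[OF assms] by (auto simp: less_top)
  have *: "enn2ereal a = ereal (enn2real a)" if "a < \<infinity>" for a
    using that by (cases a) auto
  show ?thesis
    unfolding ext_integral_def
    using real_lebesgue_integral_def[OF assms] *[OF fin(1)] *[OF fin(2)] by simp
qed

lemma ext_integral_cong_AE:
  assumes "AE x in N. f x = g x"
  shows "ext_integral N f = ext_integral N g"
proof -
  have "(\<integral>\<^sup>+ x. e2ennreal (f x) \<partial>N) = (\<integral>\<^sup>+ x. e2ennreal (g x) \<partial>N)"
    "(\<integral>\<^sup>+ x. e2ennreal (- f x) \<partial>N) = (\<integral>\<^sup>+ x. e2ennreal (- g x) \<partial>N)"
    using assms by (auto intro!: nn_integral_cong_AE)
  then show ?thesis by (simp add: ext_integral_def)
qed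

text \<open>
  The integrands are arbitrary, because the nonnegative integral of any function is the supremum over
  the simple functions below it. The minimal cost, an uncountable infimum, is an integrand of this kind.
\<close>

lemma ext_integral_mono:
  assumes "\<And>x. x \<in> space N \<Longrightarrow> f x \<le> g x"
  shows "ext_integral N f \<le> ext_integral N g"
proof -
  have "(\<integral>\<^sup>+ x. e2ennreal (f x) \<partial>N) \<le> (\<integral>\<^sup>+ x. e2ennreal (g x) \<partial>N)"
    "(\<integral>\<^sup>+ x. e2ennreal (- g x) \<partial>N) \<le> (\<integral>\<^sup>+ x. e2ennreal (- f x) \<partial>N)"
    using assms by (auto intro!: nn_integral_mono e2ennreal_mono)
  then show ?thesis 
    unfolding ext_integral_def by (intro ereal_minus_mono) (auto simp: less_eq_ennreal.rep_eq)
qed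

lemma ext_integral_less_top:
  assumes "ext_integral N f < \<infinity>"
  shows "(\<integral>\<^sup>+ x. e2ennreal (f x) \<partial>N) < \<infinity>"
proof (rule ccontr)
  assume "\<not> ?thesis"
  then have "(\<integral>\<^sup>+ x. e2ennreal (f x) \<partial>N) = \<infinity>" by (simp add: less_top[symmetric])
  then show False using assms by (simp add: ext_integral_def)
qed

text \<open>
  The finite positive part excludes the case \<open>\<infinity> - \<infinity> = \<infinity>\<close>, in which the integral exceeds \<open>- \<infinity>\<close> in
  spite of an infinite negative part.
\<close>

lemma ext_integral_greater_bot:
  assumes "- \<infinity> < ext_integral N f" "(\<integral>\<^sup>+ x. e2ennreal (f x) \<partial>N) < \<infinity>"
  shows "(\<integral>\<^sup>+ x. e2ennreal (- f x) \<partial>N) < \<infinity>"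
proof (rule ccontr)
  assume "\<not> ?thesis"
  then have "(\<integral>\<^sup>+ x. e2ennreal (- f x) \<partial>N) = \<infinity>" by (simp add: less_top[symmetric])
  moreover obtain a where "(\<integral>\<^sup>+ x. e2ennreal (f x) \<partial>N) = ennreal a" "a \<ge> 0"
    using assms(2) by (cases "(\<integral>\<^sup>+ x. e2ennreal (f x) \<partial>N)") auto
  ultimately show False using assms(1) by (simp add: ext_integral_def enn2ereal_ennreal)
qed

section \<open>Right-continuous and increasing paths\<close>

definition right_continuous_path :: "(real \<Rightarrow> real) \<Rightarrow> bool" where
  "right_continuous_path f \<longleftrightarrow> (\<forall>t\<ge>0. continuous (at_right t) f)"

definition increasing_path :: "(real \<Rightarrow> real) \<Rightarrow> bool" where
  "increasing_path f \<longleftrightarrow> right_continuous_path f \<and> mono_on {0..} f \<and> 0 \<le> f 0"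

lemma increasing_pathD:
  assumes "increasing_path f"
  shows "0 \<le> s \<Longrightarrow> s \<le> t \<Longrightarrow> f s \<le> f t" and "0 \<le> t \<Longrightarrow> 0 \<le> f t"
proof -
  show *: "0 \<le> s \<Longrightarrow> s \<le> t \<Longrightarrow> f s \<le> f t" for s t
    using assms by (auto simp: increasing_path_def mono_on_def)
  show "0 \<le> f t" if "0 \<le> t"
  proof -
    have "0 \<le> f 0" using assms by (simp add: increasing_path_def)
    also have "f 0 \<le> f t" using *[of 0 t] that by simp
    finally show ?thesis .
  qed
qed

text \<open>
  Time rounded to multiples of \<open>1 / (n + 1)\<close>. Rounding up keeps right-continuity applicable in the
  limit, and it turns a stopping time into a stopping time with countably many values.
\<close>

definition grid_above :: "nat \<Rightarrow> real \<Rightarrow> real" where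
  "grid_above n t = real (nat \<lceil>real (Suc n) * t\<rceil>) / real (Suc n)"

lemma grid_above_ge: "0 \<le> t \<Longrightarrow> t \<le> grid_above n t"
proof -
  assume "0 \<le> t"
  have "real (Suc n) * t \<le> real (nat \<lceil>real (Suc n) * t\<rceil>)" by linarith
  then show ?thesis by (simp add: grid_above_def field_simps)
qed

lemma grid_above_nonneg: "0 \<le> grid_above n t"
  by (simp add: grid_above_def)

lemma grid_above_le: "0 \<le> t \<Longrightarrow> grid_above n t \<le> t + 1 / real (Suc n)"
proof -
  assume t: "0 \<le> t"
  then have "0 \<le> real (Suc n) * t" by simp
  then have "real (nat \<lceil>real (Suc n) * t\<rceil>) \<le> real (Suc n) * t + 1" by linarith
  then have "grid_above n t \<le> (real (Suc n) * t + 1) / real (Suc n)"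
    unfolding grid_above_def by (rule divide_right_mono) simp
  also have "\<dots> = t + 1 / real (Suc n)" by (simp add: add_divide_distrib)
  finally show ?thesis .
qed

lemma grid_above_tendsto: "0 \<le> t \<Longrightarrow> (\<lambda>n. grid_above n t) \<longlonglongrightarrow> t"
proof (rule tendsto_sandwich[of "\<lambda>_. t" _ _ "\<lambda>n. t + 1 / real (Suc n)"])
  have "(\<lambda>n. t + 1 / real (Suc n)) \<longlonglongrightarrow> t + 0"
    by (intro tendsto_add tendsto_const LIMSEQ_Suc[OF lim_1_over_n])
  then show "(\<lambda>n. t + 1 / real (Suc n)) \<longlonglongrightarrow> t" by simp
qed (auto simp: grid_above_ge grid_above_le simp del: of_nat_Suc)

lemma right_continuous_path_sequence:
  assumes f: "right_continuous_path f" "0 \<le> t" and s: "\<And>n. t \<le> s n" "s \<longlonglongrightarrow> t"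
  shows "(\<lambda>n. f (s n)) \<longlonglongrightarrow> f t"
proof -
  have "(f \<longlongrightarrow> f t) (at t within {t<..})"
    using f by (auto simp: right_continuous_path_def continuous_within)
  moreover have "at t within {t<..} = at t within {t..}"
    by (rule at_within_nhd[of _ UNIV]) auto
  ultimately have "continuous (at t within {t..}) f"
    by (simp add: continuous_within)
  then show ?thesis
    using s unfolding continuous_within_sequentially comp_def by auto
qed

lemma right_continuous_path_grid:
  assumes "right_continuous_path f" "0 \<le> t"
  shows "(\<lambda>n. f (grid_above n t)) \<longlonglongrightarrow> f t"
  by (rule right_continuous_path_sequence[OF assms grid_above_ge[OF assms(2)]
    grid_above_tendsto[OF assms(2)]])

definition attained_levels :: "(real \<Rightarrow> real) \<Rightarrow> real set" where
  "attained_levels f = {u. 0 < u \<and> (\<exists>s\<ge>0. u \<le> f s)}"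

text \<open>
  The generalised inverse of the path. The value \<open>0\<close> at levels that are never attained
  keeps the function in \<open>[0, \<infinity>)\<close> and measurable; those levels are cut off wherever it is integrated.
\<close>

definition passage_time :: "(real \<Rightarrow> real) \<Rightarrow> real \<Rightarrow> real" where
  "passage_time f u = (if u \<in> attained_levels f then Inf {s. 0 \<le> s \<and> u \<le> f s} else 0)"

lemma passage_time_nonneg: "0 \<le> passage_time f u"
  by (auto simp: passage_time_def attained_levels_def intro!: cInf_greatest)

text \<open>
  Right-continuity makes the infimum attained. For an adapted increasing process the equivalence makes
  every passage time a stopping time.
\<close>

lemma passage_time_le_iff:
  assumes f: "increasing_path f" and u: "u \<in> attained_levels f" and s: "0 \<le> s"
  shows "passage_time f u \<le> s \<longleftrightarrow> u \<le> f s"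
proof
  let ?S = "{s. 0 \<le> s \<and> u \<le> f s}"
  have eq: "passage_time f u = Inf ?S" using u by (simp add: passage_time_def)
  have ne: "?S \<noteq> {}" using u by (auto simp: attained_levels_def)
  have bdd: "bdd_below ?S" by (auto intro!: bdd_belowI[of _ 0])
  show "passage_time f u \<le> s" if "u \<le> f s"
    unfolding eq using that s bdd by (intro cInf_lower) auto
  assume le: "passage_time f u \<le> s"
  have "u \<le> f (s + 1 / real (Suc n))" for n
  proof -
    have "Inf ?S < s + 1 / real (Suc n)"
      using le unfolding eq by (rule le_less_trans) simp
    then obtain v where "v \<in> ?S" "v < s + 1 / real (Suc n)"
      using cInf_less_iff[OF ne bdd] by blast
    then show ?thesis using increasing_pathD(1)[OF f, of v "s + 1 / real (Suc n)"] by auto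
  qed
  moreover have "(\<lambda>n. f (s + 1 / real (Suc n))) \<longlonglongrightarrow> f s"
  proof (rule right_continuous_path_sequence[where f=f and s="\<lambda>n. s + 1 / real (Suc n)"])
    have "(\<lambda>n. s + 1 / real (Suc n)) \<longlonglongrightarrow> s + 0"
      by (intro tendsto_add tendsto_const LIMSEQ_Suc[OF lim_1_over_n])
    then show "(\<lambda>n. s + 1 / real (Suc n)) \<longlonglongrightarrow> s" by simp
  qed (use f s in \<open>auto simp: increasing_path_def\<close>)
  ultimately show "u \<le> f s" by (intro LIMSEQ_le_const) auto
qed

lemma attained_levels_eq:
  assumes "increasing_path f"
  shows "attained_levels f = (\<Union>n::nat. {0<..f (real n)})"
proof -
  have "\<exists>n::nat. u \<le> f (real n)" if "0 \<le> s" "u \<le> f s" for u s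
  proof -
    obtain n :: nat where "s \<le> real n" using real_arch_simple by blast
    then show ?thesis using increasing_pathD(1)[OF assms \<open>0 \<le> s\<close>, of "real n"] that
      by (intro exI[of _ n]) simp
  qed
  then have "u \<in> attained_levels f \<longleftrightarrow> u \<in> (\<Union>n::nat. {0<..f (real n)})" for u
    unfolding attained_levels_def using of_nat_0_le_iff
      by (simp only: mem_Collect_eq UN_iff greaterThanAtMost_iff) blast
  then show ?thesis by blast
qed

section \<open>Stieltjes measures as images of Lebesgue measure\<close>

abbreviation halfline :: "real measure" where
  "halfline \<equiv> restrict_space lborel {0..}"

lemma space_halfline: "space halfline = {0..}"
  by (simp add: space_restrict_space)

lemma halfline_measurable_id: "(\<lambda>t. t) \<in> borel_measurable halfline"
  by (simp add: measurable_restrict_space1)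

lemma sigma_finite_halfline: "sigma_finite_measure halfline"
  by (rule sigma_finite_measure_restrict_space) (auto intro: sigma_finite_lborel)

lemma sets_stieltjes [measurable_cong]: "sets (stieltjes f) = sets halfline"
  by (simp add: stieltjes_def sets_restrict_space)

lemma space_stieltjes: "space (stieltjes f) = {0..}"
  by (simp add: stieltjes_def space_restrict_space)

lemma emeasure_stieltjes:
  assumes f: "increasing_path f" and t: "0 \<le> t"
  shows "emeasure (stieltjes f) {0..t} = ennreal (f t)"
proof -
  define G where "G = (\<lambda>t. if t < 0 then 0 else f t)"
  have mono: "G a \<le> G b" if "a \<le> b" for a b
    using that increasing_pathD[OF f] by (auto simp: G_def)
  have cont: "continuous (at_right a) G" for a
  proof (cases "a < 0")
    case True
    have "eventually (\<lambda>t. G t = 0) (at_right a)"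
      unfolding eventually_at_right_field using True by (intro exI[of _ 0]) (auto simp: G_def)
    then show ?thesis
      using True by (auto simp: continuous_within G_def intro: tendsto_eventually)
  next
    case False
    then have "(f \<longlongrightarrow> f a) (at_right a)"
      using f by (auto simp: increasing_path_def right_continuous_path_def continuous_within)
    moreover have "eventually (\<lambda>t. f t = G t) (at_right a)"
      unfolding eventually_at_right_field using False by (intro exI[of _ "a+1"]) (auto simp: G_def)
    ultimately have "(G \<longlongrightarrow> f a) (at_right a)" by (rule Lim_transform_eventually)
    then show ?thesis using False by (simp add: continuous_within G_def)
  qed
  (* G vanishes before 0, so {0..t} has the mass of the half-open interval {-1<..t}. *)
  have null: "{-1<..<0} \<in> null_sets (interval_measure G)"
  proof -
    have "{-1<..<0} = (\<Union>n. {-1<..- 1 / real (Suc n)})"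
    proof (safe; clarsimp)
      fix x :: real assume x: "-1 < x" "x < 0"
      then obtain n where "inverse (real (Suc n)) < - x" using reals_Archimedean[of "- x"] by auto
      then show "\<exists>n. x \<le> - (1 / (1 + real n))" by (intro exI[of _ n]) (simp add: field_simps)
    next
      fix x :: real and n assume "x \<le> - (1 / (1 + real n))"
      moreover have "1 / (1 + real n) > 0" by simp
      ultimately show "x < 0" by linarith
    qed
    moreover have "{-1<..- 1 / real (Suc n)} \<in> null_sets (interval_measure G)" for n
    proof
      have "- 1 \<le> - 1 / real (Suc n)" by (simp add: field_simps)
      then show "emeasure (interval_measure G) {-1<..- 1 / real (Suc n)} = 0"
        by (subst emeasure_interval_measure_Ioc[OF _ mono cont]) (auto simp: G_def)
    qed simp
    ultimately show ?thesis by auto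
  qed
  have "emeasure (stieltjes f) {0..t} = emeasure (interval_measure G) {0..t}"
    unfolding stieltjes_def G_def by (subst emeasure_restrict_space) auto
  also have "\<dots> = emeasure (interval_measure G) ({0..t} \<union> {-1<..<0})"
    by (subst emeasure_Un_null_set[OF _ null]) auto
  also have "{0..t} \<union> {-1<..<0} = {-1<..t}" using t by auto
  also have "emeasure (interval_measure G) {-1<..t} = ennreal (f t)"
    using t by (subst emeasure_interval_measure_Ioc[OF _ mono cont]) (auto simp: G_def)
  finally show ?thesis .
qed

text \<open>
  The half-line is exhausted by the sets \<open>{0..t}\<close>, which are stable under intersection. The measures
  are pushed to the whole line first, because there these sets become the standard generator
  \<open>{..a}\<close> of the Borel sets.
\<close>

lemma stieltjes_eqI:
  assumes f: "increasing_path f" and sets: "sets N = sets halfline"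
    and eq: "\<And>t. 0 \<le> t \<Longrightarrow> emeasure N {0..t} = ennreal (f t)"
  shows "N = stieltjes f"
proof -
  let ?id = "\<lambda>x::real. x"
  have meas: "?id \<in> N' \<rightarrow>\<^sub>M borel" and space: "space N' = {0..}" if "sets N' = sets halfline"
    for N' :: "real measure"
  proof -
    show "space N' = {0..}" using sets_eq_imp_space_eq[OF that] by (simp add: space_restrict_space)
    show "?id \<in> N' \<rightarrow>\<^sub>M borel"
      by (subst measurable_cong_sets[OF that refl]) (auto intro: measurable_restrict_space1)
  qed
  have gen: "distr N borel ?id = distr (stieltjes f) borel ?id"
  proof (rule measure_eqI_generator_eq[where E="range atMost" and \<Omega>=UNIV and A="\<lambda>n::nat. {..real n}"])
    show "Int_stable (range atMost :: real set set)" by (auto simp: Int_stable_def)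
    have *: "emeasure (distr N' borel ?id) {..a} = (if a < 0 then 0 else ennreal (f a))"
      if "sets N' = sets halfline" "\<And>t. 0 \<le> t \<Longrightarrow> emeasure N' {0..t} = ennreal (f t)" for N' and a :: real
    proof -
      have "{..a} \<inter> {0..} = {0..a}" by auto
      then have "emeasure (distr N' borel ?id) {..a} = emeasure N' {0..a}"
        using space[OF that(1)] by (subst emeasure_distr[OF meas[OF that(1)]]) auto
      then show ?thesis using that(2)[of a] by auto
    qed
    show "emeasure (distr N borel ?id) X = emeasure (distr (stieltjes f) borel ?id) X"
      if "X \<in> range atMost" for X
      using that *[OF sets eq] *[OF sets_stieltjes emeasure_stieltjes[OF f]] by auto
    show "emeasure (distr N borel ?id) {..real i} \<noteq> \<infinity>" for i
      using *[OF sets eq] by auto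
    show "sets (distr N borel ?id) = sigma_sets UNIV (range atMost)"
      "sets (distr (stieltjes f) borel ?id) = sigma_sets UNIV (range atMost)"
      by (auto simp: borel_eq_atMost)
    show "(\<Union>i. {..real i}) = UNIV" using real_arch_simple by auto
  qed auto
  show ?thesis
  proof (rule measure_eqI)
    fix A assume A: "A \<in> sets N"
    then have A': "A \<in> sets borel" "A \<subseteq> {0..}"
      unfolding sets by (auto simp: sets_restrict_space)
    have "emeasure N' A = emeasure (distr N' borel ?id) A" if "sets N' = sets halfline" for N'
      using A' space[OF that] by (subst emeasure_distr[OF meas[OF that]]) (auto simp: Int_absorb2)
    from this[OF sets] this[OF sets_stieltjes] show "emeasure N A = emeasure (stieltjes f) A"
      using gen by simp
  qed (simp add: sets sets_stieltjes)
qed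

lemma attained_levels_measurable:
  assumes "increasing_path f" shows "attained_levels f \<in> sets borel"
  unfolding attained_levels_eq[OF assms] by measurable

lemma passage_time_measurable:
  assumes f: "increasing_path f"
  shows "passage_time f \<in> borel \<rightarrow>\<^sub>M halfline"
proof -
  have [measurable]: "attained_levels f \<in> sets borel" by (rule attained_levels_measurable[OF f])
  have "{u. passage_time f u \<le> a} = (if a < 0 then {} else - attained_levels f \<union> {..f a})" for a
  proof (cases "a < 0")
    case True
    have "\<not> passage_time f u \<le> a" for u using passage_time_nonneg[of f u] True by linarith
    with True show ?thesis by simp
  next
    case False
    have "passage_time f u \<le> a \<longleftrightarrow> u \<notin> attained_levels f \<or> u \<le> f a" for u
      using passage_time_le_iff[OF f, of u a] False
      by (cases "u \<in> attained_levels f") (auto simp: passage_time_def)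
    with False show ?thesis by auto
  qed
  then have "passage_time f \<in> borel_measurable borel"
    by (intro borel_measurableI_le) simp
  then show ?thesis
    by (intro measurable_restrict_space2) (auto simp: passage_time_nonneg)
qed

text \<open>
  The levels \<open>u\<close> with passage time at most \<open>t\<close> form the interval \<open>(0, f t]\<close>, whose length is \<open>f t\<close>. So
  integration against \<open>df\<close> becomes integration over levels against Lebesgue measure, which
  does not depend on the path any more; this is what makes pathwise integrals jointly measurable.
\<close>

lemma stieltjes_eq_distr:
  assumes f: "increasing_path f"
  shows "stieltjes f = distr (restrict_space lborel (attained_levels f)) halfline (passage_time f)"
proof (rule stieltjes_eqI[OF f, symmetric])
  fix t :: real assume t: "0 \<le> t"
  have m: "passage_time f \<in> restrict_space lborel (attained_levels f) \<rightarrow>\<^sub>M halfline"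
    using passage_time_measurable[OF f] by (intro measurable_restrict_space1) auto
  have "emeasure (distr (restrict_space lborel (attained_levels f)) halfline (passage_time f)) {0..t}
    = emeasure (restrict_space lborel (attained_levels f))
        (passage_time f -` {0..t} \<inter> attained_levels f)"
    using m by (subst emeasure_distr) (auto simp: space_restrict_space sets_restrict_space)
  also have "passage_time f -` {0..t} \<inter> attained_levels f = {0<..f t}"
  proof (intro set_eqI)
    fix u
    show "u \<in> passage_time f -` {0..t} \<inter> attained_levels f \<longleftrightarrow> u \<in> {0<..f t}"
      using passage_time_le_iff[OF f _ t, of u] t
      by (cases "u \<in> attained_levels f") (auto simp: passage_time_nonneg attained_levels_def)
  qed
  also have "emeasure (restrict_space lborel (attained_levels f)) {0<..f t} = emeasure lborel {0<..f t}"
    using attained_levels_measurable[OF f] t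
    by (subst emeasure_restrict_space) (auto simp: attained_levels_def)
  also have "\<dots> = ennreal (f t)" using increasing_pathD[OF f] t by simp
  finally show "emeasure (distr (restrict_space lborel (attained_levels f))
    halfline (passage_time f)) {0..t}
    = ennreal (f t)" .
qed simp

lemma nn_integral_stieltjes:
  assumes f: "increasing_path f" and g: "g \<in> borel_measurable halfline"
  shows "(\<integral>\<^sup>+ t. g t \<partial>stieltjes f) =
    (\<integral>\<^sup>+ u. indicator (attained_levels f) u * g (passage_time f u) \<partial>lborel)"
proof -
  have m: "passage_time f \<in> restrict_space lborel (attained_levels f) \<rightarrow>\<^sub>M halfline"
    using passage_time_measurable[OF f] by (intro measurable_restrict_space1) auto
  show ?thesis
    unfolding stieltjes_eq_distr[OF f] using g m attained_levels_measurable[OF f]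
    by (simp add: nn_integral_distr nn_integral_restrict_space mult.commute)
qed

lemma integrable_stieltjes_iff:
  fixes g :: "real \<Rightarrow> real"
  assumes f: "increasing_path f" and g: "g \<in> borel_measurable halfline"
  shows "integrable (stieltjes f) g \<longleftrightarrow>
    integrable lborel (\<lambda>u. indicator (attained_levels f) u * g (passage_time f u))"
proof -
  have m: "passage_time f \<in> restrict_space lborel (attained_levels f) \<rightarrow>\<^sub>M halfline"
    using passage_time_measurable[OF f] by (intro measurable_restrict_space1) auto
  show ?thesis
    unfolding stieltjes_eq_distr[OF f] using g m attained_levels_measurable[OF f]
    by (simp add: integrable_distr_eq integrable_restrict_space)
qed

lemma integral_stieltjes:
  fixes g :: "real \<Rightarrow> real"
  assumes f: "increasing_path f" and g: "g \<in> borel_measurable halfline"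
  shows "(LINT t|stieltjes f. g t) =
    (LINT u|lborel. indicator (attained_levels f) u * g (passage_time f u))"
proof -
  have m: "passage_time f \<in> restrict_space lborel (attained_levels f) \<rightarrow>\<^sub>M halfline"
    using passage_time_measurable[OF f] by (intro measurable_restrict_space1) auto
  show ?thesis
    unfolding stieltjes_eq_distr[OF f] using g m attained_levels_measurable[OF f]
    by (simp add: integral_distr integral_restrict_space)
qed

section \<open>Stieltjes measures of combinations and of jumps\<close>

text \<open>
  The identity for sets extends to functions along the standard induction over nonnegative
  measurable functions.
\<close>

lemma nn_integral_measure_add:
  fixes a b :: ennreal
  assumes "a < \<infinity>" "b < \<infinity>"
    and sets: "sets N1 = sets N" "sets N2 = sets N"
    and eq: "\<And>A. A \<in> sets N \<Longrightarrow> emeasure N A = a * emeasure N1 A + b * emeasure N2 A"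
    and h: "h \<in> borel_measurable N"
  shows "(\<integral>\<^sup>+ x. h x \<partial>N) = a * (\<integral>\<^sup>+ x. h x \<partial>N1) + b * (\<integral>\<^sup>+ x. h x \<partial>N2)"
proof -
  have m1: "g \<in> borel_measurable N \<Longrightarrow> g \<in> borel_measurable N1" for g :: "_ \<Rightarrow> ennreal"
    using measurable_cong_sets[OF sets(1) refl] by auto
  have m2: "g \<in> borel_measurable N \<Longrightarrow> g \<in> borel_measurable N2" for g :: "_ \<Rightarrow> ennreal"
    using measurable_cong_sets[OF sets(2) refl] by auto
  have sp: "space N1 = space N" "space N2 = space N" using sets by (auto dest: sets_eq_imp_space_eq)
  from h show ?thesis
  proof (induct rule: borel_measurable_induct)
    case (cong f g)
    have "(\<integral>\<^sup>+ x. f x \<partial>K) = (\<integral>\<^sup>+ x. g x \<partial>K)" if "space K = space N" for K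
      using cong(3) that by (intro nn_integral_cong) auto
    from this[OF refl] this[OF sp(1)] this[OF sp(2)] show ?case using cong(4) by simp
  next
    case (set A)
    then show ?case using sets eq by simp
  next
    case (mult u v)
    then show ?case unfolding nn_integral_cmult[OF mult(2)] nn_integral_cmult[OF m1[OF mult(2)]]
        nn_integral_cmult[OF m2[OF mult(2)]]
      by (simp only: distrib_left mult.left_commute)
  next
    case (add u v)
    then show ?case unfolding nn_integral_add[OF add(4,1)]
      nn_integral_add[OF m1[OF add(4)] m1[OF add(1)]]
        nn_integral_add[OF m2[OF add(4)] m2[OF add(1)]]
      by (simp only: distrib_left ac_simps)
  next
    case (seq U)
    have conv: "(\<lambda>i. \<integral>\<^sup>+ x. U i x \<partial>K) \<longlonglongrightarrow> (\<integral>\<^sup>+ x. (SUP i. U i) x \<partial>K)" if "sets K = sets N" for K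
    proof -
      have "U i \<in> borel_measurable K" for i using measurable_cong_sets[OF that refl] seq(1) by auto
      then have "(\<integral>\<^sup>+ x. (SUP i. U i x) \<partial>K) = (SUP i. \<integral>\<^sup>+ x. U i x \<partial>K)"
        using seq(4) by (intro nn_integral_monotone_convergence_SUP) auto
      moreover have "incseq (\<lambda>i. \<integral>\<^sup>+ x. U i x \<partial>K)"
        using seq(4) by (auto simp: incseq_def le_fun_def intro!: nn_integral_mono)
      ultimately show ?thesis using LIMSEQ_SUP by (simp add: image_comp)
    qed
    have "(\<lambda>i. \<integral>\<^sup>+ x. U i x \<partial>N) \<longlonglongrightarrow> a * (\<integral>\<^sup>+ x. (SUP i. U i) x \<partial>N1) + b * (\<integral>\<^sup>+ x. (SUP i. U i) x \<partial>N2)"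
      unfolding seq(3) using conv[OF sets(1)] conv[OF sets(2)] assms(1,2)
        by (intro tendsto_add ennreal_tendsto_cmult) auto
    then show ?case using conv[OF refl] LIMSEQ_unique by blast
  qed
qed

lemma increasing_path_linear:
  assumes f: "increasing_path f" and g: "increasing_path g" and "0 \<le> a" "0 \<le> b"
  shows "increasing_path (\<lambda>t. a * f t + b * g t)"
  using assms unfolding increasing_path_def right_continuous_path_def
  by (auto intro!: continuous_intros add_mono mult_left_mono simp: mono_on_def)

text \<open>
  The combination of the two measures has the distribution function of the combined path, so the
  uniqueness of Stieltjes measures identifies the two.
\<close>

lemma nn_integral_stieltjes_linear:
  assumes f: "increasing_path f" and g: "increasing_path g" and a: "0 \<le> a" and b: "0 \<le> b"
    and h: "h \<in> borel_measurable halfline"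
  shows "(\<integral>\<^sup>+ t. h t \<partial>stieltjes (\<lambda>t. a * f t + b * g t)) =
    ennreal a * (\<integral>\<^sup>+ t. h t \<partial>stieltjes f) + ennreal b * (\<integral>\<^sup>+ t. h t \<partial>stieltjes g)"
proof -
  define \<mu> where "\<mu> A = ennreal a * emeasure (stieltjes f) A + ennreal b * emeasure (stieltjes g) A"
    for A
  define N where "N = measure_of (space halfline) (sets halfline) \<mu>"
  have sets_N: "sets N = sets halfline" unfolding N_def by (rule sets.sets_measure_of_eq)
  have emeasure_N: "emeasure N A = \<mu> A" if "A \<in> sets halfline" for A
    unfolding N_def
  proof (rule emeasure_measure_of_sigma[OF sets.sigma_algebra_axioms _ _ that])
    show "positive (sets halfline) \<mu>" by (simp add: positive_def \<mu>_def)
    show "countably_additive (sets halfline) \<mu>"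
    proof (rule countably_additiveI)
      fix A :: "nat \<Rightarrow> real set"
      assume A: "range A \<subseteq> sets halfline" "disjoint_family A" 
      have "(\<Sum>i. emeasure (stieltjes k) (A i)) = emeasure (stieltjes k) (\<Union>i. A i)" for k
        using A by (intro suminf_emeasure) (auto simp: sets_stieltjes)
      then show "(\<Sum>i. \<mu> (A i)) = \<mu> (\<Union>i. A i)"
        unfolding \<mu>_def by (simp add: suminf_add[symmetric])
    qed
  qed
  have "N = stieltjes (\<lambda>t. a * f t + b * g t)"
  proof (rule stieltjes_eqI[OF increasing_path_linear[OF f g a b] sets_N])
    fix t :: real assume t: "0 \<le> t"
    have "emeasure N {0..t} = \<mu> {0..t}"
      using t by (intro emeasure_N) (auto simp: sets_restrict_space)
    then show "emeasure N {0..t} = ennreal (a * f t + b * g t)"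
      using t a b increasing_pathD[OF f] increasing_pathD[OF g]
      by (simp add: \<mu>_def emeasure_stieltjes[OF f] emeasure_stieltjes[OF g] ennreal_mult ennreal_plus)
  qed
  moreover have "(\<integral>\<^sup>+ t. h t \<partial>N) =
    ennreal a * (\<integral>\<^sup>+ t. h t \<partial>stieltjes f) + ennreal b * (\<integral>\<^sup>+ t. h t \<partial>stieltjes g)"
  proof (rule nn_integral_measure_add)
    show "h \<in> borel_measurable N" using measurable_cong_sets[OF sets_N refl] h by auto
  qed (auto simp: sets_stieltjes sets_N emeasure_N \<mu>_def)
  ultimately show ?thesis by simp
qed

lemma increasing_path_zero: "increasing_path (\<lambda>t. 0)"
  by (simp add: increasing_path_def right_continuous_path_def mono_on_def)

lemma increasing_path_step:
  assumes "0 \<le> t0" shows "increasing_path (indicator {t0..})"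
  unfolding increasing_path_def right_continuous_path_def
proof (intro conjI allI impI)
  fix t :: real
  have "eventually (\<lambda>s. indicator {t0..} s = (indicator {t0..} t :: real)) (at_right t)"
    unfolding eventually_at_right_field
    by (intro exI[of _ "if t0 \<le> t then t + 1 else t0"]) (auto simp: indicator_def)
  then show "continuous (at_right t) (indicator {t0..} :: real \<Rightarrow> real)"
    unfolding continuous_within by (rule tendsto_eventually)
qed (auto simp: mono_on_def indicator_def)

lemma attained_levels_zero: "attained_levels (\<lambda>t. 0) = {}"
  by (auto simp: attained_levels_def)

lemma attained_levels_step: "0 \<le> t0 \<Longrightarrow> attained_levels (indicator {t0..}) = {0<..1}"
  by (auto simp: attained_levels_def indicator_def split: if_splits intro: exI[of _ t0])

lemma passage_time_step:
  assumes "0 \<le> t0" "0 < u" "u \<le> 1"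
  shows "passage_time (indicator {t0..}) u = t0"
proof -
  have "{s. 0 \<le> s \<and> u \<le> indicator {t0..} s} = {t0..}"
    using assms by (auto simp: indicator_def split: if_splits)
  then show ?thesis using assms by (simp add: passage_time_def attained_levels_step)
qed

lemma integral_stieltjes_zero: 
  fixes g :: "real \<Rightarrow> real"
  assumes "g \<in> borel_measurable halfline" shows "(LINT t|stieltjes (\<lambda>t. 0). g t) = 0"
  by (simp add: integral_stieltjes[OF increasing_path_zero assms] attained_levels_zero)

lemma nn_integral_stieltjes_zero: 
  assumes "g \<in> borel_measurable halfline" shows "(\<integral>\<^sup>+t. g t \<partial>stieltjes (\<lambda>t. 0)) = 0"
  by (simp add: nn_integral_stieltjes[OF increasing_path_zero assms] attained_levels_zero)

lemma integral_stieltjes_step: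
  fixes g :: "real \<Rightarrow> real"
  assumes t0: "0 \<le> t0" and g: "g \<in> borel_measurable halfline"
  shows "(LINT t|stieltjes (indicator {t0..}). g t) = g t0"
proof -
  have "(LINT t|stieltjes (indicator {t0..}). g t) = (LINT u|lborel. indicator {0<..1::real} u * g t0)"
    unfolding integral_stieltjes[OF increasing_path_step[OF t0] g] attained_levels_step[OF t0]
    by (intro Bochner_Integration.integral_cong) (auto simp: indicator_def passage_time_step[OF t0])
  then show ?thesis by simp
qed

lemma nn_integral_stieltjes_step:
  assumes t0: "0 \<le> t0" and g: "g \<in> borel_measurable halfline"
  shows "(\<integral>\<^sup>+t. g t \<partial>stieltjes (indicator {t0..})) = g t0"
proof -
  have "(\<integral>\<^sup>+t. g t \<partial>stieltjes (indicator {t0..})) = (\<integral>\<^sup>+u. g t0 * indicator {0<..1::real} u \<partial>lborel)"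
    unfolding nn_integral_stieltjes[OF increasing_path_step[OF t0] g] attained_levels_step[OF t0]
    by (intro nn_integral_cong) (auto simp: indicator_def passage_time_step[OF t0])
  then show ?thesis by (simp add: nn_integral_cmult_indicator)
qed

section \<open>Right-continuous and increasing processes\<close>

abbreviation timed :: "'a measure \<Rightarrow> ('a \<times> real) measure" where
  "timed M \<equiv> M \<Otimes>\<^sub>M halfline"

lemma halfline_time_measurable: "(\<lambda>z. snd z) \<in> borel_measurable (timed M)"
  by (rule measurable_compose[OF measurable_snd halfline_measurable_id])

lemma discount_measurable: "(\<lambda>z. exp (- r * snd z)) \<in> borel_measurable (timed M)"
  using halfline_time_measurable by measurable

definition right_continuous_process :: "'a measure \<Rightarrow> (real \<Rightarrow> 'a \<Rightarrow> real) \<Rightarrow> bool" where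
  "right_continuous_process M Z \<longleftrightarrow> (\<forall>t\<ge>0. Z t \<in> borel_measurable M) \<and>
     (\<forall>\<omega>\<in>space M. right_continuous_path (\<lambda>t. Z t \<omega>))"

text \<open>
  On the grid the process takes countably many random variables as its values, hence is jointly
  measurable, and the grid approximations converge by right-continuity.
\<close>

lemma right_continuous_process_measurable:
  assumes "right_continuous_process M Z"
  shows "(\<lambda>z. Z (snd z) (fst z)) \<in> borel_measurable (timed M)"
proof (rule borel_measurable_LIMSEQ_real)
  show "(\<lambda>z. Z (grid_above n (snd z)) (fst z)) \<in> borel_measurable (timed M)" for n
    unfolding grid_above_def
  proof (rule measurable_compose_countable[where g="\<lambda>z. nat \<lceil>real (Suc n) * snd z\<rceil>"
        and f="\<lambda>i z. Z (real i / real (Suc n)) (fst z)"])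
    show "(\<lambda>z. Z (real i / real (Suc n)) (fst z)) \<in> borel_measurable (timed M)" for i
      using assms by (intro measurable_compose[OF measurable_fst])
        (auto simp: right_continuous_process_def)
    have [measurable]: "(\<lambda>z. snd z) \<in> borel_measurable (timed M)"
      by (intro measurable_compose[OF measurable_snd] measurable_restrict_space1) auto
    show "(\<lambda>z. nat \<lceil>real (Suc n) * snd z\<rceil>) \<in> timed M \<rightarrow>\<^sub>M count_space UNIV"
      by measurable
  qed
  fix z assume "z \<in> space (timed M)"
  then have "fst z \<in> space M" "0 \<le> snd z"
    by (auto simp: space_pair_measure space_restrict_space)
  then show "(\<lambda>n. Z (grid_above n (snd z)) (fst z)) \<longlonglongrightarrow> Z (snd z) (fst z)"
    using assms right_continuous_path_grid[of "\<lambda>t. Z t (fst z)" "snd z"]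
    by (auto simp: right_continuous_process_def)
qed

lemma right_continuous_process_path_measurable:
  assumes "right_continuous_process M Z" "\<omega> \<in> space M"
  shows "(\<lambda>t. Z t \<omega>) \<in> borel_measurable halfline"
  using measurable_compose[OF measurable_Pair1'[OF assms(2)]
    right_continuous_process_measurable[OF assms(1)]]
  by simp

definition increasing_process :: "'a measure \<Rightarrow> (real \<Rightarrow> 'a \<Rightarrow> real) \<Rightarrow> bool" where
  "increasing_process M \<eta> \<longleftrightarrow> (\<forall>t\<ge>0. \<eta> t \<in> borel_measurable M) \<and>
     (\<forall>\<omega>\<in>space M. increasing_path (\<lambda>t. \<eta> t \<omega>))"

lemma increasing_process_imp_right_continuous:
  "increasing_process M \<eta> \<Longrightarrow> right_continuous_process M \<eta>"
  by (auto simp: increasing_process_def right_continuous_process_def increasing_path_def)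

definition level_set :: "'a measure \<Rightarrow> (real \<Rightarrow> 'a \<Rightarrow> real) \<Rightarrow> ('a \<times> real) set" where
  "level_set M \<eta> = {z \<in> space (M \<Otimes>\<^sub>M lborel). snd z \<in> attained_levels (\<lambda>t. \<eta> t (fst z))}"

lemma level_set_measurable:
  assumes "increasing_process M \<eta>"
  shows "level_set M \<eta> \<in> sets (M \<Otimes>\<^sub>M lborel)"
proof -
  have [measurable]: "\<eta> (real n) \<in> borel_measurable M" for n
    using assms by (simp add: increasing_process_def)
  have "snd z \<in> attained_levels (\<lambda>t. \<eta> t (fst z)) \<longleftrightarrow> (\<exists>n. 0 < snd z \<and> snd z \<le> \<eta> (real n) (fst z))"
    if "z \<in> space (M \<Otimes>\<^sub>M lborel)" for z
    using assms that by (subst attained_levels_eq) (auto simp: increasing_process_def space_pair_measure)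
  then have "level_set M \<eta> = {z \<in> space (M \<Otimes>\<^sub>M lborel). \<exists>n. 0 < snd z \<and> snd z \<le> \<eta> (real n) (fst z)}"
    unfolding level_set_def by blast
  also have "\<dots> \<in> sets (M \<Otimes>\<^sub>M lborel)" by measurable
  finally show ?thesis .
qed

lemma passage_time_process_measurable:
  assumes \<eta>: "increasing_process M \<eta>"
  shows "(\<lambda>z. passage_time (\<lambda>t. \<eta> t (fst z)) (snd z)) \<in> (M \<Otimes>\<^sub>M lborel) \<rightarrow>\<^sub>M halfline"
proof (rule measurable_restrict_space2)
  let ?q = "\<lambda>z. passage_time (\<lambda>t. \<eta> t (fst z)) (snd z)"
  show "?q \<in> M \<Otimes>\<^sub>M lborel \<rightarrow>\<^sub>M lborel"
    unfolding measurable_lborel1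
  proof (rule borel_measurableI_le)
    fix a
    show "{z \<in> space (M \<Otimes>\<^sub>M lborel). ?q z \<le> a} \<in> sets (M \<Otimes>\<^sub>M lborel)"
    proof (cases "a < 0")
      case True
      then have "\<not> ?q z \<le> a" for z using passage_time_nonneg[of "\<lambda>t. \<eta> t (fst z)" "snd z"] by linarith
      then show ?thesis by simp
    next
      case False
      have [measurable]: "\<eta> a \<in> borel_measurable M"
        using \<eta> False by (simp add: increasing_process_def)
      have [measurable]: "level_set M \<eta> \<in> sets (M \<Otimes>\<^sub>M lborel)" by (rule level_set_measurable[OF \<eta>])
      have "?q z \<le> a \<longleftrightarrow> z \<notin> level_set M \<eta> \<or> snd z \<le> \<eta> a (fst z)" if "z \<in> space (M \<Otimes>\<^sub>M lborel)" for z
        using passage_time_le_iff[of "\<lambda>t. \<eta> t (fst z)" "snd z" a] \<eta> False that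
        by (cases "z \<in> level_set M \<eta>")
          (auto simp: passage_time_def level_set_def increasing_process_def space_pair_measure)
      then have "{z \<in> space (M \<Otimes>\<^sub>M lborel). ?q z \<le> a} =
        {z \<in> space (M \<Otimes>\<^sub>M lborel). z \<notin> level_set M \<eta> \<or> snd z \<le> \<eta> a (fst z)}" by blast
      also have "\<dots> \<in> sets (M \<Otimes>\<^sub>M lborel)" by measurable
      finally show ?thesis .
    qed
  qed
qed (auto simp: passage_time_nonneg)

text \<open>
  The measure \<open>P(d\<omega>) d\<eta>\<^sub>t(\<omega>)\<close> on the product space (the Doleans measure of \<open>\<eta>\<close>), obtained from the
  product of \<open>P\<close> with Lebesgue measure on the attained levels. An image of a product measure,
  unlike a mixture of the random measures \<open>d\<eta>\<close>, has Tonelli's and Fubini's theorems at once.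
\<close>

definition doleans :: "'a measure \<Rightarrow> (real \<Rightarrow> 'a \<Rightarrow> real) \<Rightarrow> ('a \<times> real) measure" where
  "doleans M \<eta> = distr (restrict_space (M \<Otimes>\<^sub>M lborel) (level_set M \<eta>)) (timed M)
     (\<lambda>z. (fst z, passage_time (\<lambda>t. \<eta> t (fst z)) (snd z)))"

lemma sets_doleans [measurable_cong]: "sets (doleans M \<eta>) = sets (timed M)"
  by (simp add: doleans_def)

lemma space_doleans: "space (doleans M \<eta>) = space M \<times> {0..}"
  by (simp add: doleans_def space_pair_measure space_restrict_space)

lemma doleans_map_measurable:
  assumes "increasing_process M \<eta>"
  shows "(\<lambda>z. (fst z, passage_time (\<lambda>t. \<eta> t (fst z)) (snd z))) \<in>
    (M \<Otimes>\<^sub>M lborel) \<rightarrow>\<^sub>M timed M"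
  using passage_time_process_measurable[OF assms] by measurable

lemma nn_integral_doleans_levels:
  assumes \<eta>: "increasing_process M \<eta>" and g: "g \<in> borel_measurable (timed M)"
  shows "(\<integral>\<^sup>+ z. g z \<partial>doleans M \<eta>) =
    (\<integral>\<^sup>+ z. indicator (level_set M \<eta>) z * g (fst z, passage_time (\<lambda>t. \<eta> t (fst z)) (snd z))
      \<partial>(M \<Otimes>\<^sub>M lborel))"
  unfolding doleans_def using g doleans_map_measurable[OF \<eta>] level_set_measurable[OF \<eta>]
  by (simp add: nn_integral_distr measurable_restrict_space1 nn_integral_restrict_space mult.commute)

lemma integrable_doleans_levels:
  fixes g :: "_ \<Rightarrow> real"
  assumes \<eta>: "increasing_process M \<eta>" and g: "g \<in> borel_measurable (timed M)"
  shows "integrable (doleans M \<eta>) g \<longleftrightarrow> integrable (M \<Otimes>\<^sub>M lborel)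
    (\<lambda>z. indicator (level_set M \<eta>) z * g (fst z, passage_time (\<lambda>t. \<eta> t (fst z)) (snd z)))"
  unfolding doleans_def using g doleans_map_measurable[OF \<eta>] level_set_measurable[OF \<eta>]
  by (simp add: integrable_distr_eq measurable_restrict_space1 integrable_restrict_space)

lemma integral_doleans_levels:
  fixes g :: "_ \<Rightarrow> real"
  assumes \<eta>: "increasing_process M \<eta>" and g: "g \<in> borel_measurable (timed M)"
  shows "(LINT z|doleans M \<eta>. g z) = (LINT z|(M \<Otimes>\<^sub>M lborel).
    indicator (level_set M \<eta>) z * g (fst z, passage_time (\<lambda>t. \<eta> t (fst z)) (snd z)))"
  unfolding doleans_def using g doleans_map_measurable[OF \<eta>] level_set_measurable[OF \<eta>]
  by (simp add: integral_distr measurable_restrict_space1 integral_restrict_space)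

lemma level_set_indicator:
  assumes "\<omega> \<in> space M"
  shows "indicator (level_set M \<eta>) (\<omega>, u) = indicator (attained_levels (\<lambda>t. \<eta> t \<omega>)) u"
  using assms by (auto simp: level_set_def space_pair_measure indicator_def)

text \<open>
  Tonelli's theorem over pairs of a scenario and a level, read back through the passage time of each
  single path.
\<close>

lemma
  assumes \<eta>: "increasing_process M \<eta>" and g: "g \<in> borel_measurable (timed M)"
  shows nn_integral_doleans: "(\<integral>\<^sup>+ z. g z \<partial>doleans M \<eta>) =
      (\<integral>\<^sup>+ \<omega>. \<integral>\<^sup>+ t. g (\<omega>, t) \<partial>stieltjes (\<lambda>t. \<eta> t \<omega>) \<partial>M)"
    and nn_integral_stieltjes_measurable:
      "(\<lambda>\<omega>. \<integral>\<^sup>+ t. g (\<omega>, t) \<partial>stieltjes (\<lambda>t. \<eta> t \<omega>)) \<in> borel_measurable M"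
proof -
  define G where "G z = indicator (level_set M \<eta>)
    z * g (fst z, passage_time (\<lambda>t. \<eta> t (fst z)) (snd z))" for z
  have G: "G \<in> borel_measurable (M \<Otimes>\<^sub>M lborel)"
    unfolding G_def using measurable_compose[OF doleans_map_measurable[OF \<eta>] g]
      level_set_measurable[OF \<eta>]
    by measurable
  have path: "(\<integral>\<^sup>+ t. g (\<omega>, t) \<partial>stieltjes (\<lambda>t. \<eta> t \<omega>)) = (\<integral>\<^sup>+ u. G (\<omega>, u) \<partial>lborel)"
    if \<omega>: "\<omega> \<in> space M" for \<omega>
  proof -
    have "(\<lambda>t. g (\<omega>, t)) \<in> borel_measurable halfline"
      by (rule measurable_compose[OF measurable_Pair1'[OF \<omega>] g])
    then show ?thesis
      using \<eta> \<omega> by (subst nn_integral_stieltjes)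
        (auto simp: G_def level_set_indicator increasing_process_def)
  qed
  show "(\<integral>\<^sup>+ z. g z \<partial>doleans M \<eta>) = (\<integral>\<^sup>+ \<omega>. \<integral>\<^sup>+ t. g (\<omega>, t) \<partial>stieltjes (\<lambda>t. \<eta> t \<omega>) \<partial>M)"
    unfolding nn_integral_doleans_levels[OF \<eta> g] G_def[symmetric] lborel.nn_integral_fst[OF G, symmetric]
    by (intro nn_integral_cong) (simp add: path)
  show "(\<lambda>\<omega>. \<integral>\<^sup>+ t. g (\<omega>, t) \<partial>stieltjes (\<lambda>t. \<eta> t \<omega>)) \<in> borel_measurable M"
    by (subst measurable_cong[OF path]) (auto intro: lborel.borel_measurable_nn_integral_fst[OF G])
qed

lemma (in sigma_finite_measure)
  fixes g :: "_ \<Rightarrow> real"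
  assumes \<eta>: "increasing_process M \<eta>" and g: "integrable (doleans M \<eta>) g"
  shows AE_integrable_stieltjes: "AE \<omega> in M. integrable (stieltjes (\<lambda>t. \<eta> t \<omega>)) (\<lambda>t. g (\<omega>, t))"
    and integrable_integral_stieltjes: "integrable M (\<lambda>\<omega>. LINT t|stieltjes (\<lambda>t. \<eta> t \<omega>). g (\<omega>, t))"
    and integral_doleans: "(LINT z|doleans M \<eta>. g z)
      = (LINT \<omega>|M. LINT t|stieltjes (\<lambda>t. \<eta> t \<omega>). g (\<omega>, t))"
proof -
  interpret MU: pair_sigma_finite M lborel ..
  have gm: "g \<in> borel_measurable (timed M)"
    using borel_measurable_integrable[OF g] measurable_cong_sets[OF sets_doleans refl] by blast
  define G where "G z = indicator (level_set M \<eta>)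
    z * g (fst z, passage_time (\<lambda>t. \<eta> t (fst z)) (snd z))" for z
  have G: "integrable (M \<Otimes>\<^sub>M lborel) G"
    using g unfolding G_def integrable_doleans_levels[OF \<eta> gm] .
  have path: "(\<lambda>t. g (\<omega>, t)) \<in> borel_measurable halfline" "increasing_path (\<lambda>t. \<eta> t \<omega>)"
    "(\<lambda>u. indicator (attained_levels (\<lambda>t. \<eta> t \<omega>)) u * g (\<omega>, passage_time (\<lambda>t. \<eta> t \<omega>) u))
      = (\<lambda>u. G (\<omega>, u))"
    if "\<omega> \<in> space M" for \<omega>
    using measurable_compose[OF measurable_Pair1'[OF that] gm] \<eta> that
    by (auto simp: G_def level_set_indicator increasing_process_def)
  have path_int: "(LINT t|stieltjes (\<lambda>t. \<eta> t \<omega>). g (\<omega>, t)) = (LINT u|lborel. G (\<omega>, u))"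
    if "\<omega> \<in> space M" for \<omega>
    using integral_stieltjes[OF path(2,1)] path(3)[OF that] that by simp
  show "AE \<omega> in M. integrable (stieltjes (\<lambda>t. \<eta> t \<omega>)) (\<lambda>t. g (\<omega>, t))"
    using MU.AE_integrable_fst'[OF G] AE_space
  proof eventually_elim
    case (elim \<omega>)
    then show ?case using integrable_stieltjes_iff[OF path(2,1)] path(3)[of \<omega>] by simp
  qed
  show "integrable M (\<lambda>\<omega>. LINT t|stieltjes (\<lambda>t. \<eta> t \<omega>). g (\<omega>, t))"
    using MU.integrable_fst'[OF G] by (subst Bochner_Integration.integrable_cong[OF refl path_int])
  show "(LINT z|doleans M \<eta>. g z) = (LINT \<omega>|M. LINT t|stieltjes (\<lambda>t. \<eta> t \<omega>). g (\<omega>, t))"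
    unfolding integral_doleans_levels[OF \<eta> gm] G_def[symmetric]
    unfolding MU.integral_fst'[OF G, symmetric] 
    by (rule Bochner_Integration.integral_cong[OF refl]) (simp add: path_int)
qed

section \<open>Conditional projections at random times\<close>

text \<open>
  Optional projection at a stopping time that is finite on \<open>B\<close>. Rounded up to a grid, the time takes
  countably many values \<open>s\<close>, each on an event of \<open>F s\<close>, where the projection identity applies;
  right-continuity and dominated convergence remove the rounding.
\<close>

lemma (in prob_space) projection_at_random_time:
  fixes V W :: "real \<Rightarrow> 'a \<Rightarrow> real"
  assumes V: "right_continuous_process M V" "\<And>t \<omega>. 0 \<le> t \<Longrightarrow> \<omega> \<in> space M \<Longrightarrow> \<bar>V t \<omega>\<bar> \<le> b"
    and W: "right_continuous_process M W" "\<And>t \<omega>. 0 \<le> t \<Longrightarrow> \<omega> \<in> space M \<Longrightarrow> \<bar>W t \<omega>\<bar> \<le> b"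
    and F: "\<And>t. 0 \<le> t \<Longrightarrow> subalgebra M (F t)" "\<And>s t. 0 \<le> s \<Longrightarrow> s \<le> t \<Longrightarrow> subalgebra (F t) (F s)"
    and \<tau>: "\<tau> \<in> M \<rightarrow>\<^sub>M halfline" and B: "B \<in> sets M"
    and stopping: "\<And>s. 0 \<le> s \<Longrightarrow> {\<omega> \<in> B. \<tau> \<omega> \<le> s} \<in> sets (F s)"
    and projection: "\<And>s A. 0 \<le> s \<Longrightarrow> A \<in> sets (F s) \<Longrightarrow> (LINT \<omega>:A|M. V s \<omega>) = (LINT \<omega>:A|M. W s \<omega>)"
  shows "(LINT \<omega>:B|M. V (\<tau> \<omega>) \<omega>) = (LINT \<omega>:B|M. W (\<tau> \<omega>) \<omega>)"
proof -
  note B[measurable]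
  have \<tau>_b[measurable]: "\<tau> \<in> borel_measurable M"
    using measurable_compose[OF \<tau>, of "\<lambda>x. x" borel] by (simp add: measurable_restrict_space1)
  have \<tau>0: "0 \<le> \<tau> \<omega>" if "\<omega> \<in> space M" for \<omega>
    using measurable_space[OF \<tau> that] by (simp add: space_restrict_space)
  define A where "A n i = {\<omega> \<in> B. nat \<lceil>real (Suc n) * \<tau> \<omega>\<rceil> = i}" for n i :: nat
  have A_le: "nat \<lceil>real (Suc n) * \<tau> \<omega>\<rceil> \<le> i \<longleftrightarrow> \<tau> \<omega> \<le> real i / real (Suc n)" for n i \<omega>
  proof -
    have "nat \<lceil>real (Suc n) * \<tau> \<omega>\<rceil> \<le> i \<longleftrightarrow> real (Suc n) * \<tau> \<omega> \<le> real i"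
      by (simp add: nat_le_iff ceiling_le_iff del: of_nat_Suc)
    then show ?thesis by (simp add: pos_le_divide_eq mult.commute del: of_nat_Suc)
  qed
  (* The event that the rounded time is i / (n + 1) is decided at that very time. *)
  have A_F: "A n i \<in> sets (F (real i / real (Suc n)))" for n i
  proof (cases i)
    case 0
    have "A n i = {\<omega> \<in> B. \<tau> \<omega> \<le> real i / real (Suc n)}"
      using A_le[of n _ 0] unfolding A_def 0 by auto
    then show ?thesis using stopping[of "real i / real (Suc n)"] by simp
  next
    case (Suc j)
    have "A n i = {\<omega> \<in> B. \<tau> \<omega> \<le> real i / real (Suc n)} - {\<omega> \<in> B. \<tau> \<omega> \<le> real j / real (Suc n)}"
    proof (intro set_eqI)
      fix \<omega>
      show "\<omega> \<in> A n i \<longleftrightarrow> \<omega> \<in> {\<omega> \<in> B. \<tau> \<omega> \<le> real i / real (Suc n)} - {\<omega> \<in> B. \<tau> \<omega> \<le> real j / real (Suc n)}"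
        using A_le[of n \<omega> i] A_le[of n \<omega> j] le_Suc_eq[of "nat \<lceil>real (Suc n) * \<tau> \<omega>\<rceil>" j]
        unfolding A_def mem_Collect_eq Diff_iff Suc by (metis Suc_n_not_le_n)
    qed
    moreover have "{\<omega> \<in> B. \<tau> \<omega> \<le> real j / real (Suc n)} \<in> sets (F (real i / real (Suc n)))"
      using stopping[of "real j / real (Suc n)"]
        F(2)[of "real j / real (Suc n)" "real i / real (Suc n)"] Suc
      by (auto simp: subalgebra_def divide_right_mono)
    ultimately show ?thesis using stopping[of "real i / real (Suc n)"] by auto
  qed
  have A_M: "A n i \<in> sets M" for n i
    using A_F[of n i] F(1)[of "real i / real (Suc n)"] by (auto simp: subalgebra_def)
  have A_UN: "(\<Union>i. A n i) = B" for n by (auto simp: A_def)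
  have meas: "(\<lambda>\<omega>. Z (\<tau> \<omega>) \<omega>) \<in> borel_measurable M" if "right_continuous_process M Z"
    for Z :: "real \<Rightarrow> 'a \<Rightarrow> real"
    using measurable_compose[OF measurable_Pair[OF measurable_ident_sets[OF refl] \<tau>]
      right_continuous_process_measurable[OF that]]
    by simp
  have grid_meas: "(\<lambda>\<omega>. Z (grid_above n (\<tau> \<omega>)) \<omega>) \<in> borel_measurable M"
    if "right_continuous_process M Z" 
    for Z :: "real \<Rightarrow> 'a \<Rightarrow> real" and n
    unfolding grid_above_def
  proof (rule measurable_compose_countable[where g="\<lambda>\<omega>. nat \<lceil>real (Suc n) * \<tau> \<omega>\<rceil>"
        and f="\<lambda>i \<omega>. Z (real i / real (Suc n)) \<omega>"])
    show "Z (real i / real (Suc n)) \<in> borel_measurable M" for i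
      using that by (auto simp: right_continuous_process_def)
  qed measurable
  have limit: "(\<lambda>n. LINT \<omega>:B|M. Z (grid_above n (\<tau> \<omega>)) \<omega>) \<longlonglongrightarrow> (LINT \<omega>:B|M. Z (\<tau> \<omega>) \<omega>)"
    if Z: "right_continuous_process M Z" "\<And>t \<omega>. 0 \<le> t \<Longrightarrow> \<omega> \<in> space M \<Longrightarrow> \<bar>Z t \<omega>\<bar> \<le> b"
      for Z :: "real \<Rightarrow> 'a \<Rightarrow> real"
    unfolding set_lebesgue_integral_def
  proof (rule integral_dominated_convergence[where w="\<lambda>_. b"])
    show "(\<lambda>\<omega>. indicator B \<omega> *\<^sub>R Z (\<tau> \<omega>) \<omega>) \<in> borel_measurable M"
      using meas[OF Z(1)] by measurable
    show "(\<lambda>\<omega>. indicator B \<omega> *\<^sub>R Z (grid_above n (\<tau> \<omega>)) \<omega>) \<in> borel_measurable M" for n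
      using grid_meas[OF Z(1)] by measurable
    show "AE \<omega> in M. (\<lambda>n. indicator B \<omega> *\<^sub>R Z (grid_above n (\<tau> \<omega>)) \<omega>) \<longlonglongrightarrow> indicator B \<omega> *\<^sub>R Z (\<tau> \<omega>) \<omega>"
    proof (rule AE_I2)
      fix \<omega> assume \<omega>: "\<omega> \<in> space M"
      then have "right_continuous_path (\<lambda>t. Z t \<omega>)" using Z(1)
        by (simp add: right_continuous_process_def)
      from right_continuous_path_grid[OF this \<tau>0[OF \<omega>]]
      show "(\<lambda>n. indicator B \<omega> *\<^sub>R Z (grid_above n (\<tau> \<omega>)) \<omega>) \<longlonglongrightarrow> indicator B \<omega> *\<^sub>R Z (\<tau> \<omega>) \<omega>"
        by (intro tendsto_scaleR tendsto_const)
    qed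
    show "AE \<omega> in M. norm (indicator B \<omega> *\<^sub>R Z (grid_above n (\<tau> \<omega>)) \<omega>) \<le> b" for n
    proof (rule AE_I2)
      fix \<omega> assume \<omega>: "\<omega> \<in> space M"
      have "\<bar>Z (grid_above n (\<tau> \<omega>)) \<omega>\<bar> \<le> b" using Z(2) grid_above_nonneg \<omega> by blast
      then show "norm (indicator B \<omega> *\<^sub>R Z (grid_above n (\<tau> \<omega>)) \<omega>) \<le> b" by (auto simp: indicator_def)
    qed
  qed simp
  have sum: "(LINT \<omega>:B|M. Z (grid_above n (\<tau> \<omega>)) \<omega>) = (\<Sum>i. LINT \<omega>:A n i|M. Z (real i / real (Suc n)) \<omega>)"
    if Z: "right_continuous_process M Z" "\<And>t \<omega>. 0 \<le> t \<Longrightarrow> \<omega> \<in> space M \<Longrightarrow> \<bar>Z t \<omega>\<bar> \<le> b"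
      for Z :: "real \<Rightarrow> 'a \<Rightarrow> real" and n
  proof -
    have "(LINT \<omega>:(\<Union>i. A n i)|M. Z (grid_above n (\<tau> \<omega>)) \<omega>)
      = (\<Sum>i. LINT \<omega>:A n i|M. Z (grid_above n (\<tau> \<omega>)) \<omega>)"
    proof (rule lebesgue_integral_countable_add)
      show "set_integrable M (\<Union>i. A n i) (\<lambda>\<omega>. Z (grid_above n (\<tau> \<omega>)) \<omega>)"
        unfolding set_integrable_def
      proof (rule integrable_const_bound[where B=b])
        show "AE \<omega> in M. norm (indicator (\<Union>i. A n i) \<omega> *\<^sub>R Z (grid_above n (\<tau> \<omega>)) \<omega>) \<le> b"
        proof (rule AE_I2)
          fix \<omega> assume \<omega>: "\<omega> \<in> space M"
          have "\<bar>Z (grid_above n (\<tau> \<omega>)) \<omega>\<bar> \<le> b" using Z(2) grid_above_nonneg \<omega> by blast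
          then show "norm (indicator (\<Union>i. A n i) \<omega> *\<^sub>R Z (grid_above n (\<tau> \<omega>)) \<omega>) \<le> b"
            by (auto simp: indicator_def)
        qed
        show "(\<lambda>\<omega>. indicator (\<Union>i. A n i) \<omega> *\<^sub>R Z (grid_above n (\<tau> \<omega>)) \<omega>) \<in> borel_measurable M"
          unfolding A_UN using grid_meas[OF Z(1)] by measurable
      qed
      show "A n i \<inter> A n j = {}" if "i \<noteq> j" for i j using that by (auto simp: A_def)
    qed (rule A_M)
    also have "\<dots> = (\<Sum>i. LINT \<omega>:A n i|M. Z (real i / real (Suc n)) \<omega>)"
      using A_M by (intro suminf_cong set_lebesgue_integral_cong) (auto simp: A_def grid_above_def)
    finally show ?thesis unfolding A_UN .
  qed
  have "(LINT \<omega>:B|M. V (grid_above n (\<tau> \<omega>)) \<omega>) = (LINT \<omega>:B|M. W (grid_above n (\<tau> \<omega>)) \<omega>)" for n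
  proof -
    have "(LINT \<omega>:B|M. V (grid_above n (\<tau> \<omega>)) \<omega>) = (\<Sum>i. LINT \<omega>:A n i|M. V (real i / real (Suc n)) \<omega>)"
      by (rule sum[OF V(1)]) (rule V(2))
    also have "\<dots> = (\<Sum>i. LINT \<omega>:A n i|M. W (real i / real (Suc n)) \<omega>)"
      by (intro suminf_cong projection A_F) simp
    also have "\<dots> = (LINT \<omega>:B|M. W (grid_above n (\<tau> \<omega>)) \<omega>)"
      by (rule sum[OF W(1), symmetric]) (rule W(2))
    finally show ?thesis .
  qed
  moreover have "(\<lambda>n. LINT \<omega>:B|M. V (grid_above n (\<tau> \<omega>)) \<omega>) \<longlonglongrightarrow> (LINT \<omega>:B|M. V (\<tau> \<omega>) \<omega>)"
    by (rule limit[OF V(1)]) (rule V(2))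
  moreover have "(\<lambda>n. LINT \<omega>:B|M. W (grid_above n (\<tau> \<omega>)) \<omega>) \<longlonglongrightarrow> (LINT \<omega>:B|M. W (\<tau> \<omega>) \<omega>)"
    by (rule limit[OF W(1)]) (rule W(2))
  ultimately show ?thesis using LIMSEQ_unique by simp
qed

section \<open>Discounted tail integrals\<close>

lemma nn_integral_discount_tail:
  assumes r: "0 < r" and s: "0 \<le> s"
  shows "(\<integral>\<^sup>+ t. indicator {s..} t * ennreal (exp (- r * t)) \<partial>halfline) = ennreal (exp (- r * s) / r)"
proof -
  have "(\<integral>\<^sup>+ t. indicator {s..} t * ennreal (exp (- r * t)) \<partial>halfline)
    = (\<integral>\<^sup>+ t. ennreal (exp (- r * t)) * indicator {s..} t \<partial>lborel)"
    using s by (subst nn_integral_restrict_space) (auto intro!: nn_integral_cong simp: indicator_def)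
  also have "\<dots> = ennreal (0 - (- exp (- r * s) / r))"
  proof (rule nn_integral_FTC_atLeast)
    show "((\<lambda>t. - exp (- r * t) / r) has_real_derivative exp (- r * x)) (at x)" for x
      using r by (auto intro!: derivative_eq_intros)
    have "((\<lambda>t. exp (- r * t)) \<longlongrightarrow> 0) at_top"
      using r by (intro filterlim_compose[OF exp_at_bot]
        filterlim_tendsto_neg_mult_at_bot[OF tendsto_const])
        (auto simp: filterlim_ident)
    from tendsto_mult_left[OF this, of "- 1 / r"]
    show "((\<lambda>t. - exp (- r * t) / r) \<longlongrightarrow> 0) at_top" by simp
  qed auto
  finally show ?thesis by simp
qed

lemma integrable_discount:
  assumes r: "0 < r"
  shows "integrable halfline (\<lambda>t. exp (- r * t))" "(LINT t|halfline. exp (- r * t)) = 1 / r"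
proof -
  have *: "(\<integral>\<^sup>+ t. ennreal (exp (- r * t)) \<partial>halfline) = ennreal (1 / r)"
    using nn_integral_discount_tail[OF r order_refl]
    by (subst (asm) nn_integral_cong[where v="\<lambda>t. ennreal (exp (- r * t))"])
      (auto simp: space_restrict_space)
  have m: "(\<lambda>t. exp (- r * t)) \<in> borel_measurable halfline"
    using halfline_measurable_id by measurable
  show "integrable halfline (\<lambda>t. exp (- r * t))"
    using m * by (intro integrableI_nonneg) auto
  show "(LINT t|halfline. exp (- r * t)) = 1 / r"
    using m * r by (subst integral_eq_nn_integral) auto
qed

text \<open>
  This is \<open>\<integral>\<^sub>s\<^sup>\<infinity> D\<^sub>t e\<^bsup>-rt\<^esup> dt\<close>, discounted to time \<open>0\<close> rather than to \<open>s\<close>: then its increments in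
    \<open>s\<close> are
  integrals over intervals, and it is Lipschitz.
\<close>

definition discounted_tail :: "real \<Rightarrow> ('a \<times> real \<Rightarrow> real) \<Rightarrow> real \<Rightarrow> 'a \<Rightarrow> real" where
  "discounted_tail r D s \<omega> = (LINT t|halfline. indicator {s..} t * (D (\<omega>, t) * exp (- r * t)))"

lemma integrable_discounted:
  assumes r: "0 < r" and d: "d \<in> borel_measurable halfline" "\<And>t. 0 \<le> t \<Longrightarrow> \<bar>d t\<bar> \<le> K"
  shows "integrable halfline (\<lambda>t. d t * exp (- r * t))"
proof (rule Bochner_Integration.integrable_bound)
  show "integrable halfline (\<lambda>t. K * exp (- r * t))" using integrable_discount[OF r] by simp
  show "(\<lambda>t. d t * exp (- r * t)) \<in> borel_measurable halfline"
    using d(1) halfline_measurable_id by measurable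
  show "AE t in halfline. norm (d t * exp (- r * t)) \<le> norm (K * exp (- r * t))"
    using d(2) by (auto intro!: AE_I2 mult_right_mono order_trans[OF d(2) abs_ge_self] simp:
      space_restrict_space abs_mult)
qed

lemma set_halfline: "A \<in> sets borel \<Longrightarrow> A \<inter> {0..} \<in> sets halfline"
  by (auto simp: sets_restrict_space)

lemma integrable_discounted_tail:
  assumes r: "0 < r" and d: "d \<in> borel_measurable halfline" "\<And>t. 0 \<le> t \<Longrightarrow> \<bar>d t\<bar> \<le> K"
    and S: "S \<in> sets borel"
  shows "integrable halfline (\<lambda>t. indicator S t * (d t * exp (- r * t)))"
proof -
  have "integrable halfline (\<lambda>t. indicator (S \<inter> {0..}) t *\<^sub>R (d t * exp (- r * t)))"
    by (rule integrable_mult_indicator[OF set_halfline[OF S] integrable_discounted[OF r d]])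
  then show ?thesis
    by (subst (asm) Bochner_Integration.integrable_cong[OF refl, where g="\<lambda>t. indicator S
      t * (d t * exp (- r * t))"])
      (auto simp: space_restrict_space indicator_def)
qed

lemma discounted_tail_bound:
  assumes r: "0 < r" and d: "(\<lambda>t. D (\<omega>, t)) \<in> borel_measurable halfline" "\<And>t. 0 \<le> t \<Longrightarrow> \<bar>D (\<omega>, t)\<bar> \<le> K"
    and s: "0 \<le> s"
  shows "\<bar>discounted_tail r D s \<omega>\<bar> \<le> K / r * exp (- r * s)"
proof -
  have K: "0 \<le> K" using d(2)[OF order_refl] by simp
  have int: "integrable halfline (\<lambda>t. indicator {s..} t * (D (\<omega>, t) * exp (- r * t)))"
    by (rule integrable_discounted_tail[OF r d]) measurable
  have "ennreal \<bar>discounted_tail r D s \<omega>\<bar> \<le> (\<integral>\<^sup>+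
    t. ennreal (norm (indicator {s..} t * (D (\<omega>, t) * exp (- r * t)))) \<partial>halfline)"
    unfolding discounted_tail_def using integral_norm_bound_ennreal[OF int] by simp
  also have "\<dots> \<le> (\<integral>\<^sup>+ t. ennreal K * (indicator {s..} t * ennreal (exp (- r * t))) \<partial>halfline)"
    using d(2) K by (intro nn_integral_mono)
      (auto simp: space_restrict_space abs_mult ennreal_mult[symmetric] indicator_def intro!:
        ennreal_leI mult_right_mono)
  also have "\<dots> = ennreal K * ennreal (exp (- r * s) / r)"
  proof -
    have "(\<lambda>t. indicator {s..} t * ennreal (exp (- r * t))) \<in> borel_measurable halfline"
      using halfline_measurable_id by (intro measurable_restrict_space1) measurable
    then show ?thesis by (simp add: nn_integral_cmult nn_integral_discount_tail[OF r s, simplified])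
  qed
  also have "\<dots> = ennreal (K / r * exp (- r * s))" using K r
    by (simp add: ennreal_mult[symmetric] field_simps)
  finally show ?thesis using K r by (subst (asm) ennreal_le_iff) auto
qed

lemma right_continuous_discounted_tail:
  assumes r: "0 < r" and d: "(\<lambda>t. D (\<omega>, t)) \<in> borel_measurable halfline" "\<And>t. 0 \<le> t \<Longrightarrow> \<bar>D (\<omega>, t)\<bar> \<le> K"
  shows "right_continuous_path (\<lambda>s. discounted_tail r D s \<omega>)"
proof -
  have K: "0 \<le> K" using d(2)[OF order_refl] by simp
  let ?h = "\<lambda>t. D (\<omega>, t) * exp (- r * t)"
  have lip: "\<bar>discounted_tail r D s \<omega> - discounted_tail r D s' \<omega>\<bar> \<le> K * (s' - s)" if s: "0 \<le> s" "s
    \<le> s'" for s s'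
  proof -
    have "discounted_tail r D s \<omega> - discounted_tail r D s' \<omega>
      = (LINT t|halfline. indicator {s..} t * ?h t - indicator {s'..} t * ?h t)"
      unfolding discounted_tail_def
      by (rule Bochner_Integration.integral_diff[symmetric]; rule
        integrable_discounted_tail[OF r d]; measurable)
    also have "\<dots> = (LINT t|halfline. indicator {s..<s'} t * ?h t)"
      using s by (intro Bochner_Integration.integral_cong) (auto simp: indicator_def)
    finally have eq: "discounted_tail r D s \<omega> - discounted_tail r D s' \<omega> = \<dots>" .
    have int: "integrable halfline (\<lambda>t. indicator {s..<s'} t * ?h t)"
      by (rule integrable_discounted_tail[OF r d]) measurable
    have "ennreal \<bar>LINT t|halfline. indicator {s..<s'} t * ?h t\<bar>
      \<le> (\<integral>\<^sup>+ t. ennreal (norm (indicator {s..<s'} t * ?h t)) \<partial>halfline)"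
      using integral_norm_bound_ennreal[OF int] by simp
    also have "\<dots> \<le> (\<integral>\<^sup>+ t. ennreal K * indicator {s..<s'} t \<partial>halfline)"
    proof (rule nn_integral_mono)
      fix t assume "t \<in> space halfline"
      then have t: "0 \<le> t" by (simp add: space_restrict_space)
      have "\<bar>?h t\<bar> \<le> K * 1"
        unfolding abs_mult using t r d(2)[OF t] by (intro mult_mono) auto
      then show "ennreal (norm (indicator {s..<s'} t * ?h t)) \<le> ennreal K * indicator {s..<s'} t"
        using K by (auto simp: indicator_def ennreal_leI)
    qed
    also have "\<dots> = ennreal K * emeasure halfline {s..<s'}"
      using s by (subst nn_integral_cmult_indicator) (auto simp: sets_restrict_space)
    also have "emeasure halfline {s..<s'} = ennreal (s' - s)"
      using s by (subst emeasure_restrict_space) auto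
    finally show ?thesis using K s unfolding eq
      by (simp add: ennreal_mult[symmetric] ennreal_le_iff)
  qed
  show ?thesis
    unfolding right_continuous_path_def
  proof (intro allI impI)
    fix t :: real assume t: "0 \<le> t"
    have "((\<lambda>s. discounted_tail r D s \<omega> - discounted_tail r D t \<omega>) \<longlongrightarrow> 0) (at_right t)"
    proof (rule Lim_null_comparison)
      show "\<forall>\<^sub>F s in at_right t. norm (discounted_tail r D s \<omega> - discounted_tail r D t \<omega>) \<le> K * (s - t)"
        unfolding eventually_at_right_field
        using lip[OF t] by (intro exI[of _ "t+1"]) (auto simp: abs_minus_commute)
      have "((\<lambda>s. K * (s - t)) \<longlongrightarrow> K * (t - t)) (at_right t)" by (intro tendsto_intros)
      then show "((\<lambda>s. K * (s - t)) \<longlongrightarrow> 0) (at_right t)" by simp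
    qed
    then show "continuous (at_right t) (\<lambda>s. discounted_tail r D s \<omega>)"
      unfolding continuous_within by (simp add: Lim_null[symmetric])
  qed
qed

lemma right_continuous_process_discounted_tail:
  assumes r: "0 < r" and D: "D \<in> borel_measurable (timed M)"
    "\<And>\<omega> t. \<omega> \<in> space M \<Longrightarrow> 0 \<le> t \<Longrightarrow> \<bar>D (\<omega>, t)\<bar> \<le> K"
  shows "right_continuous_process M (discounted_tail r D)"
  unfolding right_continuous_process_def
proof (intro conjI allI impI ballI)
  fix \<omega> assume \<omega>: "\<omega> \<in> space M"
  show "right_continuous_path (\<lambda>t. discounted_tail r D t \<omega>)"
    by (rule right_continuous_discounted_tail[OF r
      measurable_compose[OF measurable_Pair1'[OF \<omega>] D(1)] D(2)[OF \<omega>]])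
next
  fix s :: real
  interpret T: sigma_finite_measure halfline by (rule sigma_finite_halfline)
  have [measurable]: "(\<lambda>z. snd z) \<in> borel_measurable (timed M)"
    by (rule measurable_compose[OF measurable_snd halfline_measurable_id])
  have "(\<lambda>z. indicator {s..} (snd z) * (D z * exp (- r * snd z))) \<in> borel_measurable (timed M)"
    using D(1) by measurable
  then have "(\<lambda>(\<omega>, t). indicator {s..} t * (D (\<omega>, t) * exp (- r * t))) \<in> borel_measurable (timed M)"
    by (simp only: split_beta' prod.collapse)
  then have "(\<lambda>\<omega>. LINT t|halfline. indicator {s..} t * (D (\<omega>, t) * exp (- r * t))) \<in> borel_measurable M"
    by (rule T.borel_measurable_lebesgue_integral)
  then show "discounted_tail r D s \<in> borel_measurable M"
    by (subst measurable_cong[of M "discounted_tail r D s"]) (auto simp: discounted_tail_def)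
qed

section \<open>Integration by parts against a control\<close>

lemma sigma_finite_stieltjes:
  assumes f: "increasing_path f" shows "sigma_finite_measure (stieltjes f)"
proof
  show "\<exists>A. countable A \<and> A \<subseteq> sets (stieltjes f) \<and> \<Union> A
    = space (stieltjes f) \<and> (\<forall>a\<in>A. emeasure (stieltjes f) a \<noteq> \<infinity>)"
  proof (intro exI[of _ "range (\<lambda>n::nat. {0..real n})"] conjI)
    show "range (\<lambda>n::nat. {0..real n}) \<subseteq> sets (stieltjes f)"
      by (auto simp: sets_stieltjes sets_restrict_space)
    show "\<Union> (range (\<lambda>n::nat. {0..real n})) = space (stieltjes f)"
      using real_arch_simple by (auto simp: space_stieltjes)
  qed (auto simp: emeasure_stieltjes[OF f])
qed

text \<open>
  Tonelli's theorem for the region \<open>s \<le> t\<close>, since \<open>f t\<close> is the mass of \<open>[0, t]\<close>. It turns the finite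
  discounted mass of a control into integrability of its discounted values.
\<close>

lemma nn_integral_discount_stieltjes:
  assumes f: "increasing_path f" and r: "0 < r"
  shows "(\<integral>\<^sup>+ t. ennreal (f t) * ennreal (exp (- r * t)) \<partial>halfline) =
    ennreal (1 / r) * (\<integral>\<^sup>+ s. ennreal (exp (- r * s)) \<partial>stieltjes f)"
proof -
  interpret S: sigma_finite_measure "stieltjes f" by (rule sigma_finite_stieltjes[OF f])
  interpret T: sigma_finite_measure halfline by (rule sigma_finite_halfline)
  interpret ST: pair_sigma_finite "stieltjes f" halfline ..
  have [measurable]: "(\<lambda>t. t) \<in> borel_measurable halfline" by (rule halfline_measurable_id)
  have [measurable]: "(\<lambda>t. t) \<in> borel_measurable (stieltjes f)"
    using measurable_cong_sets[OF sets_stieltjes refl] halfline_measurable_id by blast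
  have m1[measurable]: "(\<lambda>z. fst z) \<in> borel_measurable (stieltjes f \<Otimes>\<^sub>M halfline)"
    by (rule measurable_compose[OF measurable_fst]) measurable
  have m2[measurable]: "(\<lambda>z. snd z) \<in> borel_measurable (stieltjes f \<Otimes>\<^sub>M halfline)"
    by (rule measurable_compose[OF measurable_snd]) measurable
  let ?h = "\<lambda>s t. (if s \<le> t then 1 else 0) * ennreal (exp (- r * t))"
  have h: "case_prod ?h \<in> borel_measurable (stieltjes f \<Otimes>\<^sub>M halfline)"
    unfolding split_beta' by measurable
  have "(\<integral>\<^sup>+ t. ennreal (f t) * ennreal (exp (- r * t)) \<partial>halfline)
    = (\<integral>\<^sup>+ t. \<integral>\<^sup>+ s. ?h s t \<partial>stieltjes f \<partial>halfline)"
  proof (rule nn_integral_cong)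
    fix t assume "t \<in> space halfline"
    then have t: "0 \<le> t" by (simp add: space_halfline)
    have "(\<integral>\<^sup>+ s. ?h s t \<partial>stieltjes f) = (\<integral>\<^sup>+ s. ennreal (exp (- r * t)) * indicator {0..t} s
      \<partial>stieltjes f)"
      using t by (intro nn_integral_cong) (auto simp: space_stieltjes indicator_def)
    also have "\<dots> = ennreal (exp (- r * t)) * emeasure (stieltjes f) {0..t}"
      using t by (intro nn_integral_cmult_indicator) (auto simp: sets_stieltjes sets_restrict_space)
    finally show "ennreal (f t) * ennreal (exp (- r * t)) = (\<integral>\<^sup>+ s. ?h s t \<partial>stieltjes f)"
      using emeasure_stieltjes[OF f t] by (simp add: mult.commute)
  qed
  also have "\<dots> = (\<integral>\<^sup>+ s. \<integral>\<^sup>+ t. ?h s t \<partial>halfline \<partial>stieltjes f)"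
    by (rule ST.Fubini'[OF h])
  also have "\<dots> = (\<integral>\<^sup>+ s. ennreal (1 / r) * ennreal (exp (- r * s)) \<partial>stieltjes f)"
  proof (rule nn_integral_cong)
    fix s assume "s \<in> space (stieltjes f)"
    then have s: "0 \<le> s" by (simp add: space_stieltjes)
    have "(\<integral>\<^sup>+ t. ?h s t \<partial>halfline) = (\<integral>\<^sup>+ t. indicator {s..} t * ennreal (exp (- r * t)) \<partial>halfline)"
      by (intro nn_integral_cong) (auto simp: indicator_def)
    then show "(\<integral>\<^sup>+ t. ?h s t \<partial>halfline) = ennreal (1 / r) * ennreal (exp (- r * s))"
      using nn_integral_discount_tail[OF r s] r by (simp add: ennreal_mult[symmetric])
  qed
  also have "\<dots> = ennreal (1 / r) * (\<integral>\<^sup>+ s. ennreal (exp (- r * s)) \<partial>stieltjes f)"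
    by (rule nn_integral_cmult) measurable
  finally show ?thesis .
qed

text \<open>
  Integration by parts, as Fubini's theorem for the region \<open>s \<le> t\<close>.
\<close>

lemma integral_tail_stieltjes:
  fixes d :: "real \<Rightarrow> real"
  assumes f: "increasing_path f" and r: "0 < r"
    and d: "d \<in> borel_measurable halfline" "\<And>t. 0 \<le> t \<Longrightarrow> \<bar>d t\<bar> \<le> K"
    and fin: "(\<integral>\<^sup>+ s. ennreal (exp (- r * s)) \<partial>stieltjes f) < \<infinity>"
  shows "(LINT s|stieltjes f. LINT t|halfline. indicator {s..} t * (d t * exp (- r * t))) =
    (LINT t|halfline. d t * f t * exp (- r * t))"
proof -
  interpret S: sigma_finite_measure "stieltjes f" by (rule sigma_finite_stieltjes[OF f])
  interpret T: sigma_finite_measure halfline by (rule sigma_finite_halfline)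
  interpret ST: pair_sigma_finite "stieltjes f" halfline ..
  have K: "0 \<le> K" using d(2)[OF order_refl] by simp
  note d(1)[measurable]
  have [measurable]: "(\<lambda>t. t) \<in> borel_measurable halfline" by (rule halfline_measurable_id)
  have [measurable]: "(\<lambda>t. t) \<in> borel_measurable (stieltjes f)"
    using measurable_cong_sets[OF sets_stieltjes refl] halfline_measurable_id by blast
  have m1[measurable]: "(\<lambda>z. fst z) \<in> borel_measurable (stieltjes f \<Otimes>\<^sub>M halfline)"
    by (rule measurable_compose[OF measurable_fst]) measurable
  have m2[measurable]: "(\<lambda>z. snd z) \<in> borel_measurable (stieltjes f \<Otimes>\<^sub>M halfline)"
    by (rule measurable_compose[OF measurable_snd]) measurable
  let ?h = "\<lambda>s t. (if s \<le> t then 1 else 0) * (d t * exp (- r * t))"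
  have h[measurable]: "case_prod ?h \<in> borel_measurable (stieltjes f \<Otimes>\<^sub>M halfline)"
    unfolding split_beta' by measurable
  have "integrable (stieltjes f \<Otimes>\<^sub>M halfline) (case_prod ?h)"
  proof (rule integrableI_bounded[OF h])
    have "(\<integral>\<^sup>+ z. ennreal (norm (case_prod ?h z)) \<partial>(stieltjes f \<Otimes>\<^sub>M halfline))
      = (\<integral>\<^sup>+ s. \<integral>\<^sup>+ t. ennreal (norm (?h s t)) \<partial>halfline \<partial>stieltjes f)"
      by (subst T.nn_integral_fst[symmetric]) (auto simp: measurable_split_conv)
    also have "\<dots> \<le> (\<integral>\<^sup>+ s. ennreal (K / r) * ennreal (exp (- r * s)) \<partial>stieltjes f)"
    proof (rule nn_integral_mono)
      fix s assume "s \<in> space (stieltjes f)"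
      then have s: "0 \<le> s" by (simp add: space_stieltjes)
      have "(\<integral>\<^sup>+ t. ennreal (norm (?h s t)) \<partial>halfline)
        \<le> (\<integral>\<^sup>+ t. ennreal K * (indicator {s..} t * ennreal (exp (- r * t))) \<partial>halfline)"
        using d(2) K by (intro nn_integral_mono)
          (auto simp: space_halfline abs_mult ennreal_mult[symmetric] indicator_def intro!:
            ennreal_leI mult_right_mono)
      also have "\<dots> = ennreal K * ennreal (exp (- r * s) / r)"
      proof -
        have "(\<lambda>t. indicator {s..} t * ennreal (exp (- r * t))) \<in> borel_measurable halfline"
          by measurable
        then show ?thesis by (simp add: nn_integral_cmult nn_integral_discount_tail[OF r s, simplified])
      qed
      finally show "(\<integral>\<^sup>+ t. ennreal (norm (?h s t)) \<partial>halfline)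
        \<le> ennreal (K / r) * ennreal (exp (- r * s))"
        using K r by (simp add: ennreal_mult[symmetric])
    qed
    also have "\<dots> = ennreal (K / r) * (\<integral>\<^sup>+ s. ennreal (exp (- r * s)) \<partial>stieltjes f)"
      by (rule nn_integral_cmult) measurable
    also have "\<dots> < \<infinity>" using fin by (simp add: ennreal_mult_less_top)
    finally show "(\<integral>\<^sup>+ z. ennreal (norm (case_prod ?h z)) \<partial>(stieltjes f \<Otimes>\<^sub>M halfline)) < \<infinity>" .
  qed
  from ST.Fubini_integral[OF this]
  have "(LINT s|stieltjes f. LINT t|halfline. ?h s t)
    = (LINT t|halfline. LINT s|stieltjes f. ?h s t)" by simp
  moreover have "(LINT s|stieltjes f. LINT t|halfline. ?h s t)
    = (LINT s|stieltjes f. LINT t|halfline. indicator {s..} t * (d t * exp (- r * t)))"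
    by (intro Bochner_Integration.integral_cong) (auto simp: indicator_def)
  moreover have "(LINT t|halfline. LINT s|stieltjes f. ?h s t)
    = (LINT t|halfline. d t * f t * exp (- r * t))"
  proof (intro Bochner_Integration.integral_cong refl)
    fix t assume "t \<in> space halfline"
    then have t: "0 \<le> t" by (simp add: space_halfline)
    have "(LINT s|stieltjes f. ?h s t) = (LINT s|stieltjes f. indicator {0..t}
      s * (d t * exp (- r * t)))"
      using t by (intro Bochner_Integration.integral_cong) (auto simp: space_stieltjes indicator_def)
    also have "\<dots> = measure (stieltjes f) {0..t} * (d t * exp (- r * t))"
      by (simp add: space_stieltjes Int_absorb2)
    finally show "(LINT s|stieltjes f. ?h s t) = d t * f t * exp (- r * t)"
      using emeasure_stieltjes[OF f t] increasing_pathD(2)[OF f t] by (simp add: measure_def)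
  qed
  ultimately show ?thesis by simp
qed

lemma (in prob_space) nn_integral_discount_doleans:
  assumes \<eta>: "increasing_process M \<eta>" and r: "0 < r"
  shows "(\<integral>\<^sup>+ z. ennreal (\<eta> (snd z) (fst z)) * ennreal (exp (- r * snd z)) \<partial>timed M) =
    ennreal (1 / r) * (\<integral>\<^sup>+ z. ennreal (exp (- r * snd z)) \<partial>doleans M \<eta>)"
proof -
  interpret T: sigma_finite_measure halfline by (rule sigma_finite_halfline)
  have [measurable]: "(\<lambda>z. \<eta> (snd z) (fst z)) \<in> borel_measurable (timed M)"
    by (rule right_continuous_process_measurable[OF increasing_process_imp_right_continuous[OF \<eta>]])
  have [measurable]: "(\<lambda>z. snd z) \<in> borel_measurable (timed M)"
    by (rule measurable_compose[OF measurable_snd halfline_measurable_id])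
  have e: "(\<lambda>z. ennreal (exp (- r * snd z))) \<in> borel_measurable (timed M)" by measurable
  have "(\<integral>\<^sup>+ z. ennreal (\<eta> (snd z) (fst z)) * ennreal (exp (- r * snd z)) \<partial>timed M) =
    (\<integral>\<^sup>+ \<omega>. \<integral>\<^sup>+ t. ennreal (\<eta> t \<omega>) * ennreal (exp (- r * t)) \<partial>halfline \<partial>M)"
    by (subst T.nn_integral_fst[symmetric]) auto
  also have "\<dots> = (\<integral>\<^sup>+ \<omega>. ennreal (1 / r) * (\<integral>\<^sup>+ s. ennreal (exp (- r * s)) \<partial>stieltjes (\<lambda>t. \<eta> t \<omega>)) \<partial>M)"
    using \<eta> by (intro nn_integral_cong nn_integral_discount_stieltjes r)
      (auto simp: increasing_process_def)
  also have "\<dots> = ennreal (1 / r) * (\<integral>\<^sup>+ \<omega>. \<integral>\<^sup>+ s. ennreal (exp (- r * s)) \<partial>stieltjes (\<lambda>t. \<eta> t \<omega>) \<partial>M)"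
    using nn_integral_stieltjes_measurable[OF \<eta> e] by (intro nn_integral_cmult) simp
  finally show ?thesis using nn_integral_doleans[OF \<eta> e] by simp
qed

lemma integrable_doleans_bounded:
  assumes \<eta>: "increasing_process M \<eta>" and fin: "(\<integral>\<^sup>+ z. ennreal (exp (- r * snd z)) \<partial>doleans M \<eta>) < \<infinity>"
    and g: "g \<in> borel_measurable (timed M)"
      "\<And>\<omega> t. \<omega> \<in> space M \<Longrightarrow> 0 \<le> t \<Longrightarrow> \<bar>g (\<omega>, t)\<bar> \<le> b * exp (- r * t)"
    and b: "0 \<le> b"
  shows "integrable (doleans M \<eta>) g"
proof (rule integrableI_bounded)
  show "g \<in> borel_measurable (doleans M \<eta>)"
    using g(1) measurable_cong_sets[OF sets_doleans refl] by blast
  have [measurable]: "(\<lambda>z. snd z) \<in> borel_measurable (timed M)"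
    by (rule measurable_compose[OF measurable_snd halfline_measurable_id])
  have "(\<integral>\<^sup>+ z. ennreal (norm (g z)) \<partial>doleans M \<eta>)
    \<le> (\<integral>\<^sup>+ z. ennreal b * ennreal (exp (- r * snd z)) \<partial>doleans M \<eta>)"
    using g(2) b by (intro nn_integral_mono) (auto simp: space_doleans ennreal_mult[symmetric]
      intro!: ennreal_leI)
  also have "\<dots> = ennreal b * (\<integral>\<^sup>+ z. ennreal (exp (- r * snd z)) \<partial>doleans M \<eta>)"
    by (rule nn_integral_cmult) measurable
  also have "\<dots> < \<infinity>" using fin by (simp add: ennreal_mult_less_top)
  finally show "(\<integral>\<^sup>+ z. ennreal (norm (g z)) \<partial>doleans M \<eta>) < \<infinity>" .
qed

lemma (in prob_space) integrable_discounted_control: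
  assumes \<eta>: "increasing_process M \<eta>" and r: "0 < r"
    and fin: "(\<integral>\<^sup>+ z. ennreal (exp (- r * snd z)) \<partial>doleans M \<eta>) < \<infinity>"
  shows "integrable (timed M) (\<lambda>z. \<eta> (snd z) (fst z) * exp (- r * snd z))"
proof (rule integrableI_bounded)
  have [measurable]: "(\<lambda>z. \<eta> (snd z) (fst z)) \<in> borel_measurable (timed M)"
    by (rule right_continuous_process_measurable[OF increasing_process_imp_right_continuous[OF \<eta>]])
  have [measurable]: "(\<lambda>z. snd z) \<in> borel_measurable (timed M)"
    by (rule measurable_compose[OF measurable_snd halfline_measurable_id])
  show "(\<lambda>z. \<eta> (snd z) (fst z) * exp (- r * snd z)) \<in> borel_measurable (timed M)" by measurable
  have "(\<integral>\<^sup>+ z. ennreal (norm (\<eta> (snd z) (fst z) * exp (- r * snd z))) \<partial>timed M)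
    = (\<integral>\<^sup>+ z. ennreal (\<eta> (snd z) (fst z)) * ennreal (exp (- r * snd z)) \<partial>timed M)"
  proof (rule nn_integral_cong)
    fix z assume "z \<in> space (timed M)"
    then have "0 \<le> \<eta> (snd z) (fst z)"
      using \<eta> increasing_pathD(2)[of "\<lambda>t. \<eta> t (fst z)" "snd z"]
      by (auto simp: space_pair_measure space_halfline increasing_process_def)
    then show "ennreal (norm (\<eta> (snd z) (fst z) * exp (- r * snd z)))
      = ennreal (\<eta> (snd z) (fst z)) * ennreal (exp (- r * snd z))"
      by (simp add: abs_mult ennreal_mult[symmetric])
  qed
  also have "\<dots> < \<infinity>"
    using fin unfolding nn_integral_discount_doleans[OF \<eta> r] by (simp add: ennreal_mult_less_top)
  finally show "(\<integral>\<^sup>+ z. ennreal (norm (\<eta> (snd z) (fst z) * exp (- r * snd z))) \<partial>timed M) < \<infinity>" .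
qed

text \<open>
  An increasing process is a mixture, over the levels \<open>u\<close>, of unit jumps at its passage times. For a
  single jump the identity is the optional projection at a stopping time, where \<open>p\<close> and the
  discounted tail of \<open>D\<close> have the same expectation. Integrating over \<open>u\<close> replaces the tail by \<open>p\<close> under
  the Doleans measure, and integration by parts along each path turns the tail into \<open>D \<eta>\<close>.
\<close>

lemma (in prob_space) projection_duality:
  assumes F: "\<And>t. 0 \<le> t \<Longrightarrow> subalgebra M (F t)" "\<And>s t. 0 \<le> s \<Longrightarrow> s \<le> t \<Longrightarrow> subalgebra (F t) (F s)"
    and r: "0 < r"
    and \<eta>: "increasing_process M \<eta>" "adapted F \<eta>"
    and fin: "(\<integral>\<^sup>+ z. ennreal (exp (- r * snd z)) \<partial>doleans M \<eta>) < \<infinity>"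
    and D: "D \<in> borel_measurable (timed M)"
      "\<And>\<omega> t. \<omega> \<in> space M \<Longrightarrow> 0 \<le> t \<Longrightarrow> \<bar>D (\<omega>, t)\<bar> \<le> K"
    and p: "right_continuous_process M p" "\<And>t \<omega>. 0 \<le> t \<Longrightarrow> \<omega> \<in> space M \<Longrightarrow> \<bar>p t \<omega>\<bar> \<le> K / r"
    and projection: "\<And>s A. 0 \<le> s \<Longrightarrow> A \<in> sets (F s) \<Longrightarrow>
      (LINT \<omega>:A|M. discounted_tail r D s \<omega>) = (LINT \<omega>:A|M. exp (- r * s) * p s \<omega>)"
  shows "(LINT z|doleans M \<eta>. p (snd z) (fst z) * exp (- r * snd z)) =
    (LINT z|timed M. D z * \<eta> (snd z) (fst z) * exp (- r * snd z))"
proof -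
  interpret T: sigma_finite_measure halfline by (rule sigma_finite_halfline)
  interpret MT: pair_sigma_finite M halfline ..
  interpret MU: pair_sigma_finite M lborel ..
  let ?V = "discounted_tail r D" and ?W = "\<lambda>s \<omega>. exp (- r * s) * p s \<omega>"
  obtain \<omega>0 where "\<omega>0 \<in> space M" using not_empty by blast
  then have K: "0 \<le> K" using D(2)[OF _ order_refl] by force
  have Dpath: "(\<lambda>t. D (\<omega>, t)) \<in> borel_measurable halfline" if "\<omega> \<in> space M" for \<omega>
    by (rule measurable_compose[OF measurable_Pair1'[OF that] D(1)])
  have V: "right_continuous_process M ?V"
    by (rule right_continuous_process_discounted_tail[OF r D])
  have W: "right_continuous_process M ?W"
    using p(1) unfolding right_continuous_process_def right_continuous_path_def
    by (auto intro!: continuous_intros)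
  have Vb: "\<bar>?V t \<omega>\<bar> \<le> K / r * exp (- r * t)" if "0 \<le> t" "\<omega> \<in> space M" for t \<omega>
    by (rule discounted_tail_bound[OF r Dpath[OF that(2)] D(2)[OF that(2)] that(1)])
  have Wb: "\<bar>?W t \<omega>\<bar> \<le> K / r * exp (- r * t)" if "0 \<le> t" "\<omega> \<in> space M" for t \<omega>
    using mult_right_mono[OF p(2)[OF that], of "exp (- r * t)"]
      by (simp only: abs_mult abs_exp_cancel mult.commute) simp
  have le1: "K / r * exp (- r * t) \<le> K / r" if "0 \<le> t" for t
    using K r that by (intro mult_left_le) auto
  have Vm: "(\<lambda>z. ?V (snd z) (fst z)) \<in> borel_measurable (timed M)"
    by (rule right_continuous_process_measurable[OF V])
  have Wm: "(\<lambda>z. ?W (snd z) (fst z)) \<in> borel_measurable (timed M)"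
    by (rule right_continuous_process_measurable[OF W])
  have Kr: "0 \<le> K / r" using K r by simp
  have Vint: "integrable (doleans M \<eta>) (\<lambda>z. ?V (snd z) (fst z))"
    by (rule integrable_doleans_bounded[OF \<eta>(1) fin Vm _ Kr]) (simp only: fst_conv snd_conv Vb)
  have Wint: "integrable (doleans M \<eta>) (\<lambda>z. ?W (snd z) (fst z))"
    by (rule integrable_doleans_bounded[OF \<eta>(1) fin Wm _ Kr]) (simp only: fst_conv snd_conv Wb)
  have mixture: "(LINT z|doleans M \<eta>. Z (snd z) (fst z)) =
      (LINT u|lborel. LINT \<omega>|M. indicator (level_set M \<eta>) (\<omega>, u) * Z (passage_time (\<lambda>t. \<eta> t \<omega>) u) \<omega>)"
    if Zm: "(\<lambda>z. Z (snd z) (fst z)) \<in> borel_measurable (timed M)"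
      and Zi: "integrable (doleans M \<eta>) (\<lambda>z. Z (snd z) (fst z))" for Z :: "real \<Rightarrow> 'a \<Rightarrow> real"
    using MU.integral_snd[of "\<lambda>\<omega> u. indicator (level_set M \<eta>) (\<omega>, u) * Z (passage_time (\<lambda>t. \<eta> t \<omega>) u) \<omega>"]
      Zi[unfolded integrable_doleans_levels[OF \<eta>(1) Zm]]
    unfolding integral_doleans_levels[OF \<eta>(1) Zm]
    by (simp add: split_beta')
  have stop: "(LINT \<omega>|M. indicator (level_set M \<eta>) (\<omega>, u) * ?V (passage_time (\<lambda>t. \<eta> t \<omega>) u) \<omega>) =
      (LINT \<omega>|M. indicator (level_set M \<eta>) (\<omega>, u) * ?W (passage_time (\<lambda>t. \<eta> t \<omega>) u) \<omega>)" for u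
  proof -
    define B where "B = {\<omega> \<in> space M. (\<omega>, u) \<in> level_set M \<eta>}"
    define \<tau> where "\<tau> \<omega> = passage_time (\<lambda>t. \<eta> t \<omega>) u" for \<omega>
    have "(LINT \<omega>:B|M. ?V (\<tau> \<omega>) \<omega>) = (LINT \<omega>:B|M. ?W (\<tau> \<omega>) \<omega>)"
    proof (rule projection_at_random_time[OF V _ W _ F, where b="K / r"])
      show "\<bar>?V t \<omega>\<bar> \<le> K / r" "\<bar>?W t \<omega>\<bar> \<le> K / r" if "0 \<le> t" "\<omega> \<in> space M" for t \<omega>
        using Vb[OF that] Wb[OF that] le1[OF that(1)] by linarith+
      show "\<tau> \<in> M \<rightarrow>\<^sub>M halfline"
        using measurable_compose[OF measurable_Pair2'[of u lborel M]
          passage_time_process_measurable[OF \<eta>(1)]]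
        by (simp add: \<tau>_def[abs_def])
      show "B \<in> sets M"
      proof -
        have "(\<lambda>\<omega>. (\<omega>, u)) -` level_set M \<eta> \<inter> space M \<in> sets M"
          by (rule measurable_sets[OF _ level_set_measurable[OF \<eta>(1)]]) simp
        moreover have "B = (\<lambda>\<omega>. (\<omega>, u)) -` level_set M \<eta> \<inter> space M" by (auto simp: B_def)
        ultimately show ?thesis by simp
      qed
      show "{\<omega> \<in> B. \<tau> \<omega> \<le> s} \<in> sets (F s)" if s: "0 \<le> s" for s
      proof -
        have sp: "space (F s) = space M" using F(1)[OF s] by (simp add: subalgebra_def)
        have [measurable]: "\<eta> s \<in> borel_measurable (F s)" using \<eta>(2) s by (simp add: adapted_def)
        have "\<omega> \<in> B \<and> \<tau> \<omega> \<le> s \<longleftrightarrow> \<omega> \<in> space M \<and> 0 < u \<and> u \<le> \<eta> s \<omega>" for \<omega>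
        proof (cases "\<omega> \<in> space M \<and> u \<in> attained_levels (\<lambda>t. \<eta> t \<omega>)")
          case True
          then show ?thesis using passage_time_le_iff[of "\<lambda>t. \<eta> t \<omega>" u s] \<eta>(1) s
            by (auto simp: B_def \<tau>_def level_set_def space_pair_measure increasing_process_def
              attained_levels_def)
        next
          case False
          then show ?thesis using s by (auto simp: B_def level_set_def attained_levels_def)
        qed
        then have "{\<omega> \<in> B. \<tau> \<omega> \<le> s} = {\<omega> \<in> space (F s). 0 < u \<and> u \<le> \<eta> s \<omega>}"
          unfolding sp by blast
        also have "\<dots> \<in> sets (F s)" by measurable
        finally show ?thesis .
      qed
    qed (assumption | rule projection)+
    moreover have "(LINT \<omega>:B|M. Z (\<tau> \<omega>) \<omega>) = (LINT \<omega>|M. indicator (level_set M \<eta>) (\<omega>, u) * Z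
      (passage_time (\<lambda>t. \<eta> t \<omega>) u) \<omega>)" for Z :: "real \<Rightarrow> 'a \<Rightarrow> real"
      unfolding set_lebesgue_integral_def
      by (intro Bochner_Integration.integral_cong) (auto simp: B_def \<tau>_def indicator_def)
    ultimately show ?thesis by simp
  qed
  have "(LINT z|doleans M \<eta>. ?W (snd z) (fst z)) = (LINT z|doleans M \<eta>. ?V (snd z) (fst z))"
    unfolding mixture[OF Vm Vint] mixture[OF Wm Wint] stop ..
  also have "\<dots> = (LINT \<omega>|M. LINT s|stieltjes (\<lambda>t. \<eta> t \<omega>). ?V s \<omega>)"
    using integral_doleans[OF \<eta>(1) Vint] by simp
  also have "\<dots> = (LINT \<omega>|M. LINT t|halfline. D (\<omega>, t) * \<eta> t \<omega> * exp (- r * t))"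
  proof (rule integral_cong_AE)
    have [measurable]: "(\<lambda>z. snd z) \<in> borel_measurable (timed M)"
      by (rule measurable_compose[OF measurable_snd halfline_measurable_id])
    have [measurable]: "(\<lambda>z. \<eta> (snd z) (fst z)) \<in> borel_measurable (timed M)"
      by (rule right_continuous_process_measurable[OF increasing_process_imp_right_continuous[OF \<eta>(1)]])
    have [measurable]: "D \<in> borel_measurable (timed M)" by (rule D(1))
    show "(\<lambda>\<omega>. LINT s|stieltjes (\<lambda>t. \<eta> t \<omega>). ?V s \<omega>) \<in> borel_measurable M"
      using borel_measurable_integrable[OF integrable_integral_stieltjes[OF \<eta>(1) Vint]] by simp
    have "(\<lambda>z. D z * \<eta> (snd z) (fst z) * exp (- r * snd z)) \<in> borel_measurable (timed M)" by measurable
    then have "(\<lambda>(\<omega>, t). D (\<omega>, t) * \<eta> t \<omega> * exp (- r * t)) \<in> borel_measurable (timed M)"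
      by (simp only: split_beta' prod.collapse)
    then show "(\<lambda>\<omega>. LINT t|halfline. D (\<omega>, t) * \<eta> t \<omega> * exp (- r * t)) \<in> borel_measurable M"
      by (rule T.borel_measurable_lebesgue_integral)
    have e: "(\<lambda>z. ennreal (exp (- r * snd z))) \<in> borel_measurable (timed M)" by measurable
    have "AE \<omega> in M. (\<integral>\<^sup>+ s. ennreal (exp (- r * s)) \<partial>stieltjes (\<lambda>t. \<eta> t \<omega>)) \<noteq> \<infinity>"
      using fin nn_integral_stieltjes_measurable[OF \<eta>(1) e] unfolding nn_integral_doleans[OF \<eta>(1) e]
      by (intro nn_integral_PInf_AE) auto
    with AE_space show "AE \<omega> in M. (LINT s|stieltjes (\<lambda>t. \<eta> t \<omega>). ?V s \<omega>) =
      (LINT t|halfline. D (\<omega>, t) * \<eta> t \<omega> * exp (- r * t))"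
    proof eventually_elim
      case (elim \<omega>)
      then show ?case
        unfolding discounted_tail_def using \<eta>(1)
        by (intro integral_tail_stieltjes[OF _ r Dpath D(2)])
          (auto simp: increasing_process_def less_top)
    qed
  qed
  also have "\<dots> = (LINT z|timed M. D z * \<eta> (snd z) (fst z) * exp (- r * snd z))"
  proof -
    have "integrable (timed M) (\<lambda>z. D z * \<eta> (snd z) (fst z) * exp (- r * snd z))"
    proof (rule Bochner_Integration.integrable_bound)
      show "integrable (timed M) (\<lambda>z. K * (\<eta> (snd z) (fst z) * exp (- r * snd z)))"
        using integrable_discounted_control[OF \<eta>(1) r fin] by (intro integrable_mult_right)
      have [measurable]: "(\<lambda>z. snd z) \<in> borel_measurable (timed M)"
        by (rule measurable_compose[OF measurable_snd halfline_measurable_id])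
      have [measurable]: "(\<lambda>z. \<eta> (snd z) (fst z)) \<in> borel_measurable (timed M)"
        by (rule right_continuous_process_measurable[OF
          increasing_process_imp_right_continuous[OF \<eta>(1)]])
      show "(\<lambda>z. D z * \<eta> (snd z) (fst z) * exp (- r * snd z)) \<in> borel_measurable (timed M)"
        using D(1) by measurable
      show "AE z in timed M. norm (D z * \<eta> (snd z) (fst z) * exp (- r * snd z))
        \<le> norm (K * (\<eta> (snd z) (fst z) * exp (- r * snd z)))"
        using D(2) K by (intro AE_I2) (auto simp: abs_mult space_pair_measure space_halfline
          mult.assoc intro!: mult_right_mono)
    qed
    from MT.integral_fst'[OF this] show ?thesis by simp
  qed
  finally show ?thesis by (simp add: mult.commute)
qed

section \<open>Cadlag paths\<close>

lemma cadlag_imp_right_continuous_path: "cadlag f \<Longrightarrow> right_continuous_path f"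
  by (simp add: cadlag_def right_continuous_path_def)

lemma cadlag_linear:
  assumes "cadlag f" "cadlag g" shows "cadlag (\<lambda>t. a * f t + b * g t)"
  unfolding cadlag_def
proof (intro conjI allI impI)
  fix t :: real assume "0 \<le> t"
  then show "continuous (at_right t) (\<lambda>t. a * f t + b * g t)"
    using assms unfolding cadlag_def by (intro continuous_intros) auto
next
  fix t :: real assume "0 < t"
  then obtain l m where "(f \<longlongrightarrow> l) (at_left t)" "(g \<longlongrightarrow> m) (at_left t)"
    using assms unfolding cadlag_def by blast
  then have "((\<lambda>t. a * f t + b * g t) \<longlongrightarrow> a * l + b * m) (at_left t)"
    by (intro tendsto_intros)
  then show "\<exists>l. ((\<lambda>t. a * f t + b * g t) \<longlongrightarrow> l) (at_left t)" by blast
qed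

lemma cadlag_step: assumes "0 \<le> t0" shows "cadlag (indicator {t0..})"
  unfolding cadlag_def
proof (intro conjI allI impI)
  fix t :: real assume "0 \<le> t"
  then show "continuous (at_right t) (indicator {t0..} :: real \<Rightarrow> real)"
    using increasing_path_step[OF assms] by (simp add: increasing_path_def right_continuous_path_def)
next
  fix t :: real
  have "eventually (\<lambda>s. indicator {t0..} s = (if t0 < t then 1 else 0 :: real)) (at_left t)"
    unfolding eventually_at_left_field
    by (intro exI[of _ "if t0 < t then t0 else t - 1"]) (auto simp: indicator_def)
  then have "(indicator {t0..} \<longlongrightarrow> (if t0 < t then 1 else 0 :: real)) (at_left t)"
    by (rule tendsto_eventually)
  then show "\<exists>l. ((indicator {t0..} :: real \<Rightarrow> real) \<longlongrightarrow> l) (at_left t)" by blast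
qed

lemma cadlag_zero: "cadlag (\<lambda>t. 0)"
  by (auto simp: cadlag_def)

section \<open>The running cost and the cone of controls\<close>

locale control_problem = prob_space M for M :: "'a measure" +
  fixes F :: "real \<Rightarrow> 'a measure" and X k :: "real \<Rightarrow> 'a \<Rightarrow> real"
    and c c' :: "real \<Rightarrow> real \<Rightarrow> real \<Rightarrow> real" and r K :: real
  assumes subalgebra: "0 \<le> t \<Longrightarrow> subalgebra M (F t)"
    and filtration: "0 \<le> s \<Longrightarrow> s \<le> t \<Longrightarrow> subalgebra (F t) (F s)"
    and r_pos: "0 < r"
    and X: "right_continuous_process M X"
    and c_measurable: "(\<lambda>(t, x, z). c t x z) \<in> borel_measurable
      (restrict_space borel ({0..} \<times> UNIV \<times> {0..}))"
    and k_adapted: "adapted F k"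
    and k_path: "\<omega> \<in> space M \<Longrightarrow> right_continuous_path (\<lambda>t. k t \<omega>)"
    and k_nonneg: "0 \<le> t \<Longrightarrow> \<omega> \<in> space M \<Longrightarrow> 0 \<le> k t \<omega>"
    and k_sup: "(\<integral>\<^sup>+ \<omega>. (SUP t\<in>{0..}. ennreal (\<bar>k t \<omega>\<bar>\<^sup>2)) \<partial>M) < \<infinity>"
    and c_deriv: "0 \<le> t \<Longrightarrow> 0 \<le> z \<Longrightarrow> (c t x has_real_derivative c' t x z) (at z within {0..})"
    and c'_cont: "0 \<le> t \<Longrightarrow> continuous_on {0..} (c' t x)"
    and c'_mono: "0 \<le> t \<Longrightarrow> mono_on {0..} (c' t x)"
    and c'_bound: "0 \<le> t \<Longrightarrow> 0 \<le> z \<Longrightarrow> \<bar>c' t x z\<bar> \<le> K"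
begin

abbreviation controls :: "(real \<Rightarrow> 'a \<Rightarrow> real) set" where
  "controls \<equiv> singular_controls M F r"

lemma sigma_finite_pair: "pair_sigma_finite M halfline"
  by (intro pair_sigma_finite.intro sigma_finite_halfline sigma_finite_measure_axioms)

lemma K_nonneg: "0 \<le> K"
  using c'_bound[of 0 0] by force

lemma k: "right_continuous_process M k"
  using k_adapted k_path subalgebra
  by (auto simp: right_continuous_process_def adapted_def intro: measurable_from_subalg)

lemma k_measurable: "(\<lambda>z. k (snd z) (fst z)) \<in> borel_measurable (timed M)"
  by (rule right_continuous_process_measurable[OF k])

lemma running_measurable:
  assumes h: "h \<in> borel_measurable (timed M)"
    and nonneg: "\<And>z. z \<in> space (timed M) \<Longrightarrow> 0 \<le> h z"
  shows "(\<lambda>z. c (snd z) (X (snd z) (fst z)) (h z)) \<in> borel_measurable (timed M)"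
proof -
  have "(\<lambda>z. (snd z, X (snd z) (fst z), h z)) \<in> timed M \<rightarrow>\<^sub>M restrict_space borel ({0..} \<times> UNIV \<times> {0..})"
  proof (rule measurable_restrict_space2)
    show "(\<lambda>z. (snd z, X (snd z) (fst z), h z)) \<in> borel_measurable (timed M)"
      by (intro borel_measurable_Pair halfline_time_measurable
        right_continuous_process_measurable[OF X] h)
  qed (use nonneg in \<open>auto simp: space_pair_measure space_halfline\<close>)
  from measurable_compose[OF this c_measurable] show ?thesis by simp
qed

text \<open>
  The derivative is the limit of the difference quotients with increments \<open>1 / (n + 1)\<close>. Right-sided
  increments stay inside \<open>[0, \<infinity>)\<close>, also at the boundary point \<open>0\<close>.
\<close>

lemma marginal_measurable:
  assumes h: "h \<in> borel_measurable (timed M)"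
    and nonneg: "\<And>z. z \<in> space (timed M) \<Longrightarrow> 0 \<le> h z"
  shows "(\<lambda>z. c' (snd z) (X (snd z) (fst z)) (h z)) \<in> borel_measurable (timed M)"
proof (rule borel_measurable_LIMSEQ_real)
  define e :: "nat \<Rightarrow> real" where "e n = 1 / real (Suc n)" for n
  have e: "0 < e n" for n by (simp add: e_def)
  have e0: "e \<longlonglongrightarrow> 0" unfolding e_def by (rule LIMSEQ_Suc[OF lim_1_over_n])
  let ?q = "\<lambda>n z. (c (snd z) (X (snd z) (fst z)) (h z + e n) - c (snd z) (X (snd z) (fst z)) (h z))
    / e n"
  show "?q n \<in> borel_measurable (timed M)" for n
  proof -
    have "(\<lambda>z. c (snd z) (X (snd z) (fst z)) (h z + e n)) \<in> borel_measurable (timed M)"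
      using h nonneg e[of n] by (intro running_measurable) (auto intro: add_nonneg_nonneg less_imp_le)
    then show ?thesis using running_measurable[OF h nonneg] by measurable
  qed
  fix z assume z: "z \<in> space (timed M)"
  then have t: "0 \<le> snd z" by (auto simp: space_pair_measure space_halfline)
  have "((\<lambda>y. (c (snd z) (X (snd z) (fst z)) y - c (snd z) (X (snd z) (fst z)) (h z)) / (y - h z))
      \<longlongrightarrow> c' (snd z) (X (snd z) (fst z)) (h z)) (at (h z) within {0..})"
    using c_deriv[OF t nonneg[OF z]] by (simp add: has_field_derivative_iff)
  moreover have "filterlim (\<lambda>n. h z + e n) (at (h z) within {0..}) sequentially"
    unfolding filterlim_at
  proof
    show "eventually (\<lambda>n. h z + e n \<in> {0..} \<and> h z + e n \<noteq> h z) sequentially"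
    proof (rule always_eventually, rule allI)
      fix n show "h z + e n \<in> {0..} \<and> h z + e n \<noteq> h z" using nonneg[OF z] e[of n] by auto
    qed
    show "(\<lambda>n. h z + e n) \<longlonglongrightarrow> h z"
      using tendsto_add[OF tendsto_const[of "h z"] e0] by simp
  qed
  ultimately have "(\<lambda>n. (c (snd z) (X (snd z) (fst z)) (h z + e n) -
    c (snd z) (X (snd z) (fst z)) (h z)) / ((h z + e n) - h z))
     \<longlonglongrightarrow> c' (snd z) (X (snd z) (fst z)) (h z)"
    by (rule filterlim_compose)
  then show "(\<lambda>n. ?q n z) \<longlonglongrightarrow> c' (snd z) (X (snd z) (fst z)) (h z)" by simp
qed

lemma mean_value:
  assumes t: "0 \<le> t" and a: "0 \<le> a" "a < b"
  obtains \<xi> where "a < \<xi>" "\<xi> < b" "c t x b - c t x a = c' t x \<xi> * (b - a)"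
proof -
  have "\<exists>\<xi>\<in>{a<..<b}. c t x b - c t x a = (\<lambda>h. h * c' t x \<xi>) (b - a)"
  proof (rule mvt_simple[OF a(2)])
    fix z assume z: "a \<le> z" "z \<le> b"
    have "(c t x has_real_derivative c' t x z) (at z within {a..b})"
      using c_deriv[OF t, of z x] z a by (auto intro: DERIV_subset)
    then show "(c t x has_derivative (\<lambda>h. h * c' t x z)) (at z within {a..b})"
      by (simp add: has_field_derivative_def mult_commute_abs)
  qed
  then show ?thesis using that by (auto simp: mult.commute)
qed

lemma running_above_tangent:
  assumes t: "0 \<le> t" and a: "0 \<le> a" and b: "0 \<le> b"
  shows "c' t x a * (b - a) \<le> c t x b - c t x a"
proof (cases a b rule: linorder_cases)
  case less
  from mean_value[OF t a less, of x] obtain \<xi> where \<xi>: "a < \<xi>" "c t x b - c t x a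
    = c' t x \<xi> * (b - a)" by blast
  have "c' t x a \<le> c' t x \<xi>" using c'_mono[OF t] \<xi>(1) a by (auto simp: mono_on_def)
  then show ?thesis using \<xi>(2) less by (simp add: mult_right_mono)
next
  case greater
  from mean_value[OF t b greater, of x] obtain \<xi> where \<xi>: "b < \<xi>" "\<xi> < a" "c t x a - c t x b
    = c' t x \<xi> * (a - b)" by blast
  have "c' t x \<xi> \<le> c' t x a" using c'_mono[OF t] \<xi>(1,2) b by (auto simp: mono_on_def)
  then have "c' t x \<xi> * (a - b) \<le> c' t x a * (a - b)" using greater by (intro mult_right_mono) auto
  then show ?thesis using \<xi>(3) by (simp add: algebra_simps)
qed simp

lemma running_Lipschitz:
  assumes t: "0 \<le> t" and a: "0 \<le> a" and b: "0 \<le> b"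
  shows "\<bar>c t x b - c t x a\<bar> \<le> K * (a + b)"
proof -
  have *: "\<bar>c t x b - c t x a\<bar> \<le> K * (a + b)" if "0 \<le> a" "a < b" for a b
  proof -
    from mean_value[OF t that, of x] obtain \<xi> where \<xi>: "a < \<xi>" "c t x b - c t x a
      = c' t x \<xi> * (b - a)" by blast
    have "\<bar>c' t x \<xi> * (b - a)\<bar> \<le> K * (a + b)"
      unfolding abs_mult using c'_bound[OF t, of \<xi> x] \<xi>(1) that K_nonneg by (intro mult_mono) auto
    then show ?thesis using \<xi>(2) by simp
  qed
  show ?thesis
    using *[of a b] *[of b a] a b K_nonneg
    by (cases a b rule: linorder_cases) (auto simp: abs_minus_commute add.commute)
qed

lemma
  assumes "\<theta> \<in> controls"
  shows control_increasing: "increasing_process M \<theta>"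
    and control_adapted: "adapted F \<theta>"
    and control_square: "(\<integral>\<^sup>+ \<omega>. (\<integral>\<^sup>+ t. ennreal (exp (- r * t)) \<partial>stieltjes (\<lambda>t. \<theta> t \<omega>))\<^sup>2 \<partial>M) < \<infinity>"
  using assms subalgebra unfolding singular_controls_def increasing_process_def adapted_def
    increasing_path_def
  by (auto intro: measurable_from_subalg cadlag_imp_right_continuous_path)

lemma control_mass_measurable:
  assumes "increasing_process M \<theta>"
  shows "(\<lambda>\<omega>. \<integral>\<^sup>+ t. ennreal (exp (- r * t)) \<partial>stieltjes (\<lambda>t. \<theta> t \<omega>)) \<in> borel_measurable M"
  using nn_integral_stieltjes_measurable[OF assms, of "\<lambda>z. ennreal (exp (- r * snd z))"]
    discount_measurable[of r M]
  by simp

lemma control_finite: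
  assumes \<theta>: "\<theta> \<in> controls"
  shows "(\<integral>\<^sup>+ z. ennreal (exp (- r * snd z)) \<partial>doleans M \<theta>) < \<infinity>"
proof -
  note inc = control_increasing[OF \<theta>]
  let ?Z = "\<lambda>\<omega>. \<integral>\<^sup>+ t. ennreal (exp (- r * t)) \<partial>stieltjes (\<lambda>t. \<theta> t \<omega>)"
  have [measurable]: "?Z \<in> borel_measurable M" by (rule control_mass_measurable[OF inc])
  have Z2: "(\<lambda>\<omega>. (?Z \<omega>)\<^sup>2) \<in> borel_measurable M" by measurable
  have "(\<integral>\<^sup>+ z. ennreal (exp (- r * snd z)) \<partial>doleans M \<theta>) = (\<integral>\<^sup>+ \<omega>. ?Z \<omega> \<partial>M)"
    using nn_integral_doleans[OF inc, of "\<lambda>z. ennreal (exp (- r * snd z))"]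
      discount_measurable[of r M] by simp
  also have "\<dots> \<le> (\<integral>\<^sup>+ \<omega>. 1 + (?Z \<omega>)\<^sup>2 \<partial>M)"
  proof (rule nn_integral_mono)
    fix \<omega>
    have "a \<le> 1 + a\<^sup>2" for a :: ennreal
    proof (cases "a \<le> 1")
      case False
      then have "a * 1 \<le> a * a" by (intro mult_left_mono) auto
      then show ?thesis by (simp add: power2_eq_square add_increasing)
    qed (simp add: add_increasing2)
    then show "?Z \<omega> \<le> 1 + (?Z \<omega>)\<^sup>2" .
  qed
  also have "\<dots> = 1 + (\<integral>\<^sup>+ \<omega>. (?Z \<omega>)\<^sup>2 \<partial>M)"
    using nn_integral_add[of "\<lambda>_. 1" M "\<lambda>\<omega>. (?Z \<omega>)\<^sup>2"] Z2 by (simp add: emeasure_space_1)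
  also have "\<dots> < \<infinity>" using control_square[OF \<theta>] by simp
  finally show ?thesis .
qed

lemma control_nonneg:
  assumes "\<theta> \<in> controls" "z \<in> space (timed M)"
  shows "0 \<le> \<theta> (snd z) (fst z)"
  using control_increasing[OF assms(1)] increasing_pathD(2)[of "\<lambda>t. \<theta> t (fst z)" "snd z"] assms(2)
  by (auto simp: increasing_process_def space_pair_measure space_halfline)

lemma control_measurable:
  assumes "\<theta> \<in> controls"
  shows "(\<lambda>z. \<theta> (snd z) (fst z)) \<in> borel_measurable (timed M)"
  by (intro right_continuous_process_measurable increasing_process_imp_right_continuous
    control_increasing assms)

text \<open>
  Controls form a convex cone. The discounted mass of a combination is at most \<open>a + b\<close> times the
  maximum of the two masses, which bounds its square by the sum of the squares.
\<close>

lemma controls_cone: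
  assumes \<theta>: "\<theta> \<in> controls" and \<eta>: "\<eta> \<in> controls" and a: "0 \<le> a" and b: "0 \<le> b"
  shows "(\<lambda>t \<omega>. a * \<theta> t \<omega> + b * \<eta> t \<omega>) \<in> controls"
proof -
  note inc = control_increasing[OF \<theta>] control_increasing[OF \<eta>]
  let ?Z = "\<lambda>\<theta> \<omega>. \<integral>\<^sup>+ t. ennreal (exp (- r * t)) \<partial>stieltjes (\<lambda>t. \<theta> t \<omega>)"
  have path: "increasing_path (\<lambda>t. \<theta> t \<omega>)" "increasing_path (\<lambda>t. \<eta> t \<omega>)" if "\<omega> \<in> space M" for \<omega>
    using inc that by (auto simp: increasing_process_def)
  show ?thesis
    unfolding singular_controls_def
  proof (intro CollectI conjI ballI)
    show "adapted F (\<lambda>t \<omega>. a * \<theta> t \<omega> + b * \<eta> t \<omega>)"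
      unfolding adapted_def
    proof (intro allI impI)
      fix t :: real assume "0 \<le> t"
      then have [measurable]: "\<theta> t \<in> borel_measurable (F t)" "\<eta> t \<in> borel_measurable (F t)"
        using control_adapted[OF \<theta>] control_adapted[OF \<eta>] by (auto simp: adapted_def)
      show "(\<lambda>\<omega>. a * \<theta> t \<omega> + b * \<eta> t \<omega>) \<in> borel_measurable (F t)" by measurable
    qed
    fix \<omega> assume \<omega>: "\<omega> \<in> space M"
    show "cadlag (\<lambda>t. a * \<theta> t \<omega> + b * \<eta> t \<omega>)"
      using \<theta> \<eta> \<omega> by (intro cadlag_linear) (auto simp: singular_controls_def)
    show "mono_on {0..} (\<lambda>t. a * \<theta> t \<omega> + b * \<eta> t \<omega>)" "0 \<le> a * \<theta> 0 \<omega> + b * \<eta> 0 \<omega>"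
      using increasing_path_linear[OF path[OF \<omega>] a b] by (auto simp: increasing_path_def)
  next
    have [measurable]: "?Z \<theta> \<in> borel_measurable M" "?Z \<eta> \<in> borel_measurable M"
      using control_mass_measurable inc by auto
    have Z2: "(\<lambda>\<omega>. (?Z \<theta> \<omega>)\<^sup>2) \<in> borel_measurable M" "(\<lambda>\<omega>. (?Z \<eta> \<omega>)\<^sup>2) \<in> borel_measurable M"
      by measurable
    have e: "(\<lambda>t. ennreal (exp (- r * t))) \<in> borel_measurable halfline" using halfline_measurable_id
      by measurable
    have "(\<integral>\<^sup>+ \<omega>. (?Z (\<lambda>t \<omega>. a * \<theta> t \<omega> + b * \<eta> t \<omega>) \<omega>)\<^sup>2 \<partial>M)
        \<le> (\<integral>\<^sup>+ \<omega>. (ennreal (a + b))\<^sup>2 * ((?Z \<theta> \<omega>)\<^sup>2 + (?Z \<eta> \<omega>)\<^sup>2) \<partial>M)"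
    proof (rule nn_integral_mono)
      fix \<omega> assume \<omega>: "\<omega> \<in> space M"
      have "?Z (\<lambda>t \<omega>. a * \<theta> t \<omega> + b * \<eta> t \<omega>) \<omega> = ennreal a * ?Z \<theta> \<omega> + ennreal b * ?Z \<eta> \<omega>"
        by (rule nn_integral_stieltjes_linear[OF path[OF \<omega>] a b e])
      also have "\<dots> \<le> ennreal a * max (?Z \<theta> \<omega>) (?Z \<eta> \<omega>) + ennreal b * max (?Z \<theta> \<omega>) (?Z \<eta> \<omega>)"
        by (intro add_mono mult_left_mono) auto
      also have "\<dots> = ennreal (a + b) * max (?Z \<theta> \<omega>) (?Z \<eta> \<omega>)"
        using a b by (simp add: distrib_right)
      finally have "(?Z (\<lambda>t \<omega>. a * \<theta> t \<omega> + b * \<eta> t \<omega>) \<omega>)\<^sup>2 \<le> (ennreal (a + b) * max (?Z \<theta> \<omega>) (?Z \<eta> \<omega>))\<^sup>2"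
        by (intro power_mono) auto
      also have "\<dots> = (ennreal (a + b))\<^sup>2 * (max (?Z \<theta> \<omega>) (?Z \<eta> \<omega>))\<^sup>2"
        by (rule power_mult_distrib)
      also have "\<dots> \<le> (ennreal (a + b))\<^sup>2 * ((?Z \<theta> \<omega>)\<^sup>2 + (?Z \<eta> \<omega>)\<^sup>2)"
        by (intro mult_left_mono) (auto simp: max_def add_increasing add_increasing2)
      finally show "(?Z (\<lambda>t \<omega>. a * \<theta> t \<omega> + b * \<eta> t \<omega>) \<omega>)\<^sup>2
        \<le> (ennreal (a + b))\<^sup>2 * ((?Z \<theta> \<omega>)\<^sup>2 + (?Z \<eta> \<omega>)\<^sup>2)" .
    qed
    also have "\<dots> = (ennreal (a + b))\<^sup>2 * ((\<integral>\<^sup>+ \<omega>. (?Z \<theta> \<omega>)\<^sup>2 \<partial>M) + (\<integral>\<^sup>+ \<omega>. (?Z \<eta> \<omega>)\<^sup>2 \<partial>M))"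
      using nn_integral_cmult[of "\<lambda>\<omega>. (?Z \<theta> \<omega>)\<^sup>2 + (?Z \<eta> \<omega>)\<^sup>2" M "(ennreal (a + b))\<^sup>2"]
        nn_integral_add[OF Z2] Z2 by simp
    also have "\<dots> < \<infinity>"
      using control_square[OF \<theta>] control_square[OF \<eta>]
        by (simp add: ennreal_mult_less_top power2_eq_square[of "ennreal (a + b)"])
    finally show "(\<integral>\<^sup>+ \<omega>. (?Z (\<lambda>t \<omega>. a * \<theta> t \<omega> + b * \<eta> t \<omega>) \<omega>)\<^sup>2 \<partial>M) < \<infinity>" .
  qed
qed

lemma jump_path:
  "(\<lambda>t. indicator A \<omega> * indicator {t0..} t :: real) = (if \<omega> \<in> A then indicator {t0..} else (\<lambda>t. 0))"
  by (auto simp: indicator_def)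

text \<open>
  A unit jump at a deterministic time on an event known at that time: the perturbation that tests
  the subgradient pointwise.
\<close>

lemma jump_control:
  assumes t0: "0 \<le> t0" and A: "A \<in> sets (F t0)"
  shows "(\<lambda>t \<omega>. indicator A \<omega> * indicator {t0..} t) \<in> controls"
  unfolding singular_controls_def
proof (intro CollectI conjI ballI)
  show "adapted F (\<lambda>t \<omega>. indicator A \<omega> * indicator {t0..} t)"
    unfolding adapted_def
  proof (intro allI impI)
    fix t :: real assume t: "0 \<le> t"
    show "(\<lambda>\<omega>. indicator A \<omega> * indicator {t0..} t :: real) \<in> borel_measurable (F t)"
    proof (cases "t0 \<le> t")
      case True
      then have "A \<in> sets (F t)" using filtration[OF t0 True] A by (auto simp: subalgebra_def)
      then show ?thesis by measurable
    qed simp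
  qed
  have e: "(\<lambda>t. ennreal (exp (- r * t))) \<in> borel_measurable halfline" using halfline_measurable_id
    by measurable
  have mass: "(\<integral>\<^sup>+ t. ennreal (exp (- r * t)) \<partial>stieltjes (\<lambda>t. indicator A \<omega> * indicator {t0..} t))
    \<le> 1" for \<omega>
    unfolding jump_path
    using r_pos t0 nn_integral_stieltjes_step[OF t0 e] nn_integral_stieltjes_zero[OF e]
    by (cases "\<omega> \<in> A") simp_all
  have "(\<integral>\<^sup>+ \<omega>. (\<integral>\<^sup>+ t. ennreal (exp (- r * t))
    \<partial>stieltjes (\<lambda>t. indicator A \<omega> * indicator {t0..} t))\<^sup>2 \<partial>M) \<le> (\<integral>\<^sup>+ \<omega>. 1 \<partial>M)"
    using power_mono[OF mass, where n=2] by (intro nn_integral_mono) auto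
  then show "(\<integral>\<^sup>+ \<omega>. (\<integral>\<^sup>+ t. ennreal (exp (- r * t))
    \<partial>stieltjes (\<lambda>t. indicator A \<omega> * indicator {t0..} t))\<^sup>2 \<partial>M) < \<infinity>"
    by (simp add: emeasure_space_1 le_less_trans[OF _ ennreal_one_less_top])
  fix \<omega>
  show "cadlag (\<lambda>t. indicator A \<omega> * indicator {t0..} t)"
    unfolding jump_path by (auto simp: cadlag_step[OF t0] cadlag_zero)
  show "mono_on {0..} (\<lambda>t. indicator A \<omega> * indicator {t0..} t :: real)"
    by (auto simp: mono_on_def indicator_def)
qed simp

section \<open>Intervention costs\<close>

text \<open>
  By right-continuity the supremum may be taken over the rational times.
\<close>

lemma sup_cost_measurable: "(\<lambda>\<omega>. SUP t\<in>{0..}. ennreal (\<bar>k t \<omega>\<bar>\<^sup>2)) \<in> borel_measurable M"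
proof -
  have [measurable]: "k (real i / real (Suc n)) \<in> borel_measurable M" for i n
    using k by (simp add: right_continuous_process_def)
  let ?k2 = "\<lambda>t \<omega>. ennreal (\<bar>k t \<omega>\<bar>\<^sup>2)"
  have "(SUP t\<in>{0..}. ?k2 t \<omega>) = (SUP n. SUP i. ?k2 (real i / real (Suc n)) \<omega>)" (is "?l = ?r")
    if \<omega>: "\<omega> \<in> space M" for \<omega>
  proof (rule antisym)
    show "?l \<le> ?r"
    proof (rule SUP_least)
      fix t :: real assume t: "t \<in> {0..}"
      have lim: "(\<lambda>n. ?k2 (grid_above n t) \<omega>) \<longlonglongrightarrow> ?k2 t \<omega>"
        using right_continuous_path_grid[OF k_path[OF \<omega>], of t] t by (intro tendsto_intros) auto
      have "?k2 (grid_above n t) \<omega> \<le> ?r" for n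
        unfolding grid_above_def by (intro SUP_upper2[where i=n] SUP_upper) auto
      then show "?k2 t \<omega> \<le> ?r" by (intro LIMSEQ_le_const2[OF lim] exI[of _ 0] allI impI)
    qed
    show "?r \<le> ?l" by (intro SUP_least SUP_upper) auto
  qed
  note eq = this
  have "(\<lambda>\<omega>. SUP n. SUP i. ?k2 (real i / real (Suc n)) \<omega>) \<in> borel_measurable M" by measurable
  then show ?thesis by (rule measurable_cong[THEN iffD2, rotated]) (rule eq)
qed

definition intervention :: "(real \<Rightarrow> 'a \<Rightarrow> real) \<Rightarrow> real" where
  "intervention \<eta> = (LINT z|doleans M \<eta>. k (snd z) (fst z) * exp (- r * snd z))"

lemma discounted_k_measurable: "(\<lambda>z. k (snd z) (fst z) * exp (- r * snd z)) \<in> borel_measurable (timed M)"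
  using k_measurable discount_measurable[of r M] by measurable

lemma discounted_k_nonneg: "z \<in> space M \<times> {0..} \<Longrightarrow> 0 \<le> k (snd z) (fst z) * exp (- r * snd z)"
  using k_nonneg by auto

text \<open>
  The intervention cost of a path is at most \<open>(sup k) Z\<close>, where \<open>Z\<close> is the discounted mass of
  the control; it is integrable by \<open>ab \<le> a\<^sup>2 + b\<^sup>2\<close>, since both factors are square-integrable.
\<close>

lemma nn_intervention_finite:
  assumes \<eta>: "\<eta> \<in> controls"
  shows "(\<integral>\<^sup>+ z. ennreal (k (snd z) (fst z) * exp (- r * snd z)) \<partial>doleans M \<eta>) < \<infinity>"
proof -
  note inc = control_increasing[OF \<eta>]
  let ?Z = "\<lambda>\<omega>. \<integral>\<^sup>+ t. ennreal (exp (- r * t)) \<partial>stieltjes (\<lambda>t. \<eta> t \<omega>)"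
  let ?S = "\<lambda>\<omega>. SUP t\<in>{0..}. ennreal (\<bar>k t \<omega>\<bar>\<^sup>2)"
  have Z2: "(\<lambda>\<omega>. (?Z \<omega>)\<^sup>2) \<in> borel_measurable M" 
    using control_mass_measurable[OF inc] by measurable
  have e: "(\<lambda>t. ennreal (exp (- r * t))) \<in> borel_measurable (stieltjes f)" for f
    using measurable_cong_sets[OF sets_stieltjes refl] halfline_measurable_id by measurable
  have "(\<integral>\<^sup>+ z. ennreal (k (snd z) (fst z) * exp (- r * snd z)) \<partial>doleans M \<eta>) =
    (\<integral>\<^sup>+ \<omega>. \<integral>\<^sup>+ t. ennreal (k t \<omega> * exp (- r * t)) \<partial>stieltjes (\<lambda>t. \<eta> t \<omega>) \<partial>M)"
    using nn_integral_doleans[OF inc, of "\<lambda>z. ennreal (k (snd z) (fst z) * exp (- r * snd z))"]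
      discounted_k_measurable
    by simp
  also have "\<dots> \<le> (\<integral>\<^sup>+ \<omega>. ?S \<omega> + (?Z \<omega>)\<^sup>2 \<partial>M)"
  proof (rule nn_integral_mono)
    fix \<omega> assume \<omega>: "\<omega> \<in> space M"
    have "(\<integral>\<^sup>+ t. ennreal (k t \<omega> * exp (- r * t)) \<partial>stieltjes (\<lambda>t. \<eta> t \<omega>))
      \<le> (\<integral>\<^sup>+ t. (SUP s\<in>{0..}. ennreal (k s \<omega>)) * ennreal (exp (- r * t)) \<partial>stieltjes (\<lambda>t. \<eta> t \<omega>))"
    proof (rule nn_integral_mono)
      fix t assume "t \<in> space (stieltjes (\<lambda>t. \<eta> t \<omega>))"
      then have t: "t \<in> {0..}" by (simp add: space_stieltjes)
      have "ennreal (k t \<omega> * exp (- r * t)) = ennreal (k t \<omega>) * ennreal (exp (- r * t))"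
        using k_nonneg[OF _ \<omega>] t by (intro ennreal_mult) auto
      also have "\<dots> \<le> (SUP s\<in>{0..}. ennreal (k s \<omega>)) * ennreal (exp (- r * t))"
        by (intro mult_right_mono SUP_upper[OF t]) simp
      finally show "ennreal (k t \<omega> * exp (- r * t))
        \<le> (SUP s\<in>{0..}. ennreal (k s \<omega>)) * ennreal (exp (- r * t))" .
    qed
    also have "\<dots> = (SUP s\<in>{0..}. ennreal (k s \<omega>)) * ?Z \<omega>"
      by (rule nn_integral_cmult[OF e])
    also have "\<dots> = (SUP s\<in>{0..}. ennreal (k s \<omega>) * ?Z \<omega>)"
      by (subst SUP_mult_right_ennreal) auto
    also have "\<dots> \<le> ?S \<omega> + (?Z \<omega>)\<^sup>2"
    proof (rule SUP_least)
      fix s :: real assume s: "s \<in> {0..}"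
      have ab: "a * b \<le> a\<^sup>2 + b\<^sup>2" for a b :: ennreal
      proof (cases "a \<le> b")
        case True
        then have "a * b \<le> b * b" by (intro mult_right_mono) auto
        then show ?thesis by (simp add: power2_eq_square add_increasing)
      next
        case False
        then have "a * b \<le> a * a" by (intro mult_left_mono) auto
        then show ?thesis by (simp add: power2_eq_square add_increasing2)
      qed
      have "ennreal (k s \<omega>) * ?Z \<omega> \<le> (ennreal (k s \<omega>))\<^sup>2 + (?Z \<omega>)\<^sup>2" by (rule ab)
      also have "(ennreal (k s \<omega>))\<^sup>2 = ennreal (\<bar>k s \<omega>\<bar>\<^sup>2)"
        using k_nonneg[OF _ \<omega>] s by (simp add: ennreal_power)
      also have "ennreal (\<bar>k s \<omega>\<bar>\<^sup>2) \<le> ?S \<omega>" by (rule SUP_upper[OF s])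
      finally show "ennreal (k s \<omega>) * ?Z \<omega> \<le> ?S \<omega> + (?Z \<omega>)\<^sup>2" by (simp add: add_mono)
    qed
    finally show "(\<integral>\<^sup>+ t. ennreal (k t \<omega> * exp (- r * t)) \<partial>stieltjes (\<lambda>t. \<eta> t \<omega>)) \<le> ?S \<omega> + (?Z \<omega>)\<^sup>2" .
  qed
  also have "\<dots> = (\<integral>\<^sup>+ \<omega>. ?S \<omega> \<partial>M) + (\<integral>\<^sup>+ \<omega>. (?Z \<omega>)\<^sup>2 \<partial>M)"
    by (rule nn_integral_add[OF sup_cost_measurable Z2])
  also have "\<dots> < \<infinity>" using k_sup control_square[OF \<eta>] by simp
  finally show ?thesis .
qed

lemma intervention_integrable:
  assumes \<eta>: "\<eta> \<in> controls"
  shows "integrable (doleans M \<eta>) (\<lambda>z. k (snd z) (fst z) * exp (- r * snd z))"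
proof (rule integrableI_nonneg)
  show "(\<lambda>z. k (snd z) (fst z) * exp (- r * snd z)) \<in> borel_measurable (doleans M \<eta>)"
    using discounted_k_measurable measurable_cong_sets[OF sets_doleans refl] by blast
  show "AE z in doleans M \<eta>. 0 \<le> k (snd z) (fst z) * exp (- r * snd z)"
    using discounted_k_nonneg by (intro AE_I2) (auto simp: space_doleans)
qed (rule nn_intervention_finite[OF \<eta>])

lemma intervention_eq_nn_integral:
  assumes \<eta>: "\<eta> \<in> controls"
  shows "ennreal (intervention \<eta>) = (\<integral>\<^sup>+ z. ennreal (k (snd z) (fst z) * exp (- r * snd z)) \<partial>doleans
    M \<eta>)"
    and "0 \<le> intervention \<eta>"
proof -
  have nonneg: "AE z in doleans M \<eta>. 0 \<le> k (snd z) (fst z) * exp (- r * snd z)"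
    using discounted_k_nonneg by (intro AE_I2) (auto simp: space_doleans)
  show "ennreal (intervention \<eta>) = (\<integral>\<^sup>+ z. ennreal (k (snd z) (fst z) * exp (- r * snd z)) \<partial>doleans M \<eta>)"
    unfolding intervention_def using nn_integral_eq_integral[OF intervention_integrable[OF \<eta>]
      nonneg] by simp
  show "0 \<le> intervention \<eta>"
    unfolding intervention_def by (rule integral_nonneg_AE[OF nonneg])
qed

lemma intervention_linear:
  assumes \<theta>: "\<theta> \<in> controls" and \<eta>: "\<eta> \<in> controls" and a: "0 \<le> a" and b: "0 \<le> b"
  shows "intervention (\<lambda>t \<omega>. a * \<theta> t \<omega> + b * \<eta> t \<omega>) = a * intervention \<theta> + b * intervention \<eta>"
proof -
  let ?\<zeta> = "\<lambda>t \<omega>. a * \<theta> t \<omega> + b * \<eta> t \<omega>"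
  let ?g = "\<lambda>z. ennreal (k (snd z) (fst z) * exp (- r * snd z))"
  have \<zeta>: "?\<zeta> \<in> controls" by (rule controls_cone[OF \<theta> \<eta> a b])
  note inc = control_increasing[OF \<theta>] control_increasing[OF \<eta>] control_increasing[OF \<zeta>]
  have g: "?g \<in> borel_measurable (timed M)" using discounted_k_measurable by measurable
  have "ennreal (intervention ?\<zeta>) = (\<integral>\<^sup>+ \<omega>. \<integral>\<^sup>+ t. ?g (\<omega>, t) \<partial>stieltjes (\<lambda>t. ?\<zeta> t \<omega>) \<partial>M)"
    unfolding intervention_eq_nn_integral(1)[OF \<zeta>] by (rule nn_integral_doleans[OF inc(3) g])
  also have "\<dots> = (\<integral>\<^sup>+ \<omega>. ennreal a * (\<integral>\<^sup>+ t. ?g (\<omega>, t) \<partial>stieltjes (\<lambda>t. \<theta> t \<omega>))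
    + ennreal b * (\<integral>\<^sup>+ t. ?g (\<omega>, t) \<partial>stieltjes (\<lambda>t. \<eta> t \<omega>)) \<partial>M)"
    using inc measurable_compose[OF measurable_Pair1' g]
    by (intro nn_integral_cong nn_integral_stieltjes_linear a b) (auto simp: increasing_process_def)
  also have "\<dots> = ennreal a * (\<integral>\<^sup>+ z. ?g z \<partial>doleans M \<theta>) + ennreal b * (\<integral>\<^sup>+ z. ?g z \<partial>doleans M \<eta>)"
    unfolding nn_integral_doleans[OF inc(1) g] nn_integral_doleans[OF inc(2) g]
    using nn_integral_stieltjes_measurable[OF inc(1) g] nn_integral_stieltjes_measurable[OF inc(2) g]
    by (simp add: nn_integral_add nn_integral_cmult)
  also have "\<dots> = ennreal (a * intervention \<theta> + b * intervention \<eta>)"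
    unfolding intervention_eq_nn_integral(1)[OF \<theta>, symmetric]
      intervention_eq_nn_integral(1)[OF \<eta>, symmetric]
    using a b intervention_eq_nn_integral(2)[OF \<theta>] intervention_eq_nn_integral(2)[OF \<eta>]
    by (simp add: ennreal_mult)
  finally show ?thesis
    using a b intervention_eq_nn_integral(2)[OF \<theta>] intervention_eq_nn_integral(2)[OF \<eta>]
      intervention_eq_nn_integral(2)[OF \<zeta>]
    by (subst (asm) ennreal_inj) auto
qed

section \<open>The first-order condition\<close>

text \<open>
  The costs of two controls are compared through the difference of their running costs: since \<open>c\<close> is
  Lipschitz in the control, this difference is integrable on the product space, whereas
  the running cost of a single control is only integrated path by path.
\<close>

definition running_difference :: "(real \<Rightarrow> 'a \<Rightarrow> real) \<Rightarrow> (real \<Rightarrow> 'a \<Rightarrow> real) \<Rightarrow> 'a \<times> real \<Rightarrow> real" where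
  "running_difference \<theta> \<eta> z = (c (snd z) (X (snd z) (fst z)) (\<eta> (snd z) (fst z))
     - c (snd z) (X (snd z) (fst z)) (\<theta> (snd z) (fst z))) * exp (- r * snd z)"

definition marginal :: "(real \<Rightarrow> 'a \<Rightarrow> real) \<Rightarrow> 'a \<times> real \<Rightarrow> real" where
  "marginal \<theta> z = c' (snd z) (X (snd z) (fst z)) (\<theta> (snd z) (fst z))"

lemma marginal_control_measurable: "\<theta> \<in> controls \<Longrightarrow> marginal \<theta> \<in> borel_measurable (timed M)"
  unfolding marginal_def[abs_def] by (intro marginal_measurable control_measurable control_nonneg)

lemma marginal_bound:
  assumes "\<theta> \<in> controls" "z \<in> space (timed M)"
  shows "\<bar>marginal \<theta> z\<bar> \<le> K"
  unfolding marginal_def using control_nonneg[OF assms] assms(2)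
  by (intro c'_bound) (auto simp: space_pair_measure space_halfline)

lemma discounted_control_integrable:
  "\<eta> \<in> controls \<Longrightarrow> integrable (timed M) (\<lambda>z. \<eta> (snd z) (fst z) * exp (- r * snd z))"
  by (intro integrable_discounted_control control_increasing control_finite r_pos)

lemma running_difference_integrable:
  assumes \<theta>: "\<theta> \<in> controls" and \<eta>: "\<eta> \<in> controls"
  shows "integrable (timed M) (running_difference \<theta> \<eta>)"
proof (rule Bochner_Integration.integrable_bound)
  show "integrable (timed M) (\<lambda>z. K * (\<theta> (snd z) (fst z) * exp (- r * snd z))
    + K * (\<eta> (snd z) (fst z) * exp (- r * snd z)))"
    by (intro Bochner_Integration.integrable_add integrable_mult_right discounted_control_integrable \<theta> \<eta>)
  show "running_difference \<theta> \<eta> \<in> borel_measurable (timed M)"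
    unfolding running_difference_def[abs_def]
    by (intro borel_measurable_times borel_measurable_diff running_measurable control_measurable
        control_nonneg \<theta> \<eta> discount_measurable)
  show "AE z in timed M. norm (running_difference \<theta> \<eta> z)
      \<le> norm (K * (\<theta> (snd z) (fst z) * exp (- r * snd z)) + K * (\<eta> (snd z) (fst z) * exp (- r * snd z)))"
  proof (rule AE_I2)
    fix z assume z: "z \<in> space (timed M)"
    then have t: "0 \<le> snd z" by (auto simp: space_pair_measure space_halfline)
    have "norm (running_difference \<theta> \<eta> z) \<le> K * (\<theta> (snd z) (fst z)
      + \<eta> (snd z) (fst z)) * exp (- r * snd z)"
      unfolding running_difference_def real_norm_def abs_mult abs_exp_cancel
      using running_Lipschitz[OF t control_nonneg[OF \<theta> z] control_nonneg[OF \<eta> z]]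
        by (rule mult_right_mono) simp
    also have "\<dots> = K * (\<theta> (snd z) (fst z) * exp (- r * snd z))
      + K * (\<eta> (snd z) (fst z) * exp (- r * snd z))"
      by (simp add: algebra_simps)
    finally show "norm (running_difference \<theta> \<eta> z)
      \<le> norm (K * (\<theta> (snd z) (fst z) * exp (- r * snd z)) + K * (\<eta> (snd z) (fst z) * exp (- r * snd z)))"
      by simp
  qed
qed

lemma marginal_times_integrable:
  assumes \<theta>: "\<theta> \<in> controls" and \<eta>: "\<eta> \<in> controls"
  shows "integrable (timed M) (\<lambda>z. marginal \<theta> z * \<eta> (snd z) (fst z) * exp (- r * snd z))"
proof (rule Bochner_Integration.integrable_bound)
  show "integrable (timed M) (\<lambda>z. K * (\<eta> (snd z) (fst z) * exp (- r * snd z)))"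
    by (intro integrable_mult_right discounted_control_integrable \<eta>)
  show "(\<lambda>z. marginal \<theta> z * \<eta> (snd z) (fst z) * exp (- r * snd z)) \<in> borel_measurable (timed M)"
    by (intro borel_measurable_times marginal_control_measurable control_measurable \<theta> \<eta>
      discount_measurable)
  show "AE z in timed M. norm (marginal \<theta> z * \<eta> (snd z) (fst z) * exp (- r * snd z))
    \<le> norm (K * (\<eta> (snd z) (fst z) * exp (- r * snd z)))"
    using marginal_bound[OF \<theta>] K_nonneg by (intro AE_I2)
      (auto simp: abs_mult mult.assoc intro!: mult_right_mono)
qed

text \<open>
  The cost of \<open>\<eta>\<close> minus the cost of \<open>\<theta>\<close>.
\<close>

definition total_difference :: "(real \<Rightarrow> 'a \<Rightarrow> real) \<Rightarrow> (real \<Rightarrow> 'a \<Rightarrow> real) \<Rightarrow> real" where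
  "total_difference \<theta> \<eta> = (LINT z|timed M. running_difference \<theta> \<eta> z) + intervention \<eta> - intervention \<theta>"

text \<open>
  The linear part of the cost at \<open>\<theta>\<close>: the derivative of the cost at \<open>\<theta>\<close> in the direction
  \<open>\<eta> - \<theta>\<close> is \<open>marginal_cost \<theta> \<eta> - marginal_cost \<theta> \<theta>\<close>.
\<close>

definition marginal_cost :: "(real \<Rightarrow> 'a \<Rightarrow> real) \<Rightarrow> (real \<Rightarrow> 'a \<Rightarrow> real) \<Rightarrow> real" where
  "marginal_cost \<theta> \<eta> =
     (LINT z|timed M. marginal \<theta> z * \<eta> (snd z) (fst z) * exp (- r * snd z)) + intervention \<eta>"

lemma marginal_cost_linear:
  assumes \<theta>: "\<theta> \<in> controls" and \<eta>: "\<eta> \<in> controls" and \<zeta>: "\<zeta> \<in> controls" and a: "0 \<le> a" and b: "0 \<le> b"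
  shows "marginal_cost \<theta> (\<lambda>t \<omega>. a * \<eta> t \<omega> + b * \<zeta> t \<omega>) = a * marginal_cost \<theta> \<eta> + b * marginal_cost \<theta> \<zeta>"
proof -
  note int = marginal_times_integrable[OF \<theta>]
  have "(LINT z|timed M. marginal \<theta> z * (a * \<eta> (snd z) (fst z)
    + b * \<zeta> (snd z) (fst z)) * exp (- r * snd z))
    = (LINT z|timed M. a * (marginal \<theta> z * \<eta> (snd z) (fst z) * exp (- r * snd z))
      + b * (marginal \<theta> z * \<zeta> (snd z) (fst z) * exp (- r * snd z)))"
    by (intro Bochner_Integration.integral_cong) (auto simp: algebra_simps)
  also have "\<dots> = a * (LINT z|timed M. marginal \<theta> z * \<eta> (snd z) (fst z) * exp (- r * snd z))
      + b * (LINT z|timed M. marginal \<theta> z * \<zeta> (snd z) (fst z) * exp (- r * snd z))"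
    using int[OF \<eta>] int[OF \<zeta>] by (subst Bochner_Integration.integral_add) auto
  finally show ?thesis
    unfolding marginal_cost_def intervention_linear[OF \<eta> \<zeta> a b] by (simp add: algebra_simps)
qed

text \<open>
  The running cost lies above its tangents and the intervention cost is linear.
\<close>

lemma marginal_cost_le_total_difference:
  assumes \<theta>: "\<theta> \<in> controls" and \<eta>: "\<eta> \<in> controls"
  shows "marginal_cost \<theta> \<eta> - marginal_cost \<theta> \<theta> \<le> total_difference \<theta> \<eta>"
proof -
  have "(LINT z|timed M. marginal \<theta> z * \<eta> (snd z) (fst z) * exp (- r * snd z))
     - (LINT z|timed M. marginal \<theta> z * \<theta> (snd z) (fst z) * exp (- r * snd z))
    = (LINT z|timed M. marginal \<theta> z * \<eta> (snd z) (fst z) * exp (- r * snd z)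
       - marginal \<theta> z * \<theta> (snd z) (fst z) * exp (- r * snd z))"
    by (intro Bochner_Integration.integral_diff[symmetric] marginal_times_integrable \<theta> \<eta>)
  also have "\<dots> \<le> (LINT z|timed M. running_difference \<theta> \<eta> z)"
  proof (rule integral_mono)
    show "integrable (timed M) (\<lambda>z. marginal \<theta> z * \<eta> (snd z) (fst z) * exp (- r * snd z)
       - marginal \<theta> z * \<theta> (snd z) (fst z) * exp (- r * snd z))"
      by (intro Bochner_Integration.integrable_diff marginal_times_integrable \<theta> \<eta>)
    fix z assume z: "z \<in> space (timed M)"
    then have t: "0 \<le> snd z" by (auto simp: space_pair_measure space_halfline)
    from mult_right_mono[OF running_above_tangent[OF t control_nonneg[OF \<theta> z]
      control_nonneg[OF \<eta> z], of "X (snd z) (fst z)"], of "exp (- r * snd z)"]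
    show "marginal \<theta> z * \<eta> (snd z) (fst z) * exp (- r * snd z)
       - marginal \<theta> z * \<theta> (snd z) (fst z) * exp (- r * snd z) \<le> running_difference \<theta> \<eta> z"
      unfolding marginal_def running_difference_def by (simp add: algebra_simps)
  qed (rule running_difference_integrable[OF \<theta> \<eta>])
  finally show ?thesis by (simp add: marginal_cost_def total_difference_def)
qed

lemma total_difference_antisym:
  assumes \<theta>: "\<theta> \<in> controls" and \<eta>: "\<eta> \<in> controls"
  shows "total_difference \<eta> \<theta> = - total_difference \<theta> \<eta>"
proof -
  have "(LINT z|timed M. running_difference \<eta> \<theta> z) = (LINT z|timed M. - running_difference \<theta> \<eta> z)"
    by (intro Bochner_Integration.integral_cong) (auto simp: running_difference_def algebra_simps)
  then show ?thesis by (simp add: total_difference_def)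
qed

lemma marginal_cost_along_segment:
  assumes \<theta>: "\<theta> \<in> controls" and \<eta>: "\<eta> \<in> controls"
  shows "(\<lambda>n. LINT z|timed M. marginal (\<lambda>t \<omega>. (1 - 1 / real (Suc n)) * \<theta> t \<omega>
    + 1 / real (Suc n) * \<eta> t \<omega>) z
      * (\<eta> (snd z) (fst z) - \<theta> (snd z) (fst z)) * exp (- r * snd z))
    \<longlonglongrightarrow> (LINT z|timed M. marginal \<theta> z * (\<eta> (snd z) (fst z) - \<theta> (snd z) (fst z)) * exp (- r * snd z))"
proof (rule integral_dominated_convergence[where
      w="\<lambda>z. K * (\<eta> (snd z) (fst z) * exp (- r * snd z)) + K * (\<theta> (snd z) (fst z) * exp (- r * snd z))"])
  let ?\<zeta> = "\<lambda>n t \<omega>. (1 - 1 / real (Suc n)) * \<theta> t \<omega> + 1 / real (Suc n) * \<eta> t \<omega>"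
  have \<zeta>: "?\<zeta> n \<in> controls" for n by (rule controls_cone[OF \<theta> \<eta>]) auto
  have m: "(\<lambda>z. marginal \<xi> z * (\<eta> (snd z) (fst z) - \<theta> (snd z) (fst z)) * exp (- r * snd z)) \<in>
    borel_measurable (timed M)"
    if "\<xi> \<in> controls" for \<xi>
    by (intro borel_measurable_times borel_measurable_diff marginal_control_measurable
      control_measurable that \<theta> \<eta> discount_measurable)
  show "(\<lambda>z. marginal \<theta> z * (\<eta> (snd z) (fst z) - \<theta> (snd z) (fst z)) * exp (- r * snd z)) \<in>
    borel_measurable (timed M)"
    by (rule m[OF \<theta>])
  show "(\<lambda>z. marginal (?\<zeta> n) z * (\<eta> (snd z) (fst z) - \<theta> (snd z) (fst z)) * exp (- r * snd z)) \<in>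
    borel_measurable (timed M)" for n
    by (rule m[OF \<zeta>])
  show "integrable (timed M) (\<lambda>z. K * (\<eta> (snd z) (fst z) * exp (- r * snd z))
    + K * (\<theta> (snd z) (fst z) * exp (- r * snd z)))"
    by (intro Bochner_Integration.integrable_add integrable_mult_right discounted_control_integrable \<theta> \<eta>)
  show "AE z in timed M. (\<lambda>n. marginal (?\<zeta> n) z * (\<eta> (snd z) (fst z) - \<theta> (snd z) (fst z)) * exp
    (- r * snd z))
    \<longlonglongrightarrow> marginal \<theta> z * (\<eta> (snd z) (fst z) - \<theta> (snd z) (fst z)) * exp (- r * snd z)"
  proof (rule AE_I2)
    fix z assume z: "z \<in> space (timed M)"
    then have t: "0 \<le> snd z" by (auto simp: space_pair_measure space_halfline)
    let ?a = "\<theta> (snd z) (fst z)" and ?b = "\<eta> (snd z) (fst z)"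
    have "(\<lambda>n. (1 - 1 / real (Suc n)) * ?a + 1 / real (Suc n) * ?b) \<longlonglongrightarrow> (1 - 0) * ?a + 0 * ?b"
      by (intro tendsto_intros LIMSEQ_Suc[OF lim_1_over_n])
    then have lim: "(\<lambda>n. ?\<zeta> n (snd z) (fst z)) \<longlonglongrightarrow> ?a" by simp
    have "(\<lambda>n. marginal (?\<zeta> n) z) \<longlonglongrightarrow> marginal \<theta> z"
      unfolding marginal_def
      by (rule continuous_on_tendsto_compose[OF c'_cont[OF t] lim])
        (use control_nonneg[OF \<theta> z] control_nonneg[OF \<zeta> z] in auto)
    then show "(\<lambda>n. marginal (?\<zeta> n) z * (?b - ?a) * exp (- r * snd z))
      \<longlonglongrightarrow> marginal \<theta> z * (?b - ?a) * exp (- r * snd z)"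
      by (intro tendsto_intros)
  qed
  show "AE z in timed M. norm (marginal (?\<zeta> n)
    z * (\<eta> (snd z) (fst z) - \<theta> (snd z) (fst z)) * exp (- r * snd z))
    \<le> K * (\<eta> (snd z) (fst z) * exp (- r * snd z)) + K * (\<theta> (snd z) (fst z) * exp (- r * snd z))" for n
  proof (rule AE_I2)
    fix z assume z: "z \<in> space (timed M)"
    let ?a = "\<theta> (snd z) (fst z)" and ?b = "\<eta> (snd z) (fst z)"
    have "\<bar>marginal (?\<zeta> n) z * (?b - ?a)\<bar> \<le> K * (?b + ?a)"
      unfolding abs_mult using marginal_bound[OF \<zeta> z] control_nonneg[OF \<theta> z] control_nonneg[OF \<eta> z]
        K_nonneg
      by (intro mult_mono) auto
    from mult_right_mono[OF this, of "exp (- r * snd z)"]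
    show "norm (marginal (?\<zeta> n) z * (?b - ?a) * exp (- r * snd z)) \<le> K * (?b * exp (- r * snd z))
      + K * (?a * exp (- r * snd z))"
      by (simp only: real_norm_def abs_mult abs_exp_cancel distrib_left distrib_right mult.assoc) simp
  qed
qed

text \<open>
  Sufficiency is the tangent inequality at \<open>\<theta>\<close>. For necessity, the tangent inequality is used
  at the points \<open>\<zeta>\<^sub>n = (1 - 1/(n+1)) \<theta> + 1/(n+1) \<eta>\<close> in the direction back to \<open>\<theta>\<close>: it bounds the
  difference quotients along the segment by the slopes at \<open>\<zeta>\<^sub>n\<close>, which converge to the slope at
  \<open>\<theta>\<close> by continuity of \<open>c'\<close>.
\<close>

lemma optimal_iff_marginal_cost:
  assumes \<theta>: "\<theta> \<in> controls"
  shows "(\<forall>\<eta>\<in>controls. 0 \<le> total_difference \<theta> \<eta>) \<longleftrightarrow> (\<forall>\<eta>\<in>controls. marginal_cost \<theta> \<theta> \<le> marginal_cost \<theta> \<eta>)"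
proof (intro iffI ballI)
  fix \<eta> assume min: "\<forall>\<eta>\<in>controls. marginal_cost \<theta> \<theta> \<le> marginal_cost \<theta> \<eta>" and \<eta>: "\<eta> \<in> controls"
  then show "0 \<le> total_difference \<theta> \<eta>" using marginal_cost_le_total_difference[OF \<theta> \<eta>] by force
next
  fix \<eta> assume min: "\<forall>\<eta>\<in>controls. 0 \<le> total_difference \<theta> \<eta>" and \<eta>: "\<eta> \<in> controls"
  let ?\<zeta> = "\<lambda>n t \<omega>. (1 - 1 / real (Suc n)) * \<theta> t \<omega> + 1 / real (Suc n) * \<eta> t \<omega>"
  let ?I = "\<lambda>\<xi>. LINT z|timed M. marginal \<xi> z * (\<eta> (snd z) (fst z) - \<theta> (snd z) (fst z)) * exp
    (- r * snd z)"
  have \<zeta>: "?\<zeta> n \<in> controls" for n by (rule controls_cone[OF \<theta> \<eta>]) auto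
  have I: "?I \<xi> + intervention \<eta> - intervention \<theta> = marginal_cost \<xi> \<eta> - marginal_cost \<xi> \<theta>"
    if \<xi>: "\<xi> \<in> controls" for \<xi>
  proof -
    have "?I \<xi> = (LINT z|timed M. marginal \<xi> z * \<eta> (snd z) (fst z) * exp (- r * snd z)
       - marginal \<xi> z * \<theta> (snd z) (fst z) * exp (- r * snd z))"
      by (intro Bochner_Integration.integral_cong) (auto simp: algebra_simps)
    also have "\<dots> = (LINT z|timed M. marginal \<xi> z * \<eta> (snd z) (fst z) * exp (- r * snd z))
       - (LINT z|timed M. marginal \<xi> z * \<theta> (snd z) (fst z) * exp (- r * snd z))"
      by (intro Bochner_Integration.integral_diff marginal_times_integrable \<xi> \<theta> \<eta>)
    finally show ?thesis by (simp add: marginal_cost_def)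
  qed
  have "0 \<le> ?I (?\<zeta> n) + intervention \<eta> - intervention \<theta>" for n
  proof -
    let ?e = "1 / real (Suc n)"
    have e: "0 < ?e" "0 \<le> 1 - ?e" by auto
    have "marginal_cost (?\<zeta> n) \<theta> - marginal_cost (?\<zeta> n) (?\<zeta> n) \<le> total_difference (?\<zeta> n) \<theta>"
      by (rule marginal_cost_le_total_difference[OF \<zeta> \<theta>])
    also have "\<dots> \<le> 0" using min \<zeta> total_difference_antisym[OF \<theta> \<zeta>] by simp
    finally have "marginal_cost (?\<zeta> n) \<theta> \<le> (1 - ?e) * marginal_cost (?\<zeta> n) \<theta>
      + ?e * marginal_cost (?\<zeta> n) \<eta>"
      using marginal_cost_linear[OF \<zeta> \<theta> \<eta> e(2), of ?e] e by simp
    then have "0 \<le> ?e * (marginal_cost (?\<zeta> n) \<eta> - marginal_cost (?\<zeta> n) \<theta>)" by (simp only: algebra_simps)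
    then show ?thesis using e(1) unfolding I[OF \<zeta>] by (simp only: zero_le_mult_iff)  auto
  qed
  moreover have "(\<lambda>n. ?I (?\<zeta> n) + intervention \<eta> - intervention \<theta>) \<longlonglongrightarrow> ?I \<theta>
    + intervention \<eta> - intervention \<theta>"
    by (intro tendsto_intros marginal_cost_along_segment \<theta> \<eta>)
  ultimately have "0 \<le> ?I \<theta> + intervention \<eta> - intervention \<theta>" by (intro LIMSEQ_le_const) auto
  then show "marginal_cost \<theta> \<theta> \<le> marginal_cost \<theta> \<eta>" unfolding I[OF \<theta>] by simp
qed

text \<open>
  A linear functional on a cone is minimal at \<open>\<theta>\<close> only if it vanishes there, as the competitors
  \<open>0\<close> and \<open>2 \<theta>\<close> show.
\<close>

lemma marginal_cost_minimal_iff: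
  assumes \<theta>: "\<theta> \<in> controls"
  shows "(\<forall>\<eta>\<in>controls. marginal_cost \<theta> \<theta> \<le> marginal_cost \<theta> \<eta>) \<longleftrightarrow>
    (\<forall>\<eta>\<in>controls. 0 \<le> marginal_cost \<theta> \<eta>) \<and> marginal_cost \<theta> \<theta> = 0"
proof
  assume min: "\<forall>\<eta>\<in>controls. marginal_cost \<theta> \<theta> \<le> marginal_cost \<theta> \<eta>"
  have "marginal_cost \<theta> \<theta> \<le> a * marginal_cost \<theta> \<theta>" if "0 \<le> a" for a
    using bspec[OF min controls_cone[OF \<theta> \<theta> that order_refl]]
      marginal_cost_linear[OF \<theta> \<theta> \<theta> that order_refl] by simp
  from this[of 0] this[of 2] have "marginal_cost \<theta> \<theta> = 0" by simp
  then show "(\<forall>\<eta>\<in>controls. 0 \<le> marginal_cost \<theta> \<eta>) \<and> marginal_cost \<theta> \<theta> = 0" using min by simp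
qed simp

section \<open>Finiteness of the cost\<close>

text \<open>
  The constant control \<open>y\<close> has an integrable running cost. Its positive part is finite by the upper
  bound. The cost with the interest \<open>r k y\<close> added dominates the minimal cost, so its negative part is
  finite by the lower bound; and the added interest is itself integrable, hence can be removed again.
\<close>

lemma
  assumes y: "0 \<le> y"
    and upper: "ext_integral M (\<lambda>\<omega>. ext_integral
      halfline (\<lambda>t. ereal (c t (X t \<omega>) y * exp (- r * t)))) < \<infinity>"
    and lower: "- \<infinity> < ext_integral M (\<lambda>\<omega>. ext_integral halfline
       (\<lambda>t. min_cost r c t (X t \<omega>) (k t \<omega>) * ereal (exp (- r * t))))"
  shows AE_reference_integrable: "AE \<omega> in M. integrable halfline (\<lambda>t. c t (X t \<omega>) y * exp (- r * t))"
    and reference_integrable: "integrable M (\<lambda>\<omega>. LINT t|halfline. c t (X t \<omega>) y * exp (- r * t))"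
proof -
  interpret T: sigma_finite_measure halfline by (rule sigma_finite_halfline)
  define f where "f \<omega> t = c t (X t \<omega>) y * exp (- r * t)" for \<omega> t
  define w where "w \<omega> t = r * k t \<omega> * y * exp (- r * t)" for \<omega> t
  have w0: "0 \<le> w \<omega> t" if "\<omega> \<in> space M" "0 \<le> t" for \<omega> t
    unfolding w_def using k_nonneg[OF that(2,1)] r_pos y by simp
  have fQ: "(\<lambda>z. f (fst z) (snd z)) \<in> borel_measurable (timed M)"
    unfolding f_def using y by (intro borel_measurable_times running_measurable discount_measurable) auto
  have wQ: "(\<lambda>z. w (fst z) (snd z)) \<in> borel_measurable (timed M)"
    unfolding w_def by (intro borel_measurable_times k_measurable discount_measurable) auto
  have fm: "f \<omega> \<in> borel_measurable halfline" and wm: "w \<omega> \<in> borel_measurable halfline"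
    if "\<omega> \<in> space M" for \<omega>
    using measurable_compose[OF measurable_Pair1'[OF that] fQ]
      measurable_compose[OF measurable_Pair1'[OF that] wQ] by simp_all
  define P N m P' N' where "P \<omega> = (\<integral>\<^sup>+ t. ennreal (f \<omega> t) \<partial>halfline)" "N \<omega>
    = (\<integral>\<^sup>+ t. ennreal (- f \<omega> t) \<partial>halfline)"
    "m \<omega> = (\<integral>\<^sup>+ t. ennreal (w \<omega> t) \<partial>halfline)" "P' \<omega> = (\<integral>\<^sup>+ t. ennreal (f \<omega> t + w \<omega> t) \<partial>halfline)"
    "N' \<omega> = (\<integral>\<^sup>+ t. ennreal (- (f \<omega> t + w \<omega> t)) \<partial>halfline)" for \<omega>
  note defs = this
  have section_m: "(\<lambda>\<omega>. \<integral>\<^sup>+ t. ennreal (g \<omega> t) \<partial>halfline) \<in> borel_measurable M"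
    if "(\<lambda>z. g (fst z) (snd z)) \<in> borel_measurable (timed M)" for g :: "'a \<Rightarrow> real \<Rightarrow> real"
    using T.borel_measurable_nn_integral_fst[of "\<lambda>z. ennreal (g (fst z) (snd z))" M] that by simp
  have meas: "P \<in> borel_measurable M" "N \<in> borel_measurable M" "m \<in> borel_measurable M"
    "P' \<in> borel_measurable M" "N' \<in> borel_measurable M"
    unfolding defs[abs_def] by (intro section_m borel_measurable_uminus borel_measurable_add fQ wQ)+
  note [measurable] = meas
  (* (f + w)^+ + f^- = f^+ + w + (f + w)^-, free of subtractions and so valid for infinite integrals. *)
  have balance: "P' \<omega> + N \<omega> = P \<omega> + m \<omega> + N' \<omega>" if \<omega>: "\<omega> \<in> space M" for \<omega>
  proof -
    have real: "ennreal (a + b) + ennreal (- a) = ennreal a + ennreal b + ennreal (- (a + b))" if "0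
      \<le> b" for a b :: real
      using that by (cases "0 \<le> a"; cases "0 \<le> a
        + b") (auto simp: ennreal_plus[symmetric] ennreal_neg simp del: ennreal_plus)
    have "P' \<omega> + N \<omega> = (\<integral>\<^sup>+ t. ennreal (f \<omega> t + w \<omega> t) + ennreal (- f \<omega> t) \<partial>halfline)"
      unfolding defs using fm[OF \<omega>] wm[OF \<omega>] by (intro nn_integral_add[symmetric]) auto
    also have "\<dots> = (\<integral>\<^sup>+ t. (ennreal (f \<omega> t) + ennreal (w \<omega> t)) + ennreal (- (f \<omega> t + w \<omega> t)) \<partial>halfline)"
      using w0[OF \<omega>] by (intro nn_integral_cong real) (simp add: space_halfline)
    also have "\<dots> = (\<integral>\<^sup>+ t. ennreal (f \<omega> t) + ennreal (w \<omega> t) \<partial>halfline) + N' \<omega>"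
      unfolding defs using fm[OF \<omega>] wm[OF \<omega>] by (intro nn_integral_add) auto
    also have "(\<integral>\<^sup>+ t. ennreal (f \<omega> t) + ennreal (w \<omega> t) \<partial>halfline) = P \<omega> + m \<omega>"
      unfolding defs using fm[OF \<omega>] wm[OF \<omega>] by (intro nn_integral_add) auto
    finally show ?thesis .
  qed
  have P'_le: "P' \<omega> \<le> P \<omega> + m \<omega>" if \<omega>: "\<omega> \<in> space M" for \<omega>
  proof -
    have "P' \<omega> \<le> (\<integral>\<^sup>+ t. ennreal (f \<omega> t) + ennreal (w \<omega> t) \<partial>halfline)"
      unfolding defs
    proof (rule nn_integral_mono)
      fix t assume "t \<in> space halfline"
      then have "0 \<le> w \<omega> t" using w0[OF \<omega>] by (simp add: space_halfline)
      then show "ennreal (f \<omega> t + w \<omega> t) \<le> ennreal (f \<omega> t) + ennreal (w \<omega> t)"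
        by (cases "0 \<le> f \<omega> t") (auto simp: ennreal_neg intro!: ennreal_leI)
    qed
    also have "\<dots> = P \<omega> + m \<omega>"
      unfolding defs using fm[OF \<omega>] wm[OF \<omega>] by (intro nn_integral_add) auto
    finally show ?thesis .
  qed
  let ?g = "\<lambda>\<omega>. ext_integral halfline (\<lambda>t. ereal (f \<omega> t))"
  let ?h = "\<lambda>\<omega>. ext_integral halfline (\<lambda>t. ereal (f \<omega> t + w \<omega> t))"
  have g: "?g \<omega> = enn2ereal (P \<omega>) - enn2ereal (N \<omega>)" and h: "?h \<omega>
    = enn2ereal (P' \<omega>) - enn2ereal (N' \<omega>)" for \<omega>
    unfolding ext_integral_def defs by simp_all
  have [measurable]: "?g \<in> borel_measurable M" "?h \<in> borel_measurable M"
    unfolding g h by measurable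
  (* sup k is integrable by k <= 1 + k^2, and r exp (- r t) has total mass 1 on the half-line. *)
  have m_fin: "(\<integral>\<^sup>+ \<omega>. m \<omega> \<partial>M) < \<infinity>"
  proof -
    let ?S = "\<lambda>\<omega>. SUP t\<in>{0..}. ennreal (\<bar>k t \<omega>\<bar>\<^sup>2)"
    have e: "(\<lambda>t. ennreal (exp (- r * t))) \<in> borel_measurable halfline"
      using halfline_measurable_id by measurable
    have "(\<integral>\<^sup>+ \<omega>. m \<omega> \<partial>M) \<le> (\<integral>\<^sup>+ \<omega>. ennreal y * (1 + ?S \<omega>) \<partial>M)"
    proof (rule nn_integral_mono)
      fix \<omega> assume \<omega>: "\<omega> \<in> space M"
      have "m \<omega> \<le> (\<integral>\<^sup>+ t. (ennreal (r * y) * (1 + ?S \<omega>)) * ennreal (exp (- r * t)) \<partial>halfline)"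
        unfolding defs
      proof (rule nn_integral_mono)
        fix t assume "t \<in> space halfline"
        then have t: "t \<in> {0..}" by (simp add: space_halfline)
        have k0: "0 \<le> k t \<omega>" using k_nonneg \<omega> t by simp
        have "k t \<omega> \<le> 1 + (k t \<omega>)\<^sup>2"
          using zero_le_power2[of "k t \<omega> - 1 / 2"] by (simp add: power2_eq_square algebra_simps)
        then have "ennreal (k t \<omega>) \<le> ennreal (1 + \<bar>k t \<omega>\<bar>\<^sup>2)"
          by (intro ennreal_leI) simp
        also have "\<dots> = 1 + ennreal (\<bar>k t \<omega>\<bar>\<^sup>2)"
          by (subst ennreal_plus) auto
        also have "\<dots> \<le> 1 + ?S \<omega>" by (intro add_left_mono SUP_upper[OF t])
        finally have kS: "ennreal (k t \<omega>) \<le> 1 + ?S \<omega>" .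
        have "ennreal (w \<omega> t) = ennreal ((r * y) * k t \<omega>) * ennreal (exp (- r * t))"
          unfolding w_def using r_pos y k0 by (subst ennreal_mult[symmetric]) (auto simp: mult_ac)
        also have "ennreal ((r * y) * k t \<omega>) = ennreal (r * y) * ennreal (k t \<omega>)"
          using r_pos y k0 by (intro ennreal_mult) auto
        also have "ennreal (r * y) * ennreal (k t \<omega>) * ennreal (exp (- r * t))
          \<le> (ennreal (r * y) * (1 + ?S \<omega>)) * ennreal (exp (- r * t))"
          by (intro mult_right_mono mult_left_mono kS) auto
        finally show "ennreal (w \<omega> t) \<le> (ennreal (r * y) * (1 + ?S \<omega>)) * ennreal (exp (- r * t))" .
      qed
      also have "\<dots> = (ennreal (r * y) * (1 + ?S \<omega>)) * (\<integral>\<^sup>+ t. ennreal (exp (- r * t)) \<partial>halfline)"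
        by (rule nn_integral_cmult[OF e])
      also have "(\<integral>\<^sup>+ t. ennreal (exp (- r * t)) \<partial>halfline) = ennreal (1 / r)"
        using nn_integral_eq_integral[OF integrable_discount(1)[OF r_pos]]
          integrable_discount(2)[OF r_pos] by simp
      also have "ennreal (r * y) * (1 + ?S \<omega>) * ennreal (1 / r) = ennreal y * (1 + ?S \<omega>)"
      proof -
        have "ennreal (r * y) * ennreal (1 / r) = ennreal y"
          using r_pos y by (subst ennreal_mult[symmetric]) auto
        moreover have "ennreal (r * y) * (1 + ?S \<omega>) * ennreal (1 / r)
          = ennreal (r * y) * ennreal (1 / r) * (1 + ?S \<omega>)"
          by (simp only: ac_simps)
        ultimately show ?thesis by (simp only:)
      qed
      finally show "m \<omega> \<le> ennreal y * (1 + ?S \<omega>)" .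
    qed
    also have "\<dots> = ennreal y * (1 + (\<integral>\<^sup>+ \<omega>. ?S \<omega> \<partial>M))"
      using sup_cost_measurable by (simp add: nn_integral_cmult nn_integral_add emeasure_space_1)
    also have "\<dots> < \<infinity>" using k_sup by (simp add: ennreal_mult_less_top)
    finally show ?thesis .
  qed
  have g_fin: "(\<integral>\<^sup>+ \<omega>. e2ennreal (?g \<omega>) \<partial>M) < \<infinity>"
    using ext_integral_less_top[OF upper] unfolding f_def .
  have AE1: "AE \<omega> in M. e2ennreal (?g \<omega>) \<noteq> \<infinity>" using g_fin by (intro nn_integral_PInf_AE) auto
  have AE2: "AE \<omega> in M. m \<omega> \<noteq> \<infinity>" using m_fin by (intro nn_integral_PInf_AE) auto
  have AE_P: "AE \<omega> in M. P \<omega> < \<infinity>"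
    using AE1
  proof eventually_elim
    case (elim \<omega>)
    have "?g \<omega> = \<infinity>" if "P \<omega> = \<infinity>" using that unfolding g by simp
    then have "P \<omega> \<noteq> \<infinity>" using elim by auto
    then show ?case by (simp add: less_top)
  qed
  have "- \<infinity> < ext_integral M ?h"
  proof (rule less_le_trans[OF lower], rule ext_integral_mono, rule ext_integral_mono)
    fix \<omega> t assume "t \<in> space halfline"
    have "min_cost r c t (X t \<omega>) (k t \<omega>) \<le> ereal (c t (X t \<omega>) y + r * k t \<omega> * y)"
      unfolding min_cost_def using y by (intro INF_lower) auto
    then have "min_cost r c t (X t \<omega>) (k t \<omega>) * ereal (exp (- r * t))
      \<le> ereal (c t (X t \<omega>) y + r * k t \<omega> * y) * ereal (exp (- r * t))"
      by (intro ereal_mult_right_mono) auto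
    then show "min_cost r c t (X t \<omega>) (k t \<omega>) * ereal (exp (- r * t)) \<le> ereal (f \<omega> t + w \<omega> t)"
      by (simp add: f_def w_def algebra_simps)
  qed
  moreover have "(\<integral>\<^sup>+ \<omega>. e2ennreal (?h \<omega>) \<partial>M) < \<infinity>"
  proof -
    have "AE \<omega> in M. e2ennreal (?h \<omega>) \<le> e2ennreal (?g \<omega>) + m \<omega>"
      using AE_P AE2 AE_space
    proof eventually_elim
      case (elim \<omega>)
      obtain a where a: "P \<omega> = ennreal a" "0 \<le> a" using elim by (cases "P \<omega>") auto
      obtain b where b: "m \<omega> = ennreal b" "0 \<le> b" using elim by (cases "m \<omega>") auto
      have "P' \<omega> < \<infinity>" using P'_le[OF elim(3)] a b by (auto simp: less_top[symmetric] top_unique)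
      then obtain a' where a': "P' \<omega> = ennreal a'" "0 \<le> a'" by (cases "P' \<omega>") auto
      show ?case
      proof (cases "N' \<omega>")
        case top
        then have "?h \<omega> = - \<infinity>" unfolding h a'(1) by (simp add: enn2ereal_ennreal[OF a'(2)])
        then show ?thesis by (simp add: e2ennreal_neg)
      next
        case (real n')
        have "N \<omega> \<le> P \<omega> + m \<omega> + N' \<omega>" using balance[OF elim(3)]
          by (metis add_increasing order_refl zero_le)
        then have "N \<omega> < \<infinity>" using a b real by (auto simp: less_top[symmetric] top_unique)
        then obtain n where n: "N \<omega> = ennreal n" "0 \<le> n" by (cases "N \<omega>") auto
        have "a' + n = a + b + n'"
          using balance[OF elim(3)] a b a' n real
            by (simp add: ennreal_plus[symmetric] del: ennreal_plus)
        then have eq: "a' - n' = (a - n) + b" by simp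
        have "ennreal ((a - n) + b) \<le> ennreal (a - n) + ennreal b"
          using b(2) by (cases "0 \<le> a - n") (auto simp: ennreal_neg intro!: ennreal_leI)
        then show ?thesis 
          unfolding h g a'(1) a(1) b(1) n(1) real(2)
            enn2ereal_ennreal[OF a'(2)] enn2ereal_ennreal[OF a(2)] enn2ereal_ennreal[OF n(2)]
              enn2ereal_ennreal[OF real(1)]
          using eq by simp
      qed
    qed
    then have "(\<integral>\<^sup>+ \<omega>. e2ennreal (?h \<omega>) \<partial>M) \<le> (\<integral>\<^sup>+ \<omega>. e2ennreal (?g \<omega>) + m \<omega> \<partial>M)"
      by (rule nn_integral_mono_AE)
    also have "\<dots> = (\<integral>\<^sup>+ \<omega>. e2ennreal (?g \<omega>) \<partial>M) + (\<integral>\<^sup>+ \<omega>. m \<omega> \<partial>M)"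
      by (intro nn_integral_add) auto
    also have "\<dots> < \<infinity>" using g_fin m_fin by simp
    finally show ?thesis .
  qed
  ultimately have h_fin: "(\<integral>\<^sup>+ \<omega>. e2ennreal (- ?h \<omega>) \<partial>M) < \<infinity>" by (rule ext_integral_greater_bot)
  then have AE3: "AE \<omega> in M. e2ennreal (- ?h \<omega>) \<noteq> \<infinity>" by (intro nn_integral_PInf_AE) auto
  have AE_int: "AE \<omega> in M. integrable halfline (f \<omega>) \<and> integrable halfline (w \<omega>)"
    using AE_P AE2 AE3 AE_space
  proof eventually_elim
    case (elim \<omega>)
    have "P \<omega> + m \<omega> < \<infinity>" using elim(1,2) by (simp add: less_top)
    then have "P' \<omega> < \<infinity>" using P'_le[OF elim(4)] by (rule le_less_trans[rotated])
    then obtain a' where a': "P' \<omega> = ennreal a'" "0 \<le> a'" by (cases "P' \<omega>") auto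
    have "?h \<omega> = - \<infinity>" if "N' \<omega> = \<infinity>" unfolding h a'(1) that by (simp add: enn2ereal_ennreal[OF a'(2)])
    then have "N' \<omega> \<noteq> \<infinity>" using elim(3) by auto
    then have "P \<omega> + m \<omega> + N' \<omega> < \<infinity>" using \<open>P \<omega> + m \<omega> < \<infinity>\<close> by (simp add: less_top)
    moreover have "N \<omega> \<le> P \<omega> + m \<omega> + N' \<omega>" using balance[OF elim(4)]
      by (metis add_increasing order_refl zero_le)
    ultimately have "N \<omega> < \<infinity>" by (rule le_less_trans[rotated])
    moreover have "(\<integral>\<^sup>+ t. ennreal (- w \<omega> t) \<partial>halfline) = 0"
      using w0[OF elim(4)] by (subst nn_integral_cong[where v="\<lambda>_. 0"])
        (auto simp: space_halfline ennreal_neg)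
    ultimately show ?case
      unfolding real_integrable_def using elim fm[OF elim(4)] wm[OF elim(4)]
        by (auto simp: defs less_top)
  qed
  then show "AE \<omega> in M. integrable halfline (\<lambda>t. c t (X t \<omega>) y * exp (- r * t))"
    unfolding f_def by auto
  have AE_fin: "AE \<omega> in M. ennreal (LINT t|halfline. f \<omega> t) = e2ennreal (?g \<omega>) \<and>
      ennreal (- (LINT t|halfline. f \<omega> t)) \<le> e2ennreal (- ?h \<omega>) + m \<omega>"
    using AE_int AE_space
  proof eventually_elim
    case (elim \<omega>)
    have wpos: "0 \<le> (LINT t|halfline. w \<omega> t)"
      using w0[OF elim(2)] by (intro integral_nonneg_AE AE_I2) (simp add: space_halfline)
    have "m \<omega> = ennreal (LINT t|halfline. w \<omega> t)"
      unfolding defs using elim w0[OF elim(2)]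
        by (intro nn_integral_eq_integral AE_I2) (auto simp: space_halfline)
    moreover have "?h \<omega> = ereal ((LINT t|halfline. f \<omega> t) + (LINT t|halfline. w \<omega> t))"
      using elim by (subst ext_integral_eq_integral) auto
    moreover have "ennreal (- a) \<le> ennreal (- (a + b)) + ennreal b" if "0 \<le> b" for a b :: real
      using that by (cases "a + b \<le> 0") (auto simp: ennreal_plus[symmetric] ennreal_neg simp del:
        ennreal_plus intro!: ennreal_leI)
    ultimately show ?case using elim wpos by (simp add: ext_integral_eq_integral)
  qed
  have fint: "(\<lambda>\<omega>. LINT t|halfline. f \<omega> t) \<in> borel_measurable M"
    using fQ by (intro T.borel_measurable_lebesgue_integral) (simp add: split_beta')
  have "(\<integral>\<^sup>+ \<omega>. ennreal (LINT t|halfline. f \<omega> t) \<partial>M) = (\<integral>\<^sup>+ \<omega>. e2ennreal (?g \<omega>) \<partial>M)"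
    using AE_fin by (intro nn_integral_cong_AE) auto
  moreover have "(\<integral>\<^sup>+ \<omega>. ennreal (- (LINT t|halfline. f \<omega> t)) \<partial>M) \<le> (\<integral>\<^sup>+ \<omega>. e2ennreal (- ?h \<omega>) + m \<omega> \<partial>M)"
    using AE_fin by (intro nn_integral_mono_AE) auto
  moreover have "(\<integral>\<^sup>+ \<omega>. e2ennreal (- ?h \<omega>) + m \<omega> \<partial>M) = (\<integral>\<^sup>+ \<omega>. e2ennreal (- ?h \<omega>) \<partial>M) + (\<integral>\<^sup>+ \<omega>. m \<omega> \<partial>M)"
    by (intro nn_integral_add) auto
  ultimately have "integrable M (\<lambda>\<omega>. LINT t|halfline. f \<omega> t)"
    unfolding real_integrable_def using fint g_fin h_fin m_fin
      by (auto simp: less_top[symmetric] top_unique)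
  then show "integrable M (\<lambda>\<omega>. LINT t|halfline. c t (X t \<omega>) y * exp (- r * t))" unfolding f_def .
qed

text \<open>
  With one reference control whose running cost is integrable, the cost of every control is a finite
  number: the conventions for \<open>\<infinity> - \<infinity>\<close> in the definition of the cost never come into play.
\<close>

lemma cost_eq:
  assumes \<eta>0: "\<eta>\<^sub>0 \<in> controls" and \<eta>: "\<eta> \<in> controls"
    and AE0: "AE \<omega> in M. integrable halfline (\<lambda>t. c t (X t \<omega>) (\<eta>\<^sub>0 t \<omega>) * exp (- r * t))"
    and int0: "integrable M (\<lambda>\<omega>. LINT t|halfline. c t (X t \<omega>) (\<eta>\<^sub>0 t \<omega>) * exp (- r * t))"
  shows "cost M X r c k \<eta> = ereal ((LINT \<omega>|M. LINT t|halfline. c t (X t \<omega>) (\<eta>\<^sub>0 t \<omega>) * exp (- r * t))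
     + (LINT z|timed M. running_difference \<eta>\<^sub>0 \<eta> z) + intervention \<eta>)"
proof -
  interpret MT: pair_sigma_finite M halfline by (rule sigma_finite_pair)
  note d = running_difference_integrable[OF \<eta>0 \<eta>]
  note inc = control_increasing[OF \<eta>] and kint = intervention_integrable[OF \<eta>]
  let ?A = "\<lambda>\<omega>. LINT t|halfline. c t (X t \<omega>) (\<eta>\<^sub>0 t \<omega>) * exp (- r * t)"
  let ?B = "\<lambda>\<omega>. LINT t|halfline. running_difference \<eta>\<^sub>0 \<eta> (\<omega>, t)"
  let ?C = "\<lambda>\<omega>. LINT t|stieltjes (\<lambda>t. \<eta> t \<omega>). k t \<omega> * exp (- r * t)"
  have "AE \<omega> in M. integrable (stieltjes (\<lambda>t. \<eta> t \<omega>)) (\<lambda>t. k t \<omega> * exp (- r * t))"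
    using AE_integrable_stieltjes[OF inc kint] by simp
  then have "AE \<omega> in M. ext_integral halfline (\<lambda>t. ereal (c t (X t \<omega>) (\<eta> t \<omega>) * exp (- r * t))) +
       ext_integral (stieltjes (\<lambda>t. \<eta> t \<omega>)) (\<lambda>t. ereal (k t \<omega> * exp (- r * t)))
         = ereal (?A \<omega> + ?B \<omega> + ?C \<omega>)"
    using AE0 MT.AE_integrable_fst'[OF d]
  proof eventually_elim
    case (elim \<omega>)
    have eq: "c t (X t \<omega>) (\<eta> t \<omega>) * exp (- r * t) = c t (X t \<omega>) (\<eta>\<^sub>0 t \<omega>) * exp (- r * t)
      + running_difference \<eta>\<^sub>0 \<eta> (\<omega>, t)" for t
      by (simp add: running_difference_def algebra_simps)
    have "ext_integral halfline (\<lambda>t. ereal (c t (X t \<omega>) (\<eta> t \<omega>) * exp (- r * t))) = ereal (?A \<omega> + ?B \<omega>)"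
      unfolding eq using elim by (subst ext_integral_eq_integral) auto
    then show ?case using ext_integral_eq_integral[OF elim(1)] by simp
  qed
  then have "cost M X r c k \<eta> = ext_integral M (\<lambda>\<omega>. ereal (?A \<omega> + ?B \<omega> + ?C \<omega>))"
    unfolding cost_def by (rule ext_integral_cong_AE)
  also have "\<dots> = ereal (LINT \<omega>|M. ?A \<omega> + ?B \<omega> + ?C \<omega>)"
    using int0 MT.integrable_fst'[OF d] integrable_integral_stieltjes[OF inc kint]
    by (intro ext_integral_eq_integral Bochner_Integration.integrable_add) auto
  also have "(LINT \<omega>|M. ?A \<omega> + ?B \<omega> + ?C \<omega>) = (LINT \<omega>|M. ?A \<omega>) + (LINT \<omega>|M. ?B \<omega>) + (LINT \<omega>|M. ?C \<omega>)"
    using int0 MT.integrable_fst'[OF d] integrable_integral_stieltjes[OF inc kint] by simp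
  also have "(LINT \<omega>|M. ?B \<omega>) = (LINT z|timed M. running_difference \<eta>\<^sub>0 \<eta> z)"
    by (rule MT.integral_fst'[OF d])
  also have "(LINT \<omega>|M. ?C \<omega>) = intervention \<eta>"
    unfolding intervention_def using integral_doleans[OF inc kint] by simp
  finally show ?thesis .
qed

lemma optimal_control_iff_total_difference:
  assumes \<eta>0: "\<eta>\<^sub>0 \<in> controls" and \<theta>: "\<theta> \<in> controls"
    and AE0: "AE \<omega> in M. integrable halfline (\<lambda>t. c t (X t \<omega>) (\<eta>\<^sub>0 t \<omega>) * exp (- r * t))"
    and int0: "integrable M (\<lambda>\<omega>. LINT t|halfline. c t (X t \<omega>) (\<eta>\<^sub>0 t \<omega>) * exp (- r * t))"
  shows "optimal_control M F X r c k \<theta> \<longleftrightarrow> (\<forall>\<eta>\<in>controls. 0 \<le> total_difference \<theta> \<eta>)"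
proof -
  have "cost M X r c k \<theta> \<le> cost M X r c k \<eta> \<longleftrightarrow> 0 \<le> total_difference \<theta> \<eta>" if \<eta>: "\<eta> \<in> controls" for \<eta>
  proof -
    have "(LINT z|timed M. running_difference \<theta> \<eta> z)
      = (LINT z|timed M. running_difference \<eta>\<^sub>0 \<eta> z - running_difference \<eta>\<^sub>0 \<theta> z)"
      by (intro Bochner_Integration.integral_cong) (auto simp: running_difference_def algebra_simps)
    also have "\<dots> = (LINT z|timed M. running_difference \<eta>\<^sub>0 \<eta> z)
      - (LINT z|timed M. running_difference \<eta>\<^sub>0 \<theta> z)"
      by (intro Bochner_Integration.integral_diff running_difference_integrable \<eta>0 \<eta> \<theta>)
    finally show ?thesis
      unfolding cost_eq[OF \<eta>0 \<theta> AE0 int0] cost_eq[OF \<eta>0 \<eta> AE0 int0] total_difference_def by auto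
  qed
  moreover have "optimal_control M F X r c k \<theta> \<longleftrightarrow> (\<forall>\<eta>\<in>controls. cost M X r c k \<theta> \<le> cost M X r c k \<eta>)"
  proof -
    have "(INF \<eta>\<in>controls. cost M X r c k \<eta>) \<le> cost M X r c k \<theta>" by (rule INF_lower[OF \<theta>])
    then show ?thesis unfolding optimal_control_def using \<theta>
      by (auto simp: le_INF_iff[symmetric] intro: antisym)
  qed
  ultimately show ?thesis by blast
qed

section \<open>The subgradient process\<close>

text \<open>
  A version of the subgradient's conditional expectation that obeys the bound \<open>K / r\<close> in every scenario,
  so that dominated convergence and integrability arguments need no exceptional null set.
  The factor \<open>e\<^bsup>rs\<^esup>\<close> moves the tail from discounting to time \<open>0\<close> to discounting to time \<open>s\<close>.
\<close>

definition bounded_version :: "(real \<Rightarrow> 'a \<Rightarrow> real) \<Rightarrow> (real \<Rightarrow> 'a \<Rightarrow> real) \<Rightarrow> bool" where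
  "bounded_version \<theta> p \<longleftrightarrow> right_continuous_process M p \<and>
     (\<forall>t\<ge>0. \<forall>\<omega>\<in>space M. \<bar>p t \<omega>\<bar> \<le> K / r) \<and>
     (\<forall>s\<ge>0. AE \<omega> in M. p s \<omega> = real_cond_exp M (F s)
       (\<lambda>\<omega>. exp (r * s) * discounted_tail r (marginal \<theta>) s \<omega>) \<omega>)"

lemma marginal_tail:
  assumes \<theta>: "\<theta> \<in> controls" and s: "0 \<le> s"
  shows "integrable M (\<lambda>\<omega>. exp (r * s) * discounted_tail r (marginal \<theta>) s \<omega>)"
    and "\<omega> \<in> space M \<Longrightarrow> \<bar>exp (r * s) * discounted_tail r (marginal \<theta>) s \<omega>\<bar> \<le> K / r"
proof -
  note m = marginal_control_measurable[OF \<theta>]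
  have b: "\<bar>marginal \<theta> (\<omega>, t)\<bar> \<le> K" if "\<omega> \<in> space M" "0 \<le> t" for \<omega> t
    using marginal_bound[OF \<theta>, of "(\<omega>, t)"] that by (simp add: space_pair_measure space_halfline)
  show bound: "\<bar>exp (r * s) * discounted_tail r (marginal \<theta>) s \<omega>\<bar> \<le> K / r" if \<omega>: "\<omega> \<in> space M" for \<omega>
  proof -
    have "\<bar>discounted_tail r (marginal \<theta>) s \<omega>\<bar> \<le> K / r * exp (- r * s)"
      by (rule discounted_tail_bound[OF r_pos measurable_compose[OF measurable_Pair1'[OF \<omega>] m]
        b[OF \<omega>] s])
    from mult_left_mono[OF this, of "exp (r * s)"] show ?thesis
      by (simp add: abs_mult exp_minus field_simps)
  qed
  have "right_continuous_process M (discounted_tail r (marginal \<theta>))"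
    by (rule right_continuous_process_discounted_tail[OF r_pos m b])
  then have "discounted_tail r (marginal \<theta>) s \<in> borel_measurable M"
    using s by (simp add: right_continuous_process_def)
  then show "integrable M (\<lambda>\<omega>. exp (r * s) * discounted_tail r (marginal \<theta>) s \<omega>)"
    using bound by (intro integrable_const_bound[where B="K / r"] AE_I2) auto
qed

lemma finite_measure_subalgebra_F: "0 \<le> s \<Longrightarrow> finite_measure_subalgebra M (F s)"
  by (intro finite_measure_subalgebra.intro finite_measure_axioms
    finite_measure_subalgebra_axioms.intro subalgebra)

lemma version_projection:
  assumes \<theta>: "\<theta> \<in> controls" and p: "bounded_version \<theta> p" and s: "0 \<le> s" and A: "A \<in> sets (F s)"
  shows "(LINT \<omega>:A|M. discounted_tail r (marginal \<theta>) s \<omega>) = (LINT \<omega>:A|M. exp (- r * s) * p s \<omega>)"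
proof -
  interpret S: finite_measure_subalgebra M "F s" by (rule finite_measure_subalgebra_F[OF s])
  let ?f = "\<lambda>\<omega>. exp (r * s) * discounted_tail r (marginal \<theta>) s \<omega>"
  have AM: "A \<in> sets M" using A subalgebra[OF s] by (auto simp: subalgebra_def)
  have pm: "p s \<in> borel_measurable M" using p s
    by (simp add: bounded_version_def right_continuous_process_def)
  have "exp (r * s) * (LINT \<omega>:A|M. discounted_tail r (marginal \<theta>) s \<omega>) = (LINT \<omega>:A|M. ?f \<omega>)" by simp
  also have "\<dots> = (LINT \<omega>:A|M. real_cond_exp M (F s) ?f \<omega>)"
    by (rule S.real_cond_exp_intA[OF marginal_tail(1)[OF \<theta> s] A])
  also have "\<dots> = (LINT \<omega>:A|M. p s \<omega>)"
  proof (rule set_lebesgue_integral_cong_AE[OF AM])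
    show "real_cond_exp M (F s) ?f \<in> borel_measurable M" by (rule borel_measurable_cond_exp2)
    have "AE \<omega> in M. p s \<omega> = real_cond_exp M (F s) ?f \<omega>" using p s by (simp add: bounded_version_def)
    then show "AE \<omega>\<in>A in M. real_cond_exp M (F s) ?f \<omega> = p s \<omega>" by eventually_elim simp
  qed (rule pm)
  finally show ?thesis by (simp add: exp_minus field_simps)
qed

text \<open>
  The derivative of the cost is integration against the subgradient: this is where the running part
  of the derivative, a time integral of \<open>c' \<eta>\<close>, is exchanged for the integral of \<open>p\<close> against \<open>d\<eta>\<close>.
\<close>

lemma
  assumes \<theta>: "\<theta> \<in> controls" and \<eta>: "\<eta> \<in> controls" and p: "bounded_version \<theta> p"
  shows subgradient_integrable: "integrable (doleans M \<eta>)
    (\<lambda>z. (k (snd z) (fst z) + p (snd z) (fst z)) * exp (- r * snd z))"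
    and marginal_cost_eq_subgradient: "marginal_cost \<theta> \<eta> =
      (LINT z|doleans M \<eta>. (k (snd z) (fst z) + p (snd z) (fst z)) * exp (- r * snd z))"
proof -
  have pr: "right_continuous_process M p" and pb: "\<And>t \<omega>. 0 \<le> t \<Longrightarrow> \<omega> \<in> space M \<Longrightarrow> \<bar>p t \<omega>\<bar> \<le> K / r"
    using p by (auto simp: bounded_version_def)
  have pm: "(\<lambda>z. p (snd z) (fst z) * exp (- r * snd z)) \<in> borel_measurable (timed M)"
    by (intro borel_measurable_times right_continuous_process_measurable[OF pr] discount_measurable)
  have pint: "integrable (doleans M \<eta>) (\<lambda>z. p (snd z) (fst z) * exp (- r * snd z))"
  proof (rule integrable_doleans_bounded[OF control_increasing[OF \<eta>] control_finite[OF \<eta>] pm])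
    show "\<bar>p (snd (\<omega>, t)) (fst (\<omega>, t)) * exp (- r * snd (\<omega>, t))\<bar> \<le> K / r * exp (- r * t)"
      if "\<omega> \<in> space M" "0 \<le> t" for \<omega> t
      unfolding fst_conv snd_conv abs_mult abs_exp_cancel by (intro mult_right_mono pb that) simp
  qed (use K_nonneg r_pos in simp)
  show "integrable (doleans M \<eta>) (\<lambda>z. (k (snd z) (fst z) + p (snd z) (fst z)) * exp (- r * snd z))"
    unfolding distrib_right by (intro Bochner_Integration.integrable_add intervention_integrable \<eta> pint)
  have "(LINT z|doleans M \<eta>. p (snd z) (fst z) * exp (- r * snd z)) =
    (LINT z|timed M. marginal \<theta> z * \<eta> (snd z) (fst z) * exp (- r * snd z))"
  proof (rule projection_duality[OF subalgebra filtration r_pos control_increasing[OF \<eta>]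
    control_adapted[OF \<eta>]
        control_finite[OF \<eta>] marginal_control_measurable[OF \<theta>] _ pr pb version_projection[OF \<theta> p]])
    show "\<bar>marginal \<theta> (\<omega>, t)\<bar> \<le> K" if "\<omega> \<in> space M" "0 \<le> t" for \<omega> t
      using marginal_bound[OF \<theta>, of "(\<omega>, t)"] that by (simp add: space_pair_measure space_halfline)
  qed
  then show "marginal_cost \<theta> \<eta> =
      (LINT z|doleans M \<eta>. (k (snd z) (fst z) + p (snd z) (fst z)) * exp (- r * snd z))"
    unfolding marginal_cost_def intervention_def distrib_right
    using Bochner_Integration.integral_add[OF intervention_integrable[OF \<eta>] pint] by simp
qed

lemma ext_integral_subgradient:
  assumes \<theta>: "\<theta> \<in> controls" and \<eta>: "\<eta> \<in> controls" and p: "bounded_version \<theta> p"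
  shows "ext_integral M (\<lambda>\<omega>. ext_integral (stieltjes (\<lambda>t. \<eta> t \<omega>))
    (\<lambda>t. ereal ((k t \<omega> + p t \<omega>) * exp (- r * t))))
    = ereal (marginal_cost \<theta> \<eta>)"
proof -
  note inc = control_increasing[OF \<eta>] and int = subgradient_integrable[OF \<theta> \<eta> p]
  have "AE \<omega> in M. ext_integral (stieltjes (\<lambda>t. \<eta> t \<omega>)) (\<lambda>t. ereal ((k t \<omega> + p t \<omega>) * exp (- r * t)))
    = ereal (LINT t|stieltjes (\<lambda>t. \<eta> t \<omega>). (k t \<omega> + p t \<omega>) * exp (- r * t))"
    using AE_integrable_stieltjes[OF inc int] by eventually_elim (simp add: ext_integral_eq_integral)
  then have "ext_integral M (\<lambda>\<omega>. ext_integral (stieltjes (\<lambda>t. \<eta> t \<omega>))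
    (\<lambda>t. ereal ((k t \<omega> + p t \<omega>) * exp (- r * t))))
    = ext_integral M (\<lambda>\<omega>. ereal (LINT t|stieltjes (\<lambda>t. \<eta> t \<omega>). (k t \<omega> + p t \<omega>) * exp (- r * t)))"
    by (rule ext_integral_cong_AE)
  also have "\<dots> = ereal (marginal_cost \<theta> \<eta>)"
    using integrable_integral_stieltjes[OF inc int] integral_doleans[OF inc int]
    unfolding marginal_cost_eq_subgradient[OF \<theta> \<eta> p] by (simp add: ext_integral_eq_integral)
  finally show ?thesis .
qed

lemma AE_right_continuous_nonneg:
  assumes Z: "right_continuous_process M Z" and nonneg: "\<And>t. 0 \<le> t \<Longrightarrow> AE \<omega> in M. 0 \<le> Z t \<omega>"
  shows "AE \<omega> in M. \<forall>t\<ge>0. 0 \<le> Z t \<omega>"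
proof -
  have "AE \<omega> in M. \<forall>n i. 0 \<le> Z (real i / real (Suc n)) \<omega>"
    using nonneg by (intro AE_all_countable[THEN iffD2] allI) simp
  then show ?thesis
    using AE_space
  proof eventually_elim
    case (elim \<omega>)
    show ?case
    proof (intro allI impI)
      fix t :: real assume t: "0 \<le> t"
      have "(\<lambda>n. Z (grid_above n t) \<omega>) \<longlonglongrightarrow> Z t \<omega>"
        using Z elim(2) t by (intro right_continuous_path_grid[of "\<lambda>t. Z t \<omega>"])
          (auto simp: right_continuous_process_def)
      moreover have "0 \<le> Z (grid_above n t) \<omega>" for n using elim(1)
        by (simp add: grid_above_def del: of_nat_Suc)
      ultimately show "0 \<le> Z t \<omega>" by (intro LIMSEQ_le_const) auto
    qed
  qed
qed

lemma right_continuous_process_add: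
  "right_continuous_process M Y \<Longrightarrow> right_continuous_process M Z \<Longrightarrow> right_continuous_process
    M (\<lambda>t \<omega>. Y t \<omega> + Z t \<omega>)"
  unfolding right_continuous_process_def right_continuous_path_def
  by (auto intro!: continuous_intros borel_measurable_add)

lemma marginal_cost_jump:
  assumes \<theta>: "\<theta> \<in> controls" and p: "bounded_version \<theta> p" and t0: "0 \<le> t0" and A: "A \<in> sets (F t0)"
  shows "marginal_cost \<theta> (\<lambda>t \<omega>. indicator A \<omega> * indicator {t0..} t) =
      (LINT \<omega>|M. indicator A \<omega> * ((k t0 \<omega> + p t0 \<omega>) * exp (- r * t0)))"
    and "integrable M (\<lambda>\<omega>. indicator A \<omega> * ((k t0 \<omega> + p t0 \<omega>) * exp (- r * t0)))"
proof -
  let ?J = "\<lambda>t \<omega>. indicator A \<omega> * indicator {t0..} t :: real"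
  have J: "?J \<in> controls" by (rule jump_control[OF t0 A])
  note inc = control_increasing[OF J] and int = subgradient_integrable[OF \<theta> J p]
  have pr: "right_continuous_process M p" using p by (simp add: bounded_version_def)
  have path: "(LINT t|stieltjes (\<lambda>t. ?J t \<omega>). (k t \<omega> + p t \<omega>) * exp (- r * t)) =
      indicator A \<omega> * ((k t0 \<omega> + p t0 \<omega>) * exp (- r * t0))" if \<omega>: "\<omega> \<in> space M" for \<omega>
  proof -
    have m: "(\<lambda>t. (k t \<omega> + p t \<omega>) * exp (- r * t)) \<in> borel_measurable halfline"
      using right_continuous_process_path_measurable[OF k \<omega>]
        right_continuous_process_path_measurable[OF pr \<omega>]
        halfline_measurable_id by measurable
    show ?thesis
      unfolding jump_path using integral_stieltjes_step[OF t0 m] integral_stieltjes_zero[OF m]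
        by (cases "\<omega> \<in> A") simp_all
  qed
  show "marginal_cost \<theta> ?J = (LINT \<omega>|M. indicator A \<omega> * ((k t0 \<omega> + p t0 \<omega>) * exp (- r * t0)))"
    unfolding marginal_cost_eq_subgradient[OF \<theta> J p] integral_doleans[OF inc int] fst_conv snd_conv
    by (intro Bochner_Integration.integral_cong path refl)
  show "integrable M (\<lambda>\<omega>. indicator A \<omega> * ((k t0 \<omega> + p t0 \<omega>) * exp (- r * t0)))"
    using integrable_integral_stieltjes[OF inc int] unfolding fst_conv snd_conv
    by (subst (asm) Bochner_Integration.integrable_cong[OF refl path])
qed

text \<open>
  Testing with jumps on events of \<open>F s\<close> shows that the \<open>F s\<close>-measurable version of \<open>k s + p s\<close> is
  almost surely nonnegative for each fixed \<open>s\<close>; right-continuity makes the null set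
  independent of \<open>s\<close>.
\<close>

lemma marginal_cost_nonneg_iff:
  assumes \<theta>: "\<theta> \<in> controls" and p: "bounded_version \<theta> p"
  shows "(\<forall>\<eta>\<in>controls. 0 \<le> marginal_cost \<theta> \<eta>) \<longleftrightarrow> (AE \<omega> in M. \<forall>t\<ge>0. 0 \<le> k t \<omega> + p t \<omega>)"
proof
  assume nonneg: "\<forall>\<eta>\<in>controls. 0 \<le> marginal_cost \<theta> \<eta>"
  have pr: "right_continuous_process M p" using p by (simp add: bounded_version_def)
  show "AE \<omega> in M. \<forall>t\<ge>0. 0 \<le> k t \<omega> + p t \<omega>"
  proof (rule AE_right_continuous_nonneg[OF right_continuous_process_add[OF k pr]])
    fix s :: real assume s: "0 \<le> s"
    let ?E = "real_cond_exp M (F s) (\<lambda>\<omega>. exp (r * s) * discounted_tail r (marginal \<theta>) s \<omega>)"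
    have version: "AE \<omega> in M. p s \<omega> = ?E \<omega>" using p s by (simp add: bounded_version_def)
    have [measurable]: "k s \<in> borel_measurable (F s)" "?E \<in> borel_measurable (F s)"
      using k_adapted s by (auto simp: adapted_def)
    (* p s itself may fail to be F s-measurable, so the event is defined
      by the conditional expectation. *)
    define A where "A = {\<omega> \<in> space (F s). k s \<omega> + ?E \<omega> < 0}"
    have A: "A \<in> sets (F s)" unfolding A_def by measurable
    have sp: "space (F s) = space M" using subalgebra[OF s] by (simp add: subalgebra_def)
    let ?u = "\<lambda>\<omega>. - (indicator A \<omega> * ((k s \<omega> + p s \<omega>) * exp (- r * s)))"
    have int: "integrable M ?u" using marginal_cost_jump(2)[OF \<theta> p s A] by simp
    have upos: "AE \<omega> in M. 0 \<le> ?u \<omega>"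
      using version
    proof eventually_elim
      case (elim \<omega>)
      then show ?case by (auto simp: indicator_def A_def mult_nonpos_nonneg)
    qed
    have "0 \<le> (LINT \<omega>|M. indicator A \<omega> * ((k s \<omega> + p s \<omega>) * exp (- r * s)))"
      using bspec[OF nonneg jump_control[OF s A]] unfolding marginal_cost_jump(1)[OF \<theta> p s A] .
    then have "(LINT \<omega>|M. ?u \<omega>) \<le> 0" by simp
    moreover have "0 \<le> (LINT \<omega>|M. ?u \<omega>)" by (rule integral_nonneg_AE[OF upos])
    ultimately have "AE \<omega> in M. ?u \<omega> = 0" using integral_nonneg_eq_0_iff_AE[OF int upos] by simp
    then show "AE \<omega> in M. 0 \<le> k s \<omega> + p s \<omega>"
      using version AE_space
    proof eventually_elim
      case (elim \<omega>)
      show ?case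
      proof (rule ccontr)
        assume neg: "\<not> 0 \<le> k s \<omega> + p s \<omega>"
        then have "\<omega> \<in> A" using elim(2,3) by (simp add: A_def sp)
        then show False using elim(1) neg by simp
      qed
    qed
  qed
next
  assume nonneg: "AE \<omega> in M. \<forall>t\<ge>0. 0 \<le> k t \<omega> + p t \<omega>"
  show "\<forall>\<eta>\<in>controls. 0 \<le> marginal_cost \<theta> \<eta>"
  proof
    fix \<eta> assume \<eta>: "\<eta> \<in> controls"
    show "0 \<le> marginal_cost \<theta> \<eta>"
      unfolding marginal_cost_eq_subgradient[OF \<theta> \<eta> p]
        integral_doleans[OF control_increasing[OF \<eta>] subgradient_integrable[OF \<theta> \<eta> p]]
    proof (rule integral_nonneg_AE)
      show "AE \<omega> in M. 0 \<le> (LINT t|stieltjes (\<lambda>t. \<eta> t \<omega>). (k (snd (\<omega>, t)) (fst (\<omega>, t))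
        + p (snd (\<omega>, t)) (fst (\<omega>, t))) * exp (- r * snd (\<omega>, t)))"
        using nonneg
      proof eventually_elim
        case (elim \<omega>)
        then show ?case by (intro integral_nonneg_AE AE_I2) (simp add: space_stieltjes)
      qed
    qed
  qed
qed

text \<open>
  The conditional expectation of a variable bounded by \<open>K / r\<close> obeys the same bound almost surely,
  simultaneously at all times by right-continuity. Clamping the given version to this bound thus
  changes it only on a null set.
\<close>

lemma bounded_version_exists:
  assumes \<theta>: "\<theta> \<in> controls" and p: "subgradient_version M F X r c' \<theta> p"
  obtains q where "bounded_version \<theta> q" "AE \<omega> in M. \<forall>t\<ge>0. p t \<omega> = q t \<omega>"
proof
  define q where "q t \<omega> = max (- (K / r)) (min (K / r) (p t \<omega>))" for t \<omega>
  have pr: "right_continuous_process M p"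
    using p by (auto simp: subgradient_version_def right_continuous_process_def
      cadlag_imp_right_continuous_path)
  have Kr: "0 \<le> K / r" using K_nonneg r_pos by simp
  have tail: "(LINT u:{s..}|lborel. c' u (X u \<omega>) (\<theta> u \<omega>) * exp (- r * (u - s)))
    = exp (r * s) * discounted_tail r (marginal \<theta>) s \<omega>"
    if s: "0 \<le> s" for s \<omega>
  proof -
    have "exp (r * s) * discounted_tail r (marginal \<theta>) s \<omega> =
      (LINT u|lborel. exp (r * s) * (indicator {0..}
        u * (indicator {s..} u * (c' u (X u \<omega>) (\<theta> u \<omega>) * exp (- r * u)))))"
      unfolding discounted_tail_def marginal_def fst_conv snd_conv
        by (subst integral_restrict_space) auto
    also have "\<dots> = (LINT u:{s..}|lborel. c' u (X u \<omega>) (\<theta> u \<omega>) * exp (- r * (u - s)))"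
      unfolding set_lebesgue_integral_def
    proof (intro Bochner_Integration.integral_cong refl)
      fix u
      have "exp (r * s) * exp (- r * u) = exp (- r * (u - s))"
        unfolding exp_add[symmetric] by (simp add: algebra_simps)
      then show "exp (r * s) * (indicator {0..}
        u * (indicator {s..} u * (c' u (X u \<omega>) (\<theta> u \<omega>) * exp (- r * u))))
        = indicator {s..} u *\<^sub>R (c' u (X u \<omega>) (\<theta> u \<omega>) * exp (- r * (u - s)))"
        using s by (cases "s \<le> u") (simp_all add: mult.left_commute)
    qed
    finally show ?thesis by simp
  qed
  have version: "AE \<omega> in M. p s \<omega> = real_cond_exp
    M (F s) (\<lambda>\<omega>. exp (r * s) * discounted_tail r (marginal \<theta>) s \<omega>) \<omega>"
    if s: "0 \<le> s" for s
    using p s unfolding subgradient_version_def tail[OF s, symmetric] by blast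
  have bound: "AE \<omega> in M. 0 \<le> K / r - \<bar>p s \<omega>\<bar>" if s: "0 \<le> s" for s
  proof -
    interpret S: finite_measure_subalgebra M "F s" by (rule finite_measure_subalgebra_F[OF s])
    let ?f = "\<lambda>\<omega>. exp (r * s) * discounted_tail r (marginal \<theta>) s \<omega>"
    note t = marginal_tail[OF \<theta> s]
    have "AE \<omega> in M. real_cond_exp M (F s) ?f \<omega> \<le> K / r"
      using t(2) by (intro S.real_cond_exp_le_c[OF t(1)] AE_I2) (auto simp: abs_le_iff)
    moreover have "AE \<omega> in M. - (K / r) \<le> real_cond_exp M (F s) ?f \<omega>"
      using t(2) by (intro S.real_cond_exp_ge_c[OF t(1)] AE_I2) (auto simp: abs_le_iff minus_le_iff)
    ultimately show ?thesis using version[OF s] by eventually_elim (simp add: abs_le_iff)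
  qed
  have "right_continuous_process M (\<lambda>s \<omega>. K / r - \<bar>p s \<omega>\<bar>)"
    using pr unfolding right_continuous_process_def right_continuous_path_def
      by (auto intro!: continuous_intros)
  then have "AE \<omega> in M. \<forall>t\<ge>0. 0 \<le> K / r - \<bar>p t \<omega>\<bar>"
    by (rule AE_right_continuous_nonneg) (rule bound)
  then show eq: "AE \<omega> in M. \<forall>t\<ge>0. p t \<omega> = q t \<omega>"
    by eventually_elim (auto simp: q_def abs_le_iff)
  show "bounded_version \<theta> q"
    unfolding bounded_version_def
  proof (intro conjI allI impI ballI)
    show "right_continuous_process M q"
      using pr unfolding right_continuous_process_def right_continuous_path_def q_def
        by (auto intro!: continuous_intros)
    show "\<bar>q t \<omega>\<bar> \<le> K / r" for t \<omega> using Kr by (auto simp: q_def abs_le_iff)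
    fix s :: real assume s: "0 \<le> s"
    show "AE \<omega> in M. q s \<omega> = real_cond_exp M (F s)
      (\<lambda>\<omega>. exp (r * s) * discounted_tail r (marginal \<theta>) s \<omega>) \<omega>"
      using eq version[OF s] by eventually_elim (simp add: s)
  qed
qed

text \<open>
  The constant control \<open>y\<close> is \<open>y\<close> times a unit jump at time \<open>0\<close>; it serves as the reference control.
\<close>

theorem optimal_control_iff_subgradient:
  assumes \<theta>: "\<theta> \<in> controls" and p: "subgradient_version M F X r c' \<theta> p" and y: "0 \<le> y"
    and upper: "ext_integral M (\<lambda>\<omega>. ext_integral
      halfline (\<lambda>t. ereal (c t (X t \<omega>) y * exp (- r * t)))) < \<infinity>"
    and lower: "- \<infinity> < ext_integral M (\<lambda>\<omega>. ext_integral halfline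
       (\<lambda>t. min_cost r c t (X t \<omega>) (k t \<omega>) * ereal (exp (- r * t))))"
  shows "optimal_control M F X r c k \<theta> \<longleftrightarrow>
     (AE \<omega> in M. \<forall>t\<ge>0. k t \<omega> + p t \<omega> \<ge> 0) \<and>
     ext_integral M (\<lambda>\<omega>. ext_integral (stieltjes (\<lambda>t. \<theta> t \<omega>))
       (\<lambda>t. ereal ((k t \<omega> + p t \<omega>) * exp (- r * t)))) = 0"
proof -
  obtain q where q: "bounded_version \<theta> q" and pq: "AE \<omega> in M. \<forall>t\<ge>0. p t \<omega> = q t \<omega>"
    by (rule bounded_version_exists[OF \<theta> p])
  have F0: "space M \<in> sets (F 0)" using subalgebra[of 0] by (auto simp: subalgebra_def dest: sym)
  let ?one = "\<lambda>t \<omega>. indicator (space M) \<omega> * indicator {0..} t :: real"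
  (* The vanishing second term brings the multiple into the form of the cone property. *)
  let ?\<eta> = "\<lambda>t \<omega>. y * ?one t \<omega> + 0 * ?one t \<omega>"
  have one: "?one \<in> controls" by (rule jump_control[OF order_refl F0])
  have \<eta>: "?\<eta> \<in> controls" by (rule controls_cone[OF one one y order_refl])
  have \<eta>_eq: "c t (X t \<omega>) (?\<eta> t \<omega>) * exp (- r * t) = c t (X t \<omega>) y * exp (- r * t)"
    if "\<omega> \<in> space M" "t \<in> space halfline" for \<omega> t
    using that by (simp add: space_halfline)
  have AE0: "AE \<omega> in M. integrable halfline (\<lambda>t. c t (X t \<omega>) (?\<eta> t \<omega>) * exp (- r * t))"
    using AE_reference_integrable[OF y upper lower] AE_space
  proof eventually_elim
    case (elim \<omega>)
    then show ?case by (subst Bochner_Integration.integrable_cong[OF refl \<eta>_eq]) auto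
  qed
  have int0: "integrable M (\<lambda>\<omega>. LINT t|halfline. c t (X t \<omega>) (?\<eta> t \<omega>) * exp (- r * t))"
    using reference_integrable[OF y upper lower]
    by (subst Bochner_Integration.integrable_cong[OF refl
      Bochner_Integration.integral_cong[OF refl \<eta>_eq]]) auto
  have "optimal_control M F X r c k \<theta> \<longleftrightarrow>
    (\<forall>\<eta>\<in>controls. 0 \<le> marginal_cost \<theta> \<eta>) \<and> marginal_cost \<theta> \<theta> = 0"
    unfolding optimal_control_iff_total_difference[OF \<eta> \<theta> AE0 int0] optimal_iff_marginal_cost[OF \<theta>]
    by (rule marginal_cost_minimal_iff[OF \<theta>])
  moreover have "(\<forall>\<eta>\<in>controls. 0 \<le> marginal_cost \<theta> \<eta>) \<longleftrightarrow> (AE \<omega> in M. \<forall>t\<ge>0. k t \<omega> + p t \<omega> \<ge> 0)"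
    unfolding marginal_cost_nonneg_iff[OF \<theta> q]
  proof (rule eventually_subst)
    show "AE \<omega> in M. (\<forall>t\<ge>0. 0 \<le> k t \<omega> + q t \<omega>) = (\<forall>t\<ge>0. 0 \<le> k t \<omega> + p t \<omega>)"
      using pq by eventually_elim simp
  qed
  moreover have "ext_integral M (\<lambda>\<omega>. ext_integral (stieltjes (\<lambda>t. \<theta> t \<omega>))
    (\<lambda>t. ereal ((k t \<omega> + p t \<omega>) * exp (- r * t))))
      = ereal (marginal_cost \<theta> \<theta>)"
    unfolding ext_integral_subgradient[OF \<theta> \<theta> q, symmetric]
  proof (rule ext_integral_cong_AE)
    show "AE \<omega> in M. ext_integral (stieltjes (\<lambda>t. \<theta> t \<omega>)) (\<lambda>t. ereal ((k t \<omega> + p t \<omega>) * exp (- r * t)))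
      = ext_integral (stieltjes (\<lambda>t. \<theta> t \<omega>)) (\<lambda>t. ereal ((k t \<omega> + q t \<omega>) * exp (- r * t)))"
      using pq
    proof eventually_elim
      case (elim \<omega>)
      then show ?case by (intro ext_integral_cong_AE AE_I2) (simp add: space_stieltjes)
    qed
  qed
  ultimately show ?thesis by simp
qed

end

theorem theorem6:
  fixes P :: "real \<Rightarrow> 'a measure"
    and F :: "real \<Rightarrow> 'a measure"
    and X k \<theta> p :: "real \<Rightarrow> 'a \<Rightarrow> real"
    and c c' :: "real \<Rightarrow> real \<Rightarrow> real \<Rightarrow> real"
    and r x :: real
  assumes "r > 0"
    and "\<And>y. filtered_prob_space (P y) F"
    and "\<And>y z. sets (P y) = sets (P z)"
    and "adapted F X"
    and "\<And>y. levy_process (P y) X y"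
    and c_measurable: "(\<lambda>(t, x, z). c t x z) \<in>
          borel_measurable (restrict_space borel ({0..} \<times> UNIV \<times> {0..}))"
    and A1: "adapted F k"
      "\<And>\<omega>. \<omega> \<in> space (P x) \<Longrightarrow> cadlag (\<lambda>t. k t \<omega>)"
      "\<And>t \<omega>. t \<ge> 0 \<Longrightarrow> \<omega> \<in> space (P x) \<Longrightarrow> k t \<omega> \<ge> 0"
      "(\<integral>\<^sup>+ \<omega>. (SUP t\<in>{0..}. ennreal (\<bar>k t \<omega>\<bar>\<^sup>2)) \<partial>P x) < \<infinity>"
    and A2: "\<And>t x z. t \<ge> 0 \<Longrightarrow> z \<ge> 0 \<Longrightarrow>
          (c t x has_real_derivative c' t x z) (at z within {0..})"
      "\<And>t x. t \<ge> 0 \<Longrightarrow> continuous_on {0..} (c' t x)"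
      "\<And>t x. t \<ge> 0 \<Longrightarrow> strict_mono_on {0..} (c' t x)"
      "\<exists>K. \<forall>t\<ge>0. \<forall>x. \<forall>z\<ge>0. \<bar>c' t x z\<bar> \<le> K"
    and A3: "\<exists>y\<ge>0. \<forall>x. ext_integral (P x) (\<lambda>\<omega>. ext_integral (restrict_space lborel {0..})
          (\<lambda>t. ereal (c t (X t \<omega>) y * exp (- r * t)))) < \<infinity>"
    and A4: "ext_integral (P x) (\<lambda>\<omega>. ext_integral (restrict_space lborel {0..})
          (\<lambda>t. min_cost r c t (X t \<omega>) (k t \<omega>) * ereal (exp (- r * t)))) > -\<infinity>"
    and "\<theta> \<in> singular_controls (P x) F r"
    and "subgradient_version (P x) F X r c' \<theta> p"
  shows "optimal_control (P x) F X r c k \<theta> \<longleftrightarrow>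
     (AE \<omega> in P x. \<forall>t\<ge>0. k t \<omega> + p t \<omega> \<ge> 0) \<and>
     ext_integral (P x) (\<lambda>\<omega>. ext_integral (stieltjes (\<lambda>t. \<theta> t \<omega>))
       (\<lambda>t. ereal ((k t \<omega> + p t \<omega>) * exp (- r * t)))) = 0"
proof -
  obtain K where K: "\<And>t x z. t \<ge> 0 \<Longrightarrow> z \<ge> 0 \<Longrightarrow> \<bar>c' t x z\<bar> \<le> K" using A2(4) by blast
  obtain y where y: "0 \<le> y" "ext_integral (P x) (\<lambda>\<omega>. ext_integral (restrict_space lborel {0..})
          (\<lambda>t. ereal (c t (X t \<omega>) y * exp (- r * t)))) < \<infinity>" using A3 by blast
  have filt: "filtered_prob_space (P x) F" by (rule assms(2))
  have levy: "levy_process (P x) X x" by (rule assms(5))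
  interpret prob_space "P x" using filt by (simp add: filtered_prob_space_def)
  interpret control_problem "P x" F X k c c' r K
  proof
    show "right_continuous_process (P x) X"
      using levy by (auto simp: levy_process_def right_continuous_process_def cadlag_imp_right_continuous_path)
    show "mono_on {0..} (c' t x)" if "0 \<le> t" for t x
      using A2(3)[OF that] by (rule strict_mono_on_imp_mono_on)
    show "right_continuous_path (\<lambda>t. k t \<omega>)" if "\<omega> \<in> space (P x)" for \<omega>
      using A1(2)[OF that] by (rule cadlag_imp_right_continuous_path)
  qed (use filt assms(1) c_measurable A1 A2 K in \<open>auto simp: filtered_prob_space_def\<close>)
  show ?thesis
    by (rule optimal_control_iff_subgradient[OF assms(17,18) y A4])
qed

end
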